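(* Let $G\subseteq\mathrm{GL}(n)$ be a symmetric subgroup with $K=G\cap U(n)$, and let $\pi\colon G\to\mathrm{GL}(V)$ be a rational representation on a finite-dimensional complex vector space with a $K$-invariant Hermitian inner product. Let $v\in V$ with $\operatorname{cap}(v)>0$, let $0<\varepsilon<1/2$ and $C\ge\log(\|v\|/\operatorname{cap}(v))$. Set $\gamma:=\min\{\gamma(\pi),1\}$, $N:=\max\{N(\pi),1/2\}$, and $\kappa:=2n\,\bigl(e^{2C}/2\varepsilon\bigr)^{1/\gamma}$. Then the second order algorithm described in the context, run with robustness parameter $R=4N$, regularization parameter $\kappa$, accuracy $\varepsilon$, and $$T\ge 24e^2\,\frac{N\sqrt n}{\gamma}\Bigl(\log\frac n\varepsilon+C\Bigr)\log\frac C\varepsilon$$ iterations, returns a group element $g\in G$ such that $\log\|\pi(g)v\|\le\log\operatorname{cap}(v)+3\varepsilon$.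
   Context: Symmetric subgroup: a connected, Zariski-closed subgroup $G\subseteq\mathrm{GL}(n)$ (over $\mathbb C$) with $g^\dagger\in G$ for all $g\in G$. $\mathrm{Lie}(K)=\{X:e^{tX}\in K\ \forall t\in\mathbb R\}$, so $i\mathrm{Lie}(K)\subseteq\mathrm{Herm}(n)$. Rational representation: homomorphism whose matrix entries are polynomials in the $g_{i,j}$ and $\det(g)^{-1}$; $\pi(K)$ acts by unitary maps. $\log$ is natural, and $\log 0=-\infty$. Capacity: $\operatorname{cap}(v)=\inf_{g\in G}\|\pi(g)v\|$. Let $\Pi(H)=\partial_{t=0}\pi(e^{tH})$. Weight norm: $N(\pi)=\max\{\|\Pi(H)\|_{\mathrm{op}}:H\in i\mathrm{Lie}(K),\|H\|_F=1\}$. Weights: let $T_K$ be a maximal connected commutative subgroup of $K$, assumed to consist of diagonal matrices, and let $T_G=T_K\exp(i\mathrm{Lie}(T_K))$. Then $V=\bigoplus_{\omega\in\Omega(\pi)}V_\omega$, $V_\omega\ne0$, $\Omega(\pi)\subset i\mathrm{Lie}(T_K)$ finite, with $\pi(e^H)w=e^{\operatorname{tr}[H\omega]}w$ for $w\in V_\omega$ and $H\in\mathrm{Lie}(T_G)$. Weight margin: $\gamma(\pi)$ is the minimum Frobenius distance from $0$ to $\operatorname{conv}(\Gamma)$ over nonempty $\Gamma\subseteq\Omega(\pi)$ with $0\notin\operatorname{conv}(\Gamma)$ ($+\infty$ if there is none). For sufficiently differentiable left-$K$-invariant $F\colon G\to\mathbb R$, the geodesic gradient $\nabla F(g)\in i\mathrm{Lie}(K)$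 and Hessian $\nabla^2F(g)$ are given by $\operatorname{tr}[\nabla F(g)H]=\partial_{t=0}F(e^{tH}g)$ and $\operatorname{tr}[\nabla^2F(g)(H\otimes H)]=\partial^2_{t=0}F(e^{tH}g)$ for $H\in i\mathrm{Lie}(K)$. Algorithm: let $\operatorname{reg}(g)=\|g\|_F^2+\|g^{-1}\|_F^2$ and $F_{v,\kappa,\varepsilon}(g)=\log\|\pi(g)v\|+\frac{\varepsilon}{\kappa}\operatorname{reg}(g)$. Set $g_0=I$. For $t=0,\dots,T-1$: let $W=\nabla F_{v,\kappa,\varepsilon}(g_t)$, $Q=\nabla^2F_{v,\kappa,\varepsilon}(g_t)$, let $H_t$ be a minimizer of the convex quadratic $\operatorname{tr}[WH]+\frac1{2e}\operatorname{tr}[Q(H\otimes H)]$ over $\{H\in i\mathrm{Lie}(K):\|H\|_F\le 1/R\}$, and set $g_{t+1}=e^{H_t/e^2}g_t$. Return $g_T$. *)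

theory Defs
  imports "HOL-Analysis.Analysis" "HOL-Algebra.Group"
begin

section \<open>Matrices\<close>

definition dagger :: "complex^'n^'m \<Rightarrow> complex^'m^'n" where
  "dagger A = transpose (map_matrix cnj A)"

definition cscale :: "complex \<Rightarrow> complex^'n^'m \<Rightarrow> complex^'n^'m" where
  "cscale c A = map_matrix (\<lambda>x. c * x) A"

primrec matpow :: "complex^'n^'n \<Rightarrow> nat \<Rightarrow> complex^'n^'n" where
  "matpow A 0 = mat 1"
| "matpow A (Suc k) = A ** matpow A k"

text \<open>The library's \<open>exp\<close> is not available on the type of matrices, which is not an
  instance of the class of normed algebras.\<close>

definition mexp :: "complex^'n^'n \<Rightarrow> complex^'n^'n" where
  "mexp A = (\<Sum>k. (1 / fact k) *\<^sub>R matpow A k)"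

definition kron :: "complex^'n^'n \<Rightarrow> complex^'n^'n \<Rightarrow> complex^('n \<times> 'n)^('n \<times> 'n)" where
  "kron A B = (\<chi> p q. A $ fst p $ fst q * B $ snd p $ snd q)"

text \<open>Throughout, \<open>norm\<close> on matrices is the Frobenius norm: the library's norm on
  \<open>complex^'n^'n\<close> is the Euclidean norm of the Euclidean norms of the rows.\<close>


section \<open>Symmetric subgroups\<close>

definition GL :: "(complex^'n^'n) monoid" where
  "GL = \<lparr>carrier = {A. invertible A}, mult = (**), one = mat 1\<rparr>"

definition unitary_group :: "(complex^'n^'n) set" where
  "unitary_group = {g. dagger g ** g = mat 1}"

text \<open>Complex polynomials in a given family \<open>S\<close> of complex-valued functions.\<close>

inductive polynomial_in :: "('a \<Rightarrow> complex) set \<Rightarrow> ('a \<Rightarrow> complex) \<Rightarrow> bool" for S where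
  gen: "f \<in> S \<Longrightarrow> polynomial_in S f"
| const: "polynomial_in S (\<lambda>_. c)"
| add: "polynomial_in S f \<Longrightarrow> polynomial_in S g \<Longrightarrow> polynomial_in S (\<lambda>x. f x + g x)"
| mult: "polynomial_in S f \<Longrightarrow> polynomial_in S g \<Longrightarrow> polynomial_in S (\<lambda>x. f x * g x)"

definition matrix_entries :: "(complex^'n^'n \<Rightarrow> complex) set" where
  "matrix_entries = {(\<lambda>g. g $ i $ j) | i j. True}"

definition Zariski_closed :: "(complex^'n^'n) set \<Rightarrow> bool" where
  "Zariski_closed G \<longleftrightarrow>
     (\<exists>P. (\<forall>p\<in>P. polynomial_in matrix_entries p) \<and> G = {g \<in> carrier GL. \<forall>p\<in>P. p g = 0})"

text \<open>Connectedness is taken in the Euclidean topology; for Zariski-closed subgroups of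
  \<open>GL\<close> over the complex numbers it coincides with Zariski connectedness.\<close>

definition symmetric_subgroup :: "(complex^'n^'n) set \<Rightarrow> bool" where
  "symmetric_subgroup G \<longleftrightarrow>
     subgroup G GL \<and> Zariski_closed G \<and> connected G \<and> (\<forall>g\<in>G. dagger g \<in> G)"

definition Lie :: "(complex^'n^'n) set \<Rightarrow> (complex^'n^'n) set" where
  "Lie S = {X. \<forall>t::real. mexp (t *\<^sub>R X) \<in> S}"

definition iLie :: "(complex^'n^'n) set \<Rightarrow> (complex^'n^'n) set" where
  "iLie S = cscale \<i> ` Lie S"

definition connected_commutative_subgroup_of ::
    "(complex^'n^'n) set \<Rightarrow> (complex^'n^'n) set \<Rightarrow> bool" where
  "connected_commutative_subgroup_of K S \<longleftrightarrow>
     subgroup S GL \<and> S \<subseteq> K \<and> connected S \<and> (\<forall>a\<in>S. \<forall>b\<in>S. a ** b = b ** a)"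

definition maximal_torus :: "(complex^'n^'n) set \<Rightarrow> (complex^'n^'n) set \<Rightarrow> bool" where
  "maximal_torus K S \<longleftrightarrow> connected_commutative_subgroup_of K S \<and>
     (\<forall>S'. connected_commutative_subgroup_of K S' \<and> S \<subseteq> S' \<longrightarrow> S' = S)"

definition diagonal_matrices :: "(complex^'n^'n) set" where
  "diagonal_matrices = {A. \<forall>i j. i \<noteq> j \<longrightarrow> A $ i $ j = 0}"

definition complexified_torus :: "(complex^'n^'n) set \<Rightarrow> (complex^'n^'n) set" where
  "complexified_torus TK = {t ** mexp H | t H. t \<in> TK \<and> H \<in> iLie TK}"


section \<open>Rational representations\<close>

definition rational_representation ::
    "(complex^'n^'n) set \<Rightarrow> (complex^'n^'n \<Rightarrow> complex^'m^'m) \<Rightarrow> bool" where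
  "rational_representation G \<pi> \<longleftrightarrow>
     \<pi> \<in> hom (GL\<lparr>carrier := G\<rparr>) GL \<and>
     (\<forall>k l. \<exists>p. polynomial_in (insert (\<lambda>g. inverse (det g)) matrix_entries) p \<and>
                (\<forall>g\<in>G. \<pi> g $ k $ l = p g))"

text \<open>Up to a choice of basis, a nonzero finite-dimensional complex vector space with a Hermitian
  inner product is \<open>complex^'m\<close> with an arbitrary such product \<open>h\<close>, linear in its second argument.\<close>

definition hermitian_inner_product :: "(complex^'m \<Rightarrow> complex^'m \<Rightarrow> complex) \<Rightarrow> bool" where
  "hermitian_inner_product h \<longleftrightarrow>
     (\<forall>x y z. h x (y + z) = h x y + h x z) \<and>
     (\<forall>x y c. h x (c *s y) = c * h x y) \<and>
     (\<forall>x y. h y x = cnj (h x y)) \<and>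
     (\<forall>x. x \<noteq> 0 \<longrightarrow> Re (h x x) > 0)"

definition invariant_inner_product ::
    "(complex^'n^'n) set \<Rightarrow> (complex^'n^'n \<Rightarrow> complex^'m^'m) \<Rightarrow>
     (complex^'m \<Rightarrow> complex^'m \<Rightarrow> complex) \<Rightarrow> bool" where
  "invariant_inner_product K \<pi> h \<longleftrightarrow> (\<forall>k\<in>K. \<forall>x y. h (\<pi> k *v x) (\<pi> k *v y) = h x y)"

definition hnorm :: "(complex^'m \<Rightarrow> complex^'m \<Rightarrow> complex) \<Rightarrow> complex^'m \<Rightarrow> real" where
  "hnorm h x = sqrt (Re (h x x))"

definition hopnorm :: "(complex^'m \<Rightarrow> complex^'m \<Rightarrow> complex) \<Rightarrow> complex^'m^'m \<Rightarrow> real" where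
  "hopnorm h A = (SUP x\<in>{x. hnorm h x = 1}. hnorm h (A *v x))"

definition capacity ::
    "(complex^'n^'n) set \<Rightarrow> (complex^'n^'n \<Rightarrow> complex^'m^'m) \<Rightarrow>
     (complex^'m \<Rightarrow> complex^'m \<Rightarrow> complex) \<Rightarrow> complex^'m \<Rightarrow> real" where
  "capacity G \<pi> h v = (INF g\<in>G. hnorm h (\<pi> g *v v))"

definition Lie_rep ::
    "(complex^'n^'n \<Rightarrow> complex^'m^'m) \<Rightarrow> complex^'n^'n \<Rightarrow> complex^'m^'m" where
  "Lie_rep \<pi> H = vector_derivative (\<lambda>t::real. \<pi> (mexp (t *\<^sub>R H))) (at 0)"

text \<open>The element \<open>0\<close> only matters if \<open>Lie K = {0}\<close>, where the maximum is over the empty set and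
  is read as \<open>0\<close>.\<close>

definition weight_norm ::
    "(complex^'n^'n) set \<Rightarrow> (complex^'n^'n \<Rightarrow> complex^'m^'m) \<Rightarrow>
     (complex^'m \<Rightarrow> complex^'m \<Rightarrow> complex) \<Rightarrow> real" where
  "weight_norm K \<pi> h =
     Sup (insert 0 {hopnorm h (Lie_rep \<pi> H) | H. H \<in> iLie K \<and> norm H = 1})"

text \<open>\<open>trace (H ** \<omega>)\<close> is in general complex, since \<open>H\<close> ranges over the complex Lie algebra.\<close>

definition weight_space ::
    "(complex^'n^'n) set \<Rightarrow> (complex^'n^'n \<Rightarrow> complex^'m^'m) \<Rightarrow> complex^'n^'n \<Rightarrow> (complex^'m) set"
  where
  "weight_space TK \<pi> \<omega> =
     {w. \<forall>H\<in>Lie (complexified_torus TK). \<pi> (mexp H) *v w = exp (trace (H ** \<omega>)) *s w}"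

definition weights ::
    "(complex^'n^'n) set \<Rightarrow> (complex^'n^'n \<Rightarrow> complex^'m^'m) \<Rightarrow> (complex^'n^'n) set" where
  "weights TK \<pi> = {\<omega> \<in> iLie TK. weight_space TK \<pi> \<omega> \<noteq> {0}}"

text \<open>The infimum over the empty set is \<open>\<infinity>\<close> in \<open>ereal\<close>.\<close>

definition weight_margin ::
    "(complex^'n^'n) set \<Rightarrow> (complex^'n^'n \<Rightarrow> complex^'m^'m) \<Rightarrow> ereal" where
  "weight_margin TK \<pi> =
     (INF \<Gamma>\<in>{\<Gamma>. \<Gamma> \<subseteq> weights TK \<pi> \<and> \<Gamma> \<noteq> {} \<and> 0 \<notin> convex hull \<Gamma>}.
        ereal (infdist 0 (convex hull \<Gamma>)))"


section \<open>Geodesic derivatives\<close>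

definition geodesic_gradient ::
    "(complex^'n^'n) set \<Rightarrow> (complex^'n^'n \<Rightarrow> real) \<Rightarrow> complex^'n^'n \<Rightarrow> complex^'n^'n" where
  "geodesic_gradient K F g =
     (THE W. W \<in> iLie K \<and>
        (\<forall>H\<in>iLie K. trace (W ** H) =
           complex_of_real (deriv (\<lambda>t::real. F (mexp (t *\<^sub>R H) ** g)) 0)))"

text \<open>The Hessian is a symmetric tensor over the real vector space \<open>iLie K\<close>. The symmetric
  tensors are the real span of the squares \<open>kron X X\<close>, and on them the values
  \<open>trace (Q ** kron H H)\<close> determine \<open>Q\<close>.\<close>

definition geodesic_hessian ::
    "(complex^'n^'n) set \<Rightarrow> (complex^'n^'n \<Rightarrow> real) \<Rightarrow> complex^'n^'n \<Rightarrow>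
     complex^('n \<times> 'n)^('n \<times> 'n)" where
  "geodesic_hessian K F g =
     (THE Q. Q \<in> span ((\<lambda>X. kron X X) ` iLie K) \<and>
        (\<forall>H\<in>iLie K. trace (Q ** kron H H) =
           complex_of_real ((deriv ^^ 2) (\<lambda>t::real. F (mexp (t *\<^sub>R H) ** g)) 0)))"


section \<open>The second order algorithm\<close>

definition reg :: "complex^'n^'n \<Rightarrow> real" where
  "reg g = (norm g)\<^sup>2 + (norm (matrix_inv g))\<^sup>2"

definition objective ::
    "(complex^'n^'n \<Rightarrow> complex^'m^'m) \<Rightarrow> (complex^'m \<Rightarrow> complex^'m \<Rightarrow> complex) \<Rightarrow>
     complex^'m \<Rightarrow> real \<Rightarrow> real \<Rightarrow> complex^'n^'n \<Rightarrow> real" where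
  "objective \<pi> h v \<kappa> \<epsilon> g = ln (hnorm h (\<pi> g *v v)) + \<epsilon> / \<kappa> * reg g"

text \<open>\<open>W\<close> and \<open>Q\<close> are Hermitian, so that both traces are real.\<close>

definition quadratic_model ::
    "complex^'n^'n \<Rightarrow> complex^('n \<times> 'n)^('n \<times> 'n) \<Rightarrow> complex^'n^'n \<Rightarrow> real" where
  "quadratic_model W Q H =
     Re (trace (W ** H)) + 1 / (2 * exp 1) * Re (trace (Q ** kron H H))"

definition second_order_step ::
    "(complex^'n^'n) set \<Rightarrow> (complex^'n^'n \<Rightarrow> real) \<Rightarrow> real \<Rightarrow>
     complex^'n^'n \<Rightarrow> complex^'n^'n \<Rightarrow> bool" where
  "second_order_step K F R g g' \<longleftrightarrow>
     (\<exists>H. is_arg_min (quadratic_model (geodesic_gradient K F g) (geodesic_hessian K F g))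
            (\<lambda>H. H \<in> iLie K \<and> norm H \<le> 1 / R) H \<and>
          g' = mexp ((1 / (exp 1)\<^sup>2) *\<^sub>R H) ** g)"

text \<open>The minimizer in a step need not be unique; this is the set of all possible return values
  after \<open>T\<close> iterations.\<close>

definition second_order_results ::
    "(complex^'n^'n) set \<Rightarrow> (complex^'n^'n \<Rightarrow> complex^'m^'m) \<Rightarrow>
     (complex^'m \<Rightarrow> complex^'m \<Rightarrow> complex) \<Rightarrow> complex^'m \<Rightarrow>
     real \<Rightarrow> real \<Rightarrow> real \<Rightarrow> nat \<Rightarrow> (complex^'n^'n) set" where
  "second_order_results K \<pi> h v R \<kappa> \<epsilon> T =
     {gs T | gs. gs 0 = mat 1 \<and>
        (\<forall>t<T. second_order_step K (objective \<pi> h v \<kappa> \<epsilon>) R (gs t) (gs (Suc t)))}"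

end

theory Submission
  imports Defs "HOL-Computational_Algebra.Polynomial"
begin

text \<open>
  Let \<open>F g = ln |\<pi>(g) v| + (\<epsilon> / \<kappa>) reg g\<close> and \<open>R = 4 N\<close>. The theorem rests on a convergence rate
  for \<open>F\<close> and on a good point to compare with.

  For the rate, observe that along a geodesic \<open>t \<mapsto> exp(t H) g\<close> the function \<open>F\<close> is half the logarithm of a sum of exponentials
  plus sums of exponentials, so its second derivative is nonnegative and its third derivative
  is at most \<open>R |H|\<close> times the second (\<open>F_derivatives\<close>, \<open>third_cumulant_bound\<close>). For \<open>|H| \<le> 1 / R\<close> the
  second derivative therefore changes by at most a factor \<open>e\<close>, and the quadratic model bounds \<open>F\<close> from both
  sides up to that factor (\<open>robust_quadratic_bounds\<close>). Let \<open>D \<ge> 1 / R\<close> bound the distance to a point \<open>g'\<close>. By the lower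
  bound, the minimizer \<open>H\<close> of the model predicts at least the decrease of \<open>F\<close> on the initial fraction \<open>1 / (R D)\<close>
  of the geodesic to \<open>g'\<close>, and by convexity this is at least the same fraction of the gap \<open>F g - F g'\<close>. By the upper
  bound, the step \<open>H / e\<^sup>2\<close> realizes at least a fraction \<open>1 / e\<^sup>2\<close> of the predicted decrease
  (\<open>second_order_step_progress\<close>). So each step shrinks the gap by the factor \<open>1 - 1 / (e\<^sup>2 R D)\<close>.

  To bound the distance, note that the iterates stay in a sublevel set of \<open>F\<close>, which bounds \<open>reg\<close> on them. The polar decomposition
  of \<open>g' g\<^sup>-\<^sup>1\<close> provides the geodesic from \<open>g\<close> to \<open>g'\<close>, up to \<open>K\<close>, and its length is at most
  \<open>(sqrt n / 2) ln (reg g' * reg g)\<close> (\<open>geodesic_between\<close>), so that \<open>D\<close> is logarithmic in \<open>\<kappa>\<close>.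

  As for the comparison point, for every \<open>\<delta> > 0\<close> there is \<open>g'\<close> with \<open>reg g' \<le> \<kappa>\<close> and
  \<open>ln |\<pi>(g') v| \<le> ln cap + \<epsilon> + \<delta>\<close> (\<open>near_optimal_element\<close>). The polar decomposition and the conjugacy of every element of
  \<open>iLie K\<close> into the torus (\<open>conjugate_into_torus\<close>) replace \<open>G\<close> by the complexified torus. There the squared norm is
  a sum of exponentials whose exponents are given by the weights, and the weight margin \<open>\<gamma>\<close> bounds its gradient
  from below by \<open>2 \<gamma>\<close> times the gap to any other value (\<open>gradient_lower_bound\<close>). Hence descending at unit speed over a
  distance \<open>r\<close> shrinks the gap by the factor \<open>exp(- 2 \<gamma> r)\<close>, and \<open>r = ln (exp(2 C) / (2 \<epsilon>)) / (2 \<gamma>)\<close>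
  suffices; this is the origin of \<open>\<kappa> = 2 n exp(2 r)\<close>.

  The structure theory uses exponentials of Hermitian matrices, which are diagonalized. A polynomial
  evaluated on \<open>exp(z H)\<close> is then an exponential sum in \<open>z\<close> with real frequencies. Such a sum vanishes
  identically as soon as it vanishes on the natural numbers or on the imaginary axis, and this turns
  Zariski closedness of \<open>G\<close> into the polar decomposition and into \<open>exp(z H) \<in> G\<close> for \<open>H \<in> iLie K\<close> and
  all complex \<open>z\<close>.
\<close>

section \<open>Complex matrices with the Frobenius norm\<close>

lemma dagger_nth [simp]: "dagger A $ i $ j = cnj (A $ j $ i)"
  by (simp add: dagger_def transpose_def map_matrix_def)

lemma cscale_nth [simp]: "cscale c A $ i $ j = c * A $ i $ j"
  by (simp add: cscale_def map_matrix_def)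

lemma dagger_dagger [simp]: "dagger (dagger A) = A"
  by (simp add: vec_eq_iff)

lemma dagger_mult: "dagger (A ** B) = dagger B ** dagger A"
  by (simp add: vec_eq_iff matrix_matrix_mult_def mult.commute)

lemma dagger_add: "dagger (A + B) = dagger A + dagger B"
  by (simp add: vec_eq_iff)

lemma dagger_diff: "dagger (A - B) = dagger A - dagger B"
  by (simp add: vec_eq_iff)

lemma dagger_scaleR: "dagger (r *\<^sub>R A) = r *\<^sub>R dagger A"
  by (simp add: vec_eq_iff)

lemma dagger_cscale: "dagger (cscale c A) = cscale (cnj c) (dagger A)"
  by (simp add: vec_eq_iff)

lemma dagger_mat_1 [simp]: "dagger (mat 1) = mat 1"
  by (simp add: vec_eq_iff mat_def)

lemma cscale_mult_left: "cscale c A ** B = cscale c (A ** B)"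
  by (simp add: vec_eq_iff matrix_matrix_mult_def sum_distrib_left mult_ac)

lemma cscale_mult_right: "A ** cscale c B = cscale c (A ** B)"
  by (simp add: vec_eq_iff matrix_matrix_mult_def sum_distrib_left mult_ac)

lemma cscale_cscale [simp]: "cscale c (cscale d A) = cscale (c * d) A"
  by (simp add: vec_eq_iff mult_ac)

lemma cscale_of_real: "cscale (of_real r) A = r *\<^sub>R A"
  unfolding vec_eq_iff cscale_nth vector_scaleR_component by (simp only: scaleR_conv_of_real simp_thms)

lemma scaleR_eq_scale: "r *\<^sub>R x = complex_of_real r *s x"
  unfolding vec_eq_iff vector_scaleR_component vector_smult_component
  by (simp only: scaleR_conv_of_real simp_thms)

lemma cscale_1 [simp]: "cscale 1 A = A"
  by (simp add: vec_eq_iff)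

lemma cscale_mult_vec: "cscale c A *v x = c *s (A *v x)"
  by (simp add: vec_eq_iff matrix_vector_mult_def sum_distrib_left mult_ac)

lemma matrix_mult_diff_left: "(A - B) ** C = A ** C - B ** (C :: complex^'k^'n)"
  by (simp add: vec_eq_iff matrix_matrix_mult_def sum_subtractf algebra_simps)

lemma matrix_mult_diff_right: "A ** (B - C) = A ** B - A ** (C :: complex^'k^'n)"
  by (simp add: vec_eq_iff matrix_matrix_mult_def sum_subtractf algebra_simps)

lemma matrix_mult_scaleR_left: "(r *\<^sub>R A) ** B = r *\<^sub>R (A ** (B :: complex^'k^'n))"
  by (simp add: vec_eq_iff matrix_matrix_mult_def scaleR_sum_right)

lemma matrix_mult_scaleR_right: "A ** (r *\<^sub>R B) = r *\<^sub>R (A ** (B :: complex^'k^'n))"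
  by (simp add: vec_eq_iff matrix_matrix_mult_def scaleR_sum_right)

lemma norm_matrix_sq: "(norm (A :: complex^'n^'m))\<^sup>2 = (\<Sum>i\<in>UNIV. \<Sum>j\<in>UNIV. (cmod (A $ i $ j))\<^sup>2)"
  by (simp add: norm_vec_def L2_set_def sum_nonneg)

lemma inner_matrix_trace: "A \<bullet> B = Re (trace (dagger A ** (B :: complex^'n^'m)))"
proof -
  have "A \<bullet> B = (\<Sum>i\<in>UNIV. \<Sum>j\<in>UNIV. Re (cnj (A $ i $ j) * B $ i $ j))"
    by (simp add: inner_vec_def inner_complex_def)
  also have "\<dots> = (\<Sum>j\<in>UNIV. \<Sum>i\<in>UNIV. Re (cnj (A $ i $ j) * B $ i $ j))"
    by (rule sum.swap)
  finally show ?thesis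
    by (simp add: trace_def matrix_matrix_mult_def)
qed

lemma norm_dagger [simp]: "norm (dagger A) = norm (A :: complex^'n^'m)"
proof -
  have "(norm (dagger A))\<^sup>2 = (norm A)\<^sup>2"
    unfolding norm_matrix_sq by (subst sum.swap) simp
  then show ?thesis by simp
qed

lemma norm_matrix_mult: "norm (A ** B) \<le> norm A * norm (B :: complex^'k^'n)"
proof -
  have *: "(cmod ((A ** B) $ i $ j))\<^sup>2 \<le> (\<Sum>k\<in>UNIV. (cmod (A $ i $ k))\<^sup>2) * (\<Sum>k\<in>UNIV. (cmod (B $ k $ j))\<^sup>2)"
    for i j
  proof -
    have "cmod ((A ** B) $ i $ j) \<le> (\<Sum>k\<in>UNIV. \<bar>cmod (A $ i $ k)\<bar> * \<bar>cmod (B $ k $ j)\<bar>)"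
      unfolding matrix_matrix_mult_def by (simp add: sum_norm_le norm_mult)
    also have "\<dots> \<le> L2_set (\<lambda>k. cmod (A $ i $ k)) UNIV * L2_set (\<lambda>k. cmod (B $ k $ j)) UNIV"
      by (rule L2_set_mult_ineq)
    finally have "(cmod ((A ** B) $ i $ j))\<^sup>2 \<le> (L2_set (\<lambda>k. cmod (A $ i $ k)) UNIV * L2_set (\<lambda>k. cmod (B $ k $ j)) UNIV)\<^sup>2"
      by (simp add: power_mono)
    then show ?thesis by (simp add: L2_set_def power_mult_distrib sum_nonneg)
  qed
  have "(norm (A ** B))\<^sup>2 \<le> (\<Sum>i\<in>UNIV. \<Sum>j\<in>UNIV. (\<Sum>k\<in>UNIV. (cmod (A $ i $ k))\<^sup>2) * (\<Sum>k\<in>UNIV. (cmod (B $ k $ j))\<^sup>2))"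
    unfolding norm_matrix_sq by (intro sum_mono *)
  also have "\<dots> = (norm A)\<^sup>2 * (\<Sum>j\<in>UNIV. \<Sum>k\<in>UNIV. (cmod (B $ k $ j))\<^sup>2)"
    unfolding norm_matrix_sq by (simp add: sum_product)
  also have "(\<Sum>j\<in>UNIV. \<Sum>k\<in>UNIV. (cmod (B $ k $ j))\<^sup>2) = (norm B)\<^sup>2"
    unfolding norm_matrix_sq by (rule sum.swap)
  finally have "(norm (A ** B))\<^sup>2 \<le> (norm A * norm B)\<^sup>2"
    by (simp add: power_mult_distrib)
  then show ?thesis by (rule power2_le_imp_le) simp
qed

lemma bounded_bilinear_matrix_mult:
  "bounded_bilinear ((**) :: complex^'n^'m \<Rightarrow> complex^'k^'n \<Rightarrow> complex^'k^'m)"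
proof
  show "\<exists>K. \<forall>(A::complex^'n^'m) (B::complex^'k^'n). norm (A ** B) \<le> norm A * norm B * K"
    by (rule exI[of _ 1]) (simp add: norm_matrix_mult)
qed (simp_all add: matrix_add_ldistrib matrix_mult_scaleR_left matrix_mult_scaleR_right
      vec_eq_iff matrix_matrix_mult_def sum.distrib distrib_right distrib_left scaleR_sum_right)

lemmas bounded_linear_mult_left = bounded_bilinear.bounded_linear_left[OF bounded_bilinear_matrix_mult]
lemmas bounded_linear_mult_right = bounded_bilinear.bounded_linear_right[OF bounded_bilinear_matrix_mult]

lemma norm_matrix_vector_mult: "norm (A *v x) \<le> norm A * norm (x :: complex^'n)"
proof -
  have *: "(cmod ((A *v x) $ i))\<^sup>2 \<le> (\<Sum>k\<in>UNIV. (cmod (A $ i $ k))\<^sup>2) * (norm x)\<^sup>2" for i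
  proof -
    have "cmod ((A *v x) $ i) \<le> (\<Sum>k\<in>UNIV. \<bar>cmod (A $ i $ k)\<bar> * \<bar>cmod (x $ k)\<bar>)"
      unfolding matrix_vector_mult_def by (simp add: sum_norm_le norm_mult)
    also have "\<dots> \<le> L2_set (\<lambda>k. cmod (A $ i $ k)) UNIV * L2_set (\<lambda>k. cmod (x $ k)) UNIV"
      by (rule L2_set_mult_ineq)
    finally have "(cmod ((A *v x) $ i))\<^sup>2 \<le> (L2_set (\<lambda>k. cmod (A $ i $ k)) UNIV * L2_set (\<lambda>k. cmod (x $ k)) UNIV)\<^sup>2"
      by (simp add: power_mono)
    then show ?thesis by (simp add: L2_set_def power_mult_distrib sum_nonneg norm_vec_def)
  qed
  have "(norm (A *v x))\<^sup>2 = (\<Sum>i\<in>UNIV. (cmod ((A *v x) $ i))\<^sup>2)"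
    by (simp add: norm_vec_def L2_set_def sum_nonneg)
  also have "\<dots> \<le> (\<Sum>i\<in>UNIV. (\<Sum>k\<in>UNIV. (cmod (A $ i $ k))\<^sup>2) * (norm x)\<^sup>2)"
    by (intro sum_mono *)
  also have "\<dots> = (norm A * norm x)\<^sup>2"
    by (simp add: norm_matrix_sq sum_distrib_right power_mult_distrib)
  finally show ?thesis by (rule power2_le_imp_le) simp
qed

lemma bounded_bilinear_matrix_vector:
  "bounded_bilinear ((*v) :: complex^'n^'m \<Rightarrow> complex^'n \<Rightarrow> complex^'m)"
proof
  show "\<exists>K. \<forall>(A::complex^'n^'m) x. norm (A *v x) \<le> norm A * norm x * K"
    by (rule exI[of _ 1]) (simp add: norm_matrix_vector_mult)
qed (simp_all add: vec_eq_iff matrix_vector_mult_def scaleR_sum_right sum.distrib distrib_right distrib_left)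

lemmas bounded_linear_vector_left = bounded_bilinear.bounded_linear_left[OF bounded_bilinear_matrix_vector]
lemmas bounded_linear_vector_right = bounded_bilinear.bounded_linear_right[OF bounded_bilinear_matrix_vector]

lemma bounded_linear_dagger: "bounded_linear (dagger :: complex^'n^'m \<Rightarrow> _)"
  by (rule bounded_linear_intro[where K = 1]) (auto simp: dagger_add dagger_scaleR)

lemma bounded_linear_matrix_nth: "bounded_linear (\<lambda>A :: complex^'n^'m. A $ i $ j)"
  by (rule linear_conv_bounded_linear[THEN iffD1], rule linearI) auto

lemma unitary_commute:
  fixes U :: "complex^'n^'n"
  shows "dagger U ** U = mat 1 \<longleftrightarrow> U ** dagger U = mat 1"
  using matrix_left_right_inverse by blast

lemma norm_unitary_mult_left:
  assumes "dagger U ** U = (mat 1 :: complex^'n^'n)"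
  shows "norm (U ** A) = norm (A :: complex^'k^'n)"
proof -
  have "(U ** A) \<bullet> (U ** A) = Re (trace (dagger A ** (dagger U ** U) ** A))"
    by (simp add: inner_matrix_trace dagger_mult matrix_mul_assoc)
  also have "\<dots> = A \<bullet> A"
    by (simp add: assms inner_matrix_trace)
  finally show ?thesis by (simp add: norm_eq_sqrt_inner)
qed

lemma norm_unitary_mult_right:
  assumes "dagger U ** U = (mat 1 :: complex^'n^'n)"
  shows "norm (A ** U) = norm (A :: complex^'n^'k)"
proof -
  have "norm (A ** U) = norm (dagger U ** dagger A)"
    by (metis dagger_mult norm_dagger)
  also have "\<dots> = norm (dagger A)"
    by (rule norm_unitary_mult_left) (metis assms dagger_dagger unitary_commute)
  finally show ?thesis by simp
qed

lemma trace_hermitian_mult: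
  assumes "dagger A = A" "dagger B = B"
  shows "trace (A ** B) = complex_of_real (A \<bullet> (B :: complex^'n^'n))"
proof -
  have "cnj (trace (A ** B)) = trace (dagger (A ** B))"
    by (simp add: trace_def)
  also have "\<dots> = trace (A ** B)"
    unfolding dagger_mult assms by (rule trace_mul_sym)
  finally have "Im (trace (A ** B)) = 0"
    by (metis Reals_cnj_iff complex_is_Real_iff)
  then show ?thesis
    by (simp add: inner_matrix_trace assms complex_eq_iff)
qed

section \<open>Hermitian forms\<close>

locale hermitian_form =
  fixes h :: "complex^'m \<Rightarrow> complex^'m \<Rightarrow> complex"
  assumes h: "hermitian_inner_product h"
begin

lemma add_right: "h x (y + z) = h x y + h x z"
  and scale_right: "h x (c *s y) = c * h x y"
  and sym: "h y x = cnj (h x y)"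
  and pos: "x \<noteq> 0 \<Longrightarrow> Re (h x x) > 0"
  using h unfolding hermitian_inner_product_def by blast+

lemma add_left: "h (x + y) z = h x z + h y z"
  unfolding sym[of "x + y" z] sym[of x z] sym[of y z] by (simp add: add_right)

lemma scale_left: "h (c *s x) y = cnj c * h x y"
  unfolding sym[of "c *s x" y] sym[of x y] by (simp add: scale_right)

lemma zero_right [simp]: "h x 0 = 0"
  using scale_right[of x 0 0] by simp

lemma zero_left [simp]: "h 0 x = 0"
  by (subst sym) simp

lemma scaleR_right: "h x (r *\<^sub>R y) = r *\<^sub>R h x y"
proof -
  show ?thesis by (simp add: scaleR_eq_scale scale_right scaleR_conv_of_real)
qed

lemma scaleR_left: "h (r *\<^sub>R x) y = r *\<^sub>R h x y"
  unfolding sym[of "r *\<^sub>R x" y] sym[of x y] by (simp add: scaleR_right)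

lemma diff_right: "h x (y - z) = h x y - h x z"
  using add_right[of x "y - z" z] by simp

lemma diff_left: "h (x - y) z = h x z - h y z"
  using add_left[of "x - y" y z] by simp

lemma sum_right: "h x (sum f A) = (\<Sum>a\<in>A. h x (f a))"
  by (induction A rule: infinite_finite_induct) (auto simp: add_right)

lemma sum_left: "h (sum f A) y = (\<Sum>a\<in>A. h (f a) y)"
  by (induction A rule: infinite_finite_induct) (auto simp: add_left)

lemma self_real: "h x x = of_real (Re (h x x))"
proof -
  have "Im (h x x) = Im (cnj (h x x))" using sym[of x x] by (rule arg_cong)
  then show ?thesis by (simp add: complex_eq_iff)
qed

lemma nonneg: "Re (h x x) \<ge> 0"
  by (cases "x = 0") (auto dest: pos)

lemma self_eq_0: "Re (h x x) = 0 \<longleftrightarrow> x = 0"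
  using pos[of x] by fastforce

lemma Re_sym: "Re (h x y) = Re (h y x)"
  by (subst sym) simp

lemma bounded_bilinear: "bounded_bilinear h"
proof
  show "\<exists>K. \<forall>x y. norm (h x y) \<le> norm x * norm y * K"
  proof (rule exI, intro allI)
    fix x y :: "complex^'m"
    let ?e = "\<lambda>i. axis i (1::complex)"
    have "h x y = h (\<Sum>i\<in>UNIV. x $ i *s ?e i) (\<Sum>j\<in>UNIV. y $ j *s ?e j)"
      by (simp only: basis_expansion)
    also have "\<dots> = (\<Sum>i\<in>UNIV. cnj (x $ i) * h (?e i) (\<Sum>j\<in>UNIV. y $ j *s ?e j))"
      by (simp only: sum_left scale_left)
    also have "\<dots> = (\<Sum>i\<in>UNIV. cnj (x $ i) * (\<Sum>j\<in>UNIV. y $ j * h (?e i) (?e j)))"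
      by (simp only: sum_right scale_right)
    also have "\<dots> = (\<Sum>i\<in>UNIV. \<Sum>j\<in>UNIV. cnj (x $ i) * (y $ j * h (?e i) (?e j)))"
      by (simp only: sum_distrib_left)
    also have "norm \<dots> \<le> (\<Sum>i\<in>UNIV. \<Sum>j\<in>UNIV. norm x * norm y * cmod (h (?e i) (?e j)))"
      by (intro order_trans[OF norm_sum] sum_mono)
         (auto simp: norm_mult mult.assoc[symmetric] intro!: mult_right_mono mult_mono Finite_Cartesian_Product.norm_nth_le)
    also have "\<dots> = norm x * norm y * (\<Sum>i\<in>UNIV. \<Sum>j\<in>UNIV. cmod (h (?e i) (?e j)))"
      by (simp add: sum_distrib_left)
    finally show "norm (h x y) \<le> norm x * norm y * (\<Sum>i\<in>UNIV. \<Sum>j\<in>UNIV. cmod (h (?e i) (?e j)))" .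
  qed
qed (auto simp: add_left add_right scaleR_left scaleR_right)

lemma continuous_on_form [continuous_intros]:
  "continuous_on S f \<Longrightarrow> continuous_on S g \<Longrightarrow> continuous_on S (\<lambda>x. h (f x) (g x))"
  by (rule bounded_bilinear.continuous_on[OF bounded_bilinear])

lemma hnorm_nonneg [simp]: "hnorm h x \<ge> 0"
  by (simp add: hnorm_def nonneg)

lemma hnorm_sq: "(hnorm h x)\<^sup>2 = Re (h x x)"
  by (simp add: hnorm_def nonneg)

lemma hnorm_scale: "hnorm h (c *s x) = cmod c * hnorm h x"
proof -
  have "h (c *s x) (c *s x) = of_real ((cmod c)\<^sup>2) * h x x"
    by (simp add: scale_left scale_right complex_norm_square mult_ac del: of_real_power)
  then have "Re (h (c *s x) (c *s x)) = (cmod c)\<^sup>2 * Re (h x x)"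
    by (metis Re_complex_of_real of_real_mult self_real)
  then show ?thesis by (simp add: hnorm_def real_sqrt_mult)
qed

end

text \<open>The first order condition at the minimum of a nonnegative quadratic function, in a form that
  also covers degenerate second order terms.\<close>

lemma nonneg_quadratic_no_linear_term:
  fixes b c :: real
  assumes "\<And>t. 2 * t * b + t\<^sup>2 * c \<ge> 0"
  shows "b = 0"
proof (rule ccontr)
  assume "b \<noteq> 0"
  define d where "d = \<bar>c\<bar> + 1"
  have d: "d > 0" "c < 2 * d" by (auto simp: d_def)
  have "2 * (- b / d) * b + (- b / d)\<^sup>2 * c = (b / d)\<^sup>2 * (c - 2 * d)"
    using d by (simp add: field_simps power2_eq_square)
  also have "\<dots> < 0"
    using \<open>b \<noteq> 0\<close> d by (intro mult_pos_neg) auto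
  finally show False using assms[of "- b / d"] by simp
qed

section \<open>The spectral theorem\<close>

lemma vec_subspace_real: "vec.subspace (W :: (complex^'m) set) \<Longrightarrow> subspace W"
proof -
  assume W: "vec.subspace W"
  then show ?thesis
    by (simp add: subspace_def vec.subspace_def scaleR_eq_scale)
qed

lemma matrix_vector_scaleR: "A *v (r *\<^sub>R x) = r *\<^sub>R (A *v (x :: complex^'n))"
  by (simp add: vec_eq_iff matrix_vector_mult_def scaleR_sum_right)

context hermitian_form
begin

definition self_adjoint :: "complex^'m^'m \<Rightarrow> bool" where
  "self_adjoint A \<longleftrightarrow> (\<forall>x y. h (A *v x) y = h x (A *v y))"

lemma self_adjointD: "self_adjoint A \<Longrightarrow> h (A *v x) y = h x (A *v y)"
  by (simp add: self_adjoint_def)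

text \<open>Let \<open>x\<close> maximize the Rayleigh quotient on the unit sphere of \<open>W\<close>, with value \<open>l\<close>. The form of
  \<open>l - A\<close> is nonnegative on \<open>W\<close> and vanishes at \<open>x\<close>, so its first variation at \<open>x\<close> vanishes in the
  direction \<open>A x - l x\<close>; up to a positive factor this variation is \<open>-|A x - l x|\<^sup>2\<close>.\<close>

lemma eigenvector_in_invariant_subspace:
  assumes A: "self_adjoint A" and W: "vec.subspace W" "W \<noteq> {0}" and inv: "\<And>x. x \<in> W \<Longrightarrow> A *v x \<in> W"
  obtains x and l :: real where "x \<in> W" "x \<noteq> 0" "A *v x = of_real l *s x"
proof -
  define f where "f x = Re (h x (A *v x)) / Re (h x x)" for x
  have sub: "subspace W" using W by (simp add: vec_subspace_real)
  have "compact (W \<inter> sphere 0 1)"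
    by (intro closed_Int_compact closed_subspace sub) auto
  moreover obtain w where w: "w \<in> W" "w \<noteq> 0"
    using W vec.subspace_0 by blast
  have "(1 / norm w) *\<^sub>R w \<in> W \<inter> sphere 0 1"
    using w sub by (auto simp: subspace_scale)
  then have "W \<inter> sphere 0 1 \<noteq> {}" by blast
  moreover have "continuous_on (W \<inter> sphere 0 1) f"
    unfolding f_def
    by (intro continuous_intros bounded_bilinear.continuous_on[OF bounded_bilinear_matrix_vector])
       (auto simp: self_eq_0)
  ultimately have "\<exists>x\<in>W \<inter> sphere 0 1. \<forall>y\<in>W \<inter> sphere 0 1. f y \<le> f x"
    by (intro continuous_attains_sup)
  then obtain x where x: "x \<in> W" "norm x = 1" and max: "\<And>y. y \<in> W \<inter> sphere 0 1 \<Longrightarrow> f y \<le> f x"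
    by auto
  have x0: "x \<noteq> 0" using x by auto
  define l where "l = f x"
  have le: "Re (h y (A *v y)) \<le> l * Re (h y y)" if "y \<in> W" for y
  proof (cases "y = 0")
    case False
    have "f ((1 / norm y) *\<^sub>R y) \<le> l"
      unfolding l_def by (rule max) (use False that sub in \<open>auto simp: subspace_scale\<close>)
    moreover have "f ((1 / norm y) *\<^sub>R y) = f y"
      using False unfolding f_def
      by (simp add: scaleR_left scaleR_right matrix_vector_scaleR)
    ultimately have "f y \<le> l" by simp
    then show ?thesis
      using pos[OF False] by (simp add: f_def divide_le_eq)
  qed simp
  have eq: "Re (h x (A *v x)) = l * Re (h x x)"
    using pos[OF x0] by (simp add: l_def f_def)
  define z where "z = A *v x - of_real l *s x"
  have z: "z \<in> W"
    unfolding z_def using W(1) x inv by (simp add: vec.subspace_diff vec.subspace_scale)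
  have lx: "l * Re (h z x) - Re (h z (A *v x)) = - Re (h z z)"
    by (simp add: z_def diff_right diff_left scale_right scale_left algebra_simps)
  have "- Re (h z z) = 0"
  proof (rule nonneg_quadratic_no_linear_term)
    fix t :: real
    have "x + t *\<^sub>R z \<in> W" using x z sub by (simp add: subspace_add subspace_scale)
    from le[OF this]
    have "0 \<le> l * Re (h (x + t *\<^sub>R z) (x + t *\<^sub>R z)) - Re (h (x + t *\<^sub>R z) (A *v (x + t *\<^sub>R z)))"
      by simp
    also have "A *v (x + t *\<^sub>R z) = A *v x + t *\<^sub>R (A *v z)"
      by (simp add: matrix_vector_right_distrib matrix_vector_scaleR)
    also have "l * Re (h (x + t *\<^sub>R z) (x + t *\<^sub>R z)) - Re (h (x + t *\<^sub>R z) (A *v x + t *\<^sub>R (A *v z)))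
      = t * (l * (Re (h x z) + Re (h z x)) - (Re (h z (A *v x)) + Re (h x (A *v z))))
        + t\<^sup>2 * (l * Re (h z z) - Re (h z (A *v z))) + (l * Re (h x x) - Re (h x (A *v x)))"
      by (simp add: add_left add_right scaleR_left scaleR_right power2_eq_square algebra_simps)
    also have "Re (h x (A *v z)) = Re (h z (A *v x))"
      using self_adjointD[OF A, of x z] Re_sym[of "A *v x" z] by simp
    also have "Re (h x z) = Re (h z x)" by (rule Re_sym)
    finally show "0 \<le> 2 * t * (- Re (h z z)) + t\<^sup>2 * (l * Re (h z z) - Re (h z (A *v z)))"
      using eq arg_cong[OF lx, of "\<lambda>u. t * u"] by (simp add: algebra_simps)
  qed
  then have "z = 0" using self_eq_0 by simp
  then have "A *v x = of_real l *s x" by (simp add: z_def)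
  with x(1) x0 show ?thesis using that by blast
qed

text \<open>Induction on the dimension of \<open>W\<close>: if some \<open>A\<close> in \<open>S\<close> is not a scalar on \<open>W\<close>, then one of its
  eigenspaces in \<open>W\<close> is nonzero and proper, and commutativity makes it invariant under all of \<open>S\<close>.\<close>

lemma joint_eigenvector:
  assumes S: "\<And>A. A \<in> S \<Longrightarrow> self_adjoint A" "\<And>A B. A \<in> S \<Longrightarrow> B \<in> S \<Longrightarrow> A ** B = B ** A"
    and W: "vec.subspace W" "W \<noteq> {0}" and inv: "\<And>A x. A \<in> S \<Longrightarrow> x \<in> W \<Longrightarrow> A *v x \<in> W"
  shows "\<exists>x\<in>W. x \<noteq> 0 \<and> (\<forall>A\<in>S. \<exists>l::real. A *v x = of_real l *s x)"
  using W inv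
proof (induction "vec.dim W" arbitrary: W rule: less_induct)
  case less
  show ?case
  proof (cases "\<forall>A\<in>S. \<exists>l::real. \<forall>x\<in>W. A *v x = of_real l *s x")
    case True
    moreover obtain x where "x \<in> W" "x \<noteq> 0" using less.prems vec.subspace_0 by blast
    ultimately show ?thesis by blast
  next
    case False
    then obtain A where A: "A \<in> S" and no: "\<And>l::real. \<exists>x\<in>W. A *v x \<noteq> of_real l *s x" by blast
    obtain x and l :: real where x: "x \<in> W" "x \<noteq> 0" "A *v x = of_real l *s x"
      by (rule eigenvector_in_invariant_subspace[OF S(1)[OF A] less.prems(1,2) less.prems(3)[OF A]])
    define W' where "W' = {y \<in> W. A *v y = of_real l *s y}"
    have sub: "vec.subspace W'"
      using less.prems(1) unfolding W'_def vec.subspace_def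
      by (auto simp: matrix_vector_right_distrib vector_add_ldistrib vec.scale mult_ac)
    have "W' \<subset> W" using no[of l] unfolding W'_def by auto
    then have "vec.dim W' < vec.dim W"
      using vec.dim_psubset[of W' W] less.prems(1) sub vec.span_eq_iff by metis
    moreover have "W' \<noteq> {0}" using x unfolding W'_def by blast
    moreover have "B *v y \<in> W'" if B: "B \<in> S" and y: "y \<in> W'" for B y
    proof -
      have "A *v (B *v y) = B *v (A *v y)"
        by (simp add: matrix_vector_mul_assoc S(2)[OF A B])
      then show ?thesis using less.prems(3) B y by (auto simp: W'_def vec.scale)
    qed
    ultimately have "\<exists>x\<in>W'. x \<noteq> 0 \<and> (\<forall>A\<in>S. \<exists>l::real. A *v x = of_real l *s x)"
      using less.hyps sub by blast
    then show ?thesis unfolding W'_def by blast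
  qed
qed

definition orthonormal :: "(complex^'m) set \<Rightarrow> bool" where
  "orthonormal B \<longleftrightarrow> finite B \<and> (\<forall>b\<in>B. \<forall>c\<in>B. h b c = (if b = c then 1 else 0))"

lemma orthonormal_card_le:
  assumes "orthonormal B"
  shows "card B \<le> vec.dim (UNIV :: (complex^'m) set)"
proof -
  have "u w = 0" if "(\<Sum>v\<in>B. u v *s v) = 0" "w \<in> B" for u w
  proof -
    have "0 = h w (\<Sum>v\<in>B. u v *s v)" using that by simp
    also have "\<dots> = (\<Sum>v\<in>B. u v * h w v)" by (simp add: sum_right scale_right)
    also have "\<dots> = (\<Sum>v\<in>B. if v = w then u v else 0)"
      using assms that(2) by (intro sum.cong) (auto simp: orthonormal_def)
    also have "\<dots> = u w" using assms that(2) by (simp add: orthonormal_def)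
    finally show ?thesis by simp
  qed
  then have "vec.independent B"
    using assms vec.dependent_finite[of B] by (auto simp: orthonormal_def)
  then show ?thesis by (intro vec.independent_card_le_dim) auto
qed

text \<open>In a maximal orthonormal set of joint eigenvectors nothing is missing: its orthogonal
  complement is invariant, and a joint eigenvector in it would enlarge the set.\<close>

lemma joint_eigenbasis:
  assumes S: "\<And>A. A \<in> S \<Longrightarrow> self_adjoint A" "\<And>A B. A \<in> S \<Longrightarrow> B \<in> S \<Longrightarrow> A ** B = B ** A"
  obtains B where "orthonormal B" "\<And>A b. A \<in> S \<Longrightarrow> b \<in> B \<Longrightarrow> \<exists>l::real. A *v b = of_real l *s b"
    "\<And>x. x = (\<Sum>b\<in>B. h b x *s b)"
proof -
  define P where "P B \<longleftrightarrow> orthonormal B \<and> (\<forall>A\<in>S. \<forall>b\<in>B. \<exists>l::real. A *v b = of_real l *s b)" for B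
  have "P {}" by (simp add: P_def orthonormal_def)
  moreover have "\<forall>B. P B \<longrightarrow> card B < Suc (vec.dim (UNIV :: (complex^'m) set))"
    unfolding P_def less_Suc_eq_le using orthonormal_card_le by blast
  ultimately have "\<exists>B. P B \<and> (\<forall>B'. P B' \<longrightarrow> card B' \<le> card B)"
    by (rule Lattices_Big.ex_has_greatest_nat)
  then obtain B where B: "P B" and max: "\<And>B'. P B' \<Longrightarrow> card B' \<le> card B"
    by blast
  have on: "orthonormal B" and fin: "finite B" and eig: "\<And>A b. A \<in> S \<Longrightarrow> b \<in> B \<Longrightarrow> \<exists>l::real. A *v b = of_real l *s b"
    using B by (auto simp: P_def orthonormal_def)
  define W where "W = {x. \<forall>b\<in>B. h b x = 0}"
  have W: "vec.subspace W"
    unfolding W_def vec.subspace_def by (auto simp: add_right scale_right)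
  have inv: "A *v x \<in> W" if "A \<in> S" "x \<in> W" for A x
  proof -
    have "h b (A *v x) = 0" if b: "b \<in> B" for b
    proof -
      obtain l :: real where "A *v b = of_real l *s b" using eig \<open>A \<in> S\<close> b by blast
      then have "h b (A *v x) = l * h b x"
        using self_adjointD[OF S(1)[OF \<open>A \<in> S\<close>], of b x] by (simp add: scale_left)
      then show ?thesis using \<open>x \<in> W\<close> b by (simp add: W_def)
    qed
    then show ?thesis by (simp add: W_def)
  qed
  have "W = {0}"
  proof (rule ccontr)
    assume "W \<noteq> {0}"
    then obtain y where y: "y \<in> W" "y \<noteq> 0" "\<forall>A\<in>S. \<exists>l::real. A *v y = of_real l *s y"
      using joint_eigenvector[OF S W _ inv] by blast
    define r where "r = complex_of_real (1 / hnorm h y)"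
    define u where "u = r *s y"
    have hy: "hnorm h y > 0" using y(2) pos by (simp add: hnorm_def)
    have "hnorm h u = 1" using hy by (simp add: u_def r_def hnorm_scale norm_divide)
    then have u1: "h u u = 1" using self_real[of u] hnorm_sq[of u] by simp
    have bu: "h b u = 0" "h u b = 0" if "b \<in> B" for b
    proof -
      show "h b u = 0" using y(1) that by (simp add: W_def u_def scale_right)
      then show "h u b = 0" by (subst sym) simp
    qed
    have "u \<notin> B" using bu u1 by auto
    have "orthonormal (insert u B)"
      using on u1 bu \<open>u \<notin> B\<close> unfolding orthonormal_def by auto
    moreover have "\<exists>l::real. A *v u = of_real l *s u" if A: "A \<in> S" for A
    proof -
      obtain l :: real where "A *v y = of_real l *s y" using y(3) A by blast
      then have "A *v u = of_real l *s u" by (simp add: u_def vec.scale mult_ac)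
      then show ?thesis by blast
    qed
    ultimately have "P (insert u B)" using eig by (auto simp: P_def)
    from max[OF this] show False using \<open>u \<notin> B\<close> fin by simp
  qed
  have "x = (\<Sum>b\<in>B. h b x *s b)" for x
  proof -
    have "h c (\<Sum>b\<in>B. h b x *s b) = h c x" if c: "c \<in> B" for c
    proof -
      have "h c (\<Sum>b\<in>B. h b x *s b) = (\<Sum>b\<in>B. h b x * h c b)" by (simp add: sum_right scale_right)
      also have "\<dots> = (\<Sum>b\<in>B. if b = c then h b x else 0)"
        using on c by (intro sum.cong) (auto simp: orthonormal_def)
      finally show ?thesis using c fin by simp
    qed
    then have "x - (\<Sum>b\<in>B. h b x *s b) \<in> W" by (simp add: W_def diff_right)
    with \<open>W = {0}\<close> show ?thesis by simp
  qed
  with on eig show ?thesis using that by blast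
qed

end

definition diagm :: "('n \<Rightarrow> complex) \<Rightarrow> complex^'n^'n" where
  "diagm f = (\<chi> i j. if i = j then f i else 0)"

lemma diagm_nth [simp]: "diagm f $ i $ j = (if i = j then f i else 0)"
  by (simp add: diagm_def)

lemma mult_diagm_nth: "(U ** diagm f) $ i $ k = U $ i $ k * f k"
proof -
  have "(\<Sum>l\<in>UNIV. U $ i $ l * diagm f $ l $ k) = (\<Sum>l\<in>UNIV. if l = k then U $ i $ k * f k else 0)"
    by (rule sum.cong) auto
  then show ?thesis by (simp add: matrix_matrix_mult_def)
qed

lemma diagm_mult_nth: "(diagm f ** A) $ i $ j = f i * A $ i $ j"
proof -
  have "(\<Sum>k\<in>UNIV. diagm f $ i $ k * A $ k $ j) = (\<Sum>k\<in>UNIV. if k = i then f i * A $ i $ j else 0)"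
    by (rule sum.cong) auto
  then show ?thesis by (simp add: matrix_matrix_mult_def)
qed

lemma diagm_mult: "diagm f ** diagm g = diagm (\<lambda>i. f i * g i)"
  by (simp add: vec_eq_iff mult_diagm_nth)

lemma dagger_diagm: "dagger (diagm f) = diagm (\<lambda>i. cnj (f i))"
  by (simp add: vec_eq_iff)

lemma cscale_diagm: "cscale c (diagm f) = diagm (\<lambda>i. c * f i)"
  by (simp add: vec_eq_iff)

lemma diagm_1: "diagm (\<lambda>_. 1) = mat 1"
  by (simp add: vec_eq_iff mat_def)

definition cdot :: "complex^'n \<Rightarrow> complex^'n \<Rightarrow> complex" where
  "cdot x y = (\<Sum>i\<in>UNIV. cnj (x $ i) * y $ i)"

lemma hermitian_form_cdot: "hermitian_form cdot"
proof (unfold_locales, unfold hermitian_inner_product_def, intro conjI allI impI)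
  fix x :: "complex^'n" assume "x \<noteq> 0"
  have "cdot x x = of_real (\<Sum>i\<in>UNIV. (cmod (x $ i))\<^sup>2)"
    by (simp add: cdot_def complex_norm_square mult.commute del: of_real_power)
  moreover have "(\<Sum>i\<in>UNIV. (cmod (x $ i))\<^sup>2) > 0"
  proof -
    obtain i where "x $ i \<noteq> 0" using \<open>x \<noteq> 0\<close> by (auto simp: vec_eq_iff)
    then show ?thesis by (intro sum_pos2[of _ i]) auto
  qed
  ultimately show "Re (cdot x x) > 0" by simp
qed (simp_all add: cdot_def sum.distrib distrib_left sum_distrib_left mult_ac)

lemma cdot_adjoint: "cdot (A *v x) y = cdot x (dagger A *v y)"
proof -
  have "cdot (A *v x) y = (\<Sum>i\<in>UNIV. \<Sum>j\<in>UNIV. cnj (A $ i $ j) * cnj (x $ j) * y $ i)"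
    by (simp add: cdot_def matrix_vector_mult_def sum_distrib_right)
  also have "\<dots> = (\<Sum>j\<in>UNIV. \<Sum>i\<in>UNIV. cnj (A $ i $ j) * cnj (x $ j) * y $ i)"
    by (rule sum.swap)
  finally show ?thesis
    by (simp add: cdot_def matrix_vector_mult_def sum_distrib_left mult_ac)
qed

text \<open>The columns of \<open>U\<close> are the vectors of an orthonormal eigenbasis \<open>B\<close>. Parseval's identity for
  the unit vectors shows that \<open>B\<close> has as many elements as the index type, so that it can be
  enumerated by it.\<close>

theorem hermitian_diagonalization:
  fixes A :: "complex^'n^'n"
  assumes A: "dagger A = A"
  obtains U and d :: "'n \<Rightarrow> real" where "dagger U ** U = mat 1" "U ** dagger U = mat 1"
    "A = U ** diagm (\<lambda>i. of_real (d i)) ** dagger U"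
proof -
  interpret hermitian_form "cdot :: complex^'n \<Rightarrow> _" by (rule hermitian_form_cdot)
  have sa: "self_adjoint A" by (simp add: self_adjoint_def cdot_adjoint A)
  have "\<exists>B. orthonormal B \<and> (\<forall>b\<in>B. \<exists>l::real. A *v b = of_real l *s b) \<and>
      (\<forall>x. x = (\<Sum>b\<in>B. cdot b x *s b))"
    by (rule joint_eigenbasis[of "{A}"]) (use sa in simp, simp, blast)
  then obtain B where on: "orthonormal B" and eig: "\<And>b. b \<in> B \<Longrightarrow> \<exists>l::real. A *v b = of_real l *s b"
    and ex: "\<And>x. x = (\<Sum>b\<in>B. cdot b x *s b)"
    by blast
  have fin: "finite B" using on by (simp add: orthonormal_def)
  have ortho: "cdot b c = (if b = c then 1 else 0)" if "b \<in> B" "c \<in> B" for b c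
    using on that by (simp add: orthonormal_def)
  have one: "(\<Sum>b\<in>B. cnj (b $ i) * b $ i) = 1" for i
  proof -
    have "cdot b (axis i 1) = cnj (b $ i)" for b
      by (simp add: cdot_def axis_def if_distrib cong: if_cong)
    then have "(\<Sum>b\<in>B. cnj (b $ i) *s b) $ i = (axis i 1 :: complex^'n) $ i"
      using ex[of "axis i 1"] by simp
    then show ?thesis by (simp add: axis_def)
  qed
  have "complex_of_nat (card B) = (\<Sum>b\<in>B. cdot b b)" by (simp add: ortho)
  also have "\<dots> = (\<Sum>i\<in>UNIV. \<Sum>b\<in>B. cnj (b $ i) * b $ i)"
    unfolding cdot_def by (rule sum.swap)
  also have "\<dots> = complex_of_nat CARD('n)" by (simp add: one)
  finally have "card B = CARD('n)" using of_nat_eq_iff by blast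
  then obtain f :: "'n \<Rightarrow> complex^'n" where f: "bij_betw f UNIV B"
    using finite_same_card_bij[of "UNIV :: 'n set" B] fin by auto
  have fB: "f j \<in> B" for j using f by (auto simp: bij_betw_def)
  obtain d :: "'n \<Rightarrow> real" where d: "\<And>j. A *v f j = of_real (d j) *s f j"
    using eig[OF fB] by metis
  define U :: "complex^'n^'n" where "U = (\<chi> i j. f j $ i)"
  have U: "dagger U ** U = mat 1"
  proof -
    have "(dagger U ** U) $ j $ k = cdot (f j) (f k)" for j k
      by (simp add: U_def matrix_matrix_mult_def cdot_def)
    also have "cdot (f j) (f k) = (if j = k then 1 else 0)" for j k
      using f ortho[OF fB fB] by (auto simp: bij_betw_def inj_eq)
    finally show ?thesis by (simp add: vec_eq_iff mat_def)
  qed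
  have U': "U ** dagger U = mat 1" using U unitary_commute by blast
  have "A ** U = U ** diagm (\<lambda>i. of_real (d i))"
  proof -
    have "(A ** U) $ i $ j = (A *v f j) $ i" for i j
      by (simp add: U_def matrix_matrix_mult_def matrix_vector_mult_def)
    moreover have "(U ** diagm (\<lambda>i. of_real (d i))) $ i $ j = f j $ i * of_real (d j)" for i j
      by (simp add: matrix_matrix_mult_def U_def if_distrib cong: if_cong)
    ultimately show ?thesis by (simp add: vec_eq_iff d mult_ac)
  qed
  then have "A ** (U ** dagger U) = U ** diagm (\<lambda>i. of_real (d i)) ** dagger U"
    by (simp add: matrix_mul_assoc)
  with U' have "A = U ** diagm (\<lambda>i. of_real (d i)) ** dagger U" by simp
  with U U' show ?thesis using that by blast
qed

section \<open>The matrix exponential\<close>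

lemma has_derivative_vec:
  fixes f :: "'a::euclidean_space \<Rightarrow> 'b::real_normed_vector^'n"
  assumes "\<And>i. ((\<lambda>x. f x $ i) has_derivative (\<lambda>h. f' h $ i)) (at a)"
  shows "(f has_derivative f') (at a)"
  unfolding has_derivative_at
proof (intro conjI)
  have lin: "linear (\<lambda>h. f' h $ i)" for i
    using assms[of i] has_derivative_bounded_linear bounded_linear.linear by blast
  have "linear f'"
    by (rule linearI) (simp_all add: vec_eq_iff linear_add[OF lin] linear_scale[OF lin])
  then show "bounded_linear f'" by (simp add: linear_conv_bounded_linear)
  have "(\<lambda>h. (1 / norm h) *\<^sub>R (f (a + h) - f a - f' h)) \<midarrow>0\<rightarrow> 0"
  proof (rule vec_tendstoI)
    fix i
    have "(\<lambda>h. norm (f (a + h) $ i - f a $ i - f' h $ i) / norm h) \<midarrow>0\<rightarrow> 0"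
      using assms[of i] unfolding has_derivative_at by blast
    then have "(\<lambda>h. norm ((1 / norm h) *\<^sub>R (f (a + h) - f a - f' h) $ i)) \<midarrow>0\<rightarrow> 0"
      by (simp add: divide_inverse mult.commute)
    then show "(\<lambda>h. ((1 / norm h) *\<^sub>R (f (a + h) - f a - f' h)) $ i) \<midarrow>0\<rightarrow> 0 $ i"
      unfolding vector_scaleR_component zero_index by (rule tendsto_norm_zero_cancel)
  qed
  then have "(\<lambda>h. norm ((1 / norm h) *\<^sub>R (f (a + h) - f a - f' h))) \<midarrow>0\<rightarrow> 0"
    by (rule tendsto_norm_zero)
  then show "(\<lambda>h. norm (f (a + h) - f a - f' h) / norm h) \<midarrow>0\<rightarrow> 0"
    by (simp add: divide_inverse mult.commute)
qed

lemma has_vector_derivative_vec: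
  fixes f :: "real \<Rightarrow> 'b::real_normed_vector^'n"
  assumes "\<And>i. ((\<lambda>t. f t $ i) has_vector_derivative f' $ i) (at t)"
  shows "(f has_vector_derivative f') (at t)"
  using assms unfolding has_vector_derivative_def by (intro has_derivative_vec) simp

lemma norm_matpow: "norm (matpow A k) \<le> norm (mat 1 :: complex^'n^'n) * norm (A :: complex^'n^'n) ^ k"
proof (induction k)
  case (Suc k)
  have "norm (matpow A (Suc k)) \<le> norm A * norm (matpow A k)" by (simp add: norm_matrix_mult)
  also have "\<dots> \<le> norm A * (norm (mat 1 :: complex^'n^'n) * norm A ^ k)"
    using Suc by (intro mult_left_mono) auto
  finally show ?case by (simp add: mult_ac)
qed simp

lemma summable_mexp: "summable (\<lambda>k. (1 / fact k) *\<^sub>R matpow (A :: complex^'n^'n) k)"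
proof (rule summable_comparison_test)
  have "norm ((1 / fact k) *\<^sub>R matpow A k) \<le> norm (mat 1 :: complex^'n^'n) * (inverse (fact k) * norm A ^ k)" for k
    using mult_left_mono[OF norm_matpow[of A k], of "inverse (fact k)"]
    by (simp add: mult_ac divide_inverse)
  then show "\<exists>N. \<forall>k\<ge>N. norm ((1 / fact k) *\<^sub>R matpow A k) \<le> norm (mat 1 :: complex^'n^'n) * (inverse (fact k) * norm A ^ k)"
    by blast
  show "summable (\<lambda>k. norm (mat 1 :: complex^'n^'n) * (inverse (fact k) * norm A ^ k))"
    by (intro summable_mult summable_exp)
qed

lemma mexp_nth: "mexp A $ i $ j = (\<Sum>k. (1 / fact k) *\<^sub>R matpow A k $ i $ j)"
  unfolding mexp_def
  using bounded_linear.suminf[OF bounded_linear_matrix_nth[of i j] summable_mexp[of A]] by simp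

lemma summable_mexp_nth: "summable (\<lambda>k. (1 / fact k) *\<^sub>R matpow A k $ i $ j)"
  using bounded_linear.summable[OF bounded_linear_matrix_nth[of i j] summable_mexp[of A]] by simp

lemma mexp_conj:
  fixes U V A :: "complex^'n^'n"
  assumes VU: "V ** U = mat 1"
  shows "mexp (U ** A ** V) = U ** mexp A ** V"
proof -
  have UV: "U ** V = mat 1" using VU matrix_left_right_inverse by blast
  have pow: "matpow (U ** A ** V) k = U ** matpow A k ** V" for k
  proof (induction k)
    case (Suc k)
    have "matpow (U ** A ** V) (Suc k) = U ** A ** (V ** U) ** matpow A k ** V"
      using Suc by (simp add: matrix_mul_assoc)
    then show ?case by (simp add: VU matrix_mul_assoc)
  qed (simp add: UV)
  have lin: "bounded_linear (\<lambda>X. U ** X ** V)"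
    by (intro bounded_bilinear.bounded_linear_right[OF bounded_bilinear_matrix_mult, THEN bounded_linear_compose[OF
          bounded_linear_mult_left]])
  show ?thesis
    unfolding mexp_def pow bounded_linear.suminf[OF lin summable_mexp]
    by (simp add: matrix_mult_scaleR_left matrix_mult_scaleR_right)
qed

lemma matpow_diagm: "matpow (diagm f) k = diagm (\<lambda>i. f i ^ k)"
  by (induction k) (simp_all add: diagm_1 diagm_mult)

lemma mexp_diagm: "mexp (diagm f) = diagm (\<lambda>i. exp (f i))"
  by (simp add: vec_eq_iff mexp_nth matpow_diagm exp_def divide_inverse if_distrib cong: if_cong)

lemma matpow_cscale: "matpow (cscale z A) k = cscale (z ^ k) (matpow A k)"
  by (induction k) (simp_all add: cscale_mult_left cscale_mult_right mult_ac)

text \<open>Every entry of \<open>mexp (z A)\<close> is an everywhere convergent power series in \<open>z\<close>, whose linear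
  coefficient is the entry of \<open>A\<close>.\<close>

lemma mexp_has_vector_derivative_0:
  "((\<lambda>t::real. mexp (t *\<^sub>R A)) has_vector_derivative A) (at 0)"
proof (intro has_vector_derivative_vec)
  fix i j
  define c where "c k = (1 / fact k) *\<^sub>R matpow A k $ i $ j" for k
  define F where "F z = (\<Sum>k. c k * z ^ k)" for z
  have F: "mexp (cscale z A) $ i $ j = F z" for z
    unfolding mexp_nth matpow_cscale F_def c_def by (simp add: mult_ac)
  have "summable (\<lambda>k. c k * 1 ^ k)" unfolding c_def using summable_mexp_nth by simp
  then have "(F has_field_derivative (\<Sum>n. diffs c n * 0 ^ n)) (at 0)"
    unfolding F_def by (rule termdiffs_strong) simp
  also have "(\<Sum>n. diffs c n * 0 ^ n) = A $ i $ j"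
    by (simp only: powser_zero) (simp add: diffs_def c_def)
  finally have "((\<lambda>t. F (of_real t)) has_vector_derivative A $ i $ j) (at 0)"
    using has_vector_derivative_real_field[of F "A $ i $ j" 0] by simp
  then show "((\<lambda>t. mexp (t *\<^sub>R A) $ i $ j) has_vector_derivative A $ i $ j) (at 0)"
    by (simp add: F[symmetric] cscale_of_real)
qed

text \<open>The parameter is complex because a Hermitian \<open>H\<close> generates both a geodesic, for real \<open>z\<close>, and a
  one-parameter group of unitary matrices, for imaginary \<open>z\<close>.\<close>

definition hexp :: "complex \<Rightarrow> complex^'n^'n \<Rightarrow> complex^'n^'n" where
  "hexp z H = mexp (cscale z H)"

lemma mexp_scaleR_hexp: "mexp (t *\<^sub>R H) = hexp (of_real t) H"
  by (simp add: hexp_def cscale_of_real)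

lemma hexp_cscale: "hexp z (cscale c H) = hexp (z * c) H"
  by (simp add: hexp_def)

lemma hexp_scaleR: "hexp z (r *\<^sub>R H) = hexp (z * of_real r) H"
  by (metis hexp_cscale cscale_of_real)

lemma hexp_unitary_conj:
  fixes U H :: "complex^'n^'n"
  assumes "dagger U ** U = mat 1"
  shows "hexp z (U ** H ** dagger U) = U ** hexp z H ** dagger U"
  using mexp_conj[OF assms, of "cscale z H"]
  by (simp add: hexp_def cscale_mult_left cscale_mult_right)

lemma hexp_diagm: "hexp z (diagm f) = diagm (\<lambda>i. exp (z * f i))"
  by (simp add: hexp_def cscale_diagm mexp_diagm)

lemma hexp_diagonalized:
  fixes U H :: "complex^'n^'n"
  assumes "dagger U ** U = mat 1" "H = U ** diagm d ** dagger U"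
  shows "hexp z H = U ** diagm (\<lambda>i. exp (z * d i)) ** dagger U"
  using assms hexp_unitary_conj[OF assms(1), of z "diagm d"] by (simp add: hexp_diagm)

lemma hexp_add:
  fixes H :: "complex^'n^'n"
  assumes "dagger H = H"
  shows "hexp (z + w) H = hexp z H ** hexp w H"
proof -
  obtain U and d :: "'n \<Rightarrow> real" where U: "dagger U ** U = mat 1" "U ** dagger U = mat 1"
    and H: "H = U ** diagm (\<lambda>i. of_real (d i)) ** dagger U"
    by (rule hermitian_diagonalization[OF assms])
  define D where "D z = diagm (\<lambda>i. exp (z * complex_of_real (d i)))" for z
  have "hexp z H ** hexp w H = U ** D z ** (dagger U ** U) ** D w ** dagger U"
    by (simp add: hexp_diagonalized[OF U(1) H] D_def matrix_mul_assoc)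
  also have "\<dots> = U ** (D z ** D w) ** dagger U"
    by (simp add: U matrix_mul_assoc)
  also have "D z ** D w = D (z + w)"
    by (simp add: D_def diagm_mult exp_add[symmetric] distrib_right)
  finally show ?thesis by (simp add: hexp_diagonalized[OF U(1) H] D_def)
qed

lemma hexp_0 [simp]: "hexp 0 H = mat 1"
proof -
  have "cscale 0 H = diagm (\<lambda>_. 0)" by (simp add: vec_eq_iff)
  then show ?thesis by (simp add: hexp_def mexp_diagm diagm_1)
qed

lemma hexp_zero: "hexp z 0 = mat 1"
proof -
  have "(0 :: complex^'n^'n) = cscale 0 0" by (simp add: vec_eq_iff)
  then have "hexp z (0 :: complex^'n^'n) = hexp (z * 0) 0" by (metis hexp_cscale)
  then show ?thesis by simp
qed

lemma hexp_minus:
  assumes "dagger H = H"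
  shows "hexp (- z) H ** hexp z H = mat 1" "hexp z H ** hexp (- z) H = mat 1"
  using hexp_add[OF assms, of "-z" z] hexp_add[OF assms, of z "-z"] by simp_all

lemma dagger_hexp:
  fixes H :: "complex^'n^'n"
  assumes "dagger H = H"
  shows "dagger (hexp z H) = hexp (cnj z) H"
proof -
  obtain U and d :: "'n \<Rightarrow> real" where U: "dagger U ** U = mat 1" "U ** dagger U = mat 1"
    and H: "H = U ** diagm (\<lambda>i. of_real (d i)) ** dagger U"
    by (rule hermitian_diagonalization[OF assms])
  show ?thesis
    by (simp add: hexp_diagonalized[OF U(1) H] dagger_mult dagger_diagm exp_cnj matrix_mul_assoc)
qed

lemma hexp_has_vector_derivative:
  assumes "dagger H = H"
  shows "((\<lambda>t. hexp (of_real t * c) H) has_vector_derivative cscale c H ** hexp (of_real t * c) H) (at t)"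
proof -
  have 0: "((\<lambda>t. hexp (of_real t * c) H) has_vector_derivative cscale c H) (at (t - t))"
    using mexp_has_vector_derivative_0[of "cscale c H"] by (simp add: mexp_scaleR_hexp hexp_cscale)
  have "((\<lambda>s. hexp (of_real (s - t) * c) H) has_vector_derivative cscale c H) (at t)"
    using vector_diff_chain_at[of "\<lambda>s. s - t" 1 t "\<lambda>t. hexp (of_real t * c) H" "cscale c H"] 0
    by (simp add: o_def has_vector_derivative_diff_const has_vector_derivative_id)
  from bounded_linear.has_vector_derivative[OF bounded_linear_mult_left this]
  have "((\<lambda>s. hexp (of_real (s - t) * c) H ** hexp (of_real t * c) H) has_vector_derivative cscale c H ** hexp (of_real t * c) H) (at t)" .
  moreover have "hexp (of_real (s - t) * c) H ** hexp (of_real t * c) H = hexp (of_real s * c) H" for s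
    by (simp add: hexp_add[OF assms, symmetric] algebra_simps)
  ultimately show ?thesis by simp
qed

lemma continuous_hexp:
  assumes "dagger H = H"
  shows "continuous_on S (\<lambda>t. hexp (of_real t * c) H)"
  using hexp_has_vector_derivative[OF assms]
  by (meson continuous_at_imp_continuous_on has_vector_derivative_continuous)

lemma hexp_imaginary_unitary:
  assumes "dagger H = H"
  shows "hexp (\<i> * of_real t) H \<in> unitary_group"
  using hexp_minus[OF assms, of "\<i> * of_real t"] by (simp add: unitary_group_def dagger_hexp assms)

text \<open>Differentiating \<open>dagger (mexp (t X)) ** mexp (t X) = 1\<close> at \<open>0\<close> shows that the elements \<open>X\<close> of the
  Lie algebra are skew-Hermitian; so \<open>iLie S\<close> consists of Hermitian matrices.\<close>

lemma iLie_iff: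
  fixes S :: "(complex^'n^'n) set"
  assumes S: "S \<subseteq> unitary_group"
  shows "H \<in> iLie S \<longleftrightarrow> dagger H = H \<and> (\<forall>t::real. hexp (\<i> * of_real t) H \<in> S)"
proof
  assume "H \<in> iLie S"
  then obtain X where X: "X \<in> Lie S" and H: "H = cscale \<i> X" by (auto simp: iLie_def)
  have inS: "mexp (t *\<^sub>R X) \<in> S" for t using X by (simp add: Lie_def)
  then have u: "dagger (mexp (t *\<^sub>R X)) ** mexp (t *\<^sub>R X) = mat 1" for t
    using S by (auto simp: unitary_group_def)
  note d = mexp_has_vector_derivative_0[of X]
  have "((\<lambda>t. dagger (mexp (t *\<^sub>R X)) ** mexp (t *\<^sub>R X)) has_vector_derivative
      (dagger (mexp (0 *\<^sub>R X)) ** X + dagger X ** mexp (0 *\<^sub>R X))) (at 0)"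
    by (rule bounded_bilinear.has_vector_derivative[OF bounded_bilinear_matrix_mult
          bounded_linear.has_vector_derivative[OF bounded_linear_dagger d] d])
  moreover have "mexp 0 = (mat 1 :: complex^'n^'n)" using mexp_scaleR_hexp[of 0 X] by simp
  ultimately have "((\<lambda>t. mat 1) has_vector_derivative (X + dagger X)) (at (0::real))"
    by (simp add: u)
  then have "X + dagger X = 0"
    using vector_derivative_unique_at has_vector_derivative_const by blast
  then have "dagger X = - X" by (simp add: eq_neg_iff_add_eq_0 add.commute)
  then have "dagger H = H" by (simp add: H dagger_cscale vec_eq_iff)
  moreover have "hexp (\<i> * of_real t) H \<in> S" for t
    using inS[of "- t", unfolded mexp_scaleR_hexp] by (simp add: H hexp_cscale mult_ac)
  ultimately show "dagger H = H \<and> (\<forall>t::real. hexp (\<i> * of_real t) H \<in> S)" by blast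
next
  assume H: "dagger H = H \<and> (\<forall>t::real. hexp (\<i> * of_real t) H \<in> S)"
  define X where "X = cscale (- \<i>) H"
  have "mexp (t *\<^sub>R X) \<in> S" for t
  proof -
    have "mexp (t *\<^sub>R X) = hexp (\<i> * of_real (- t)) H"
      by (simp add: X_def mexp_scaleR_hexp hexp_cscale mult_ac)
    then show ?thesis using conjunct2[OF H, rule_format, of "- t"] by (simp only:)
  qed
  then have "X \<in> Lie S" by (simp add: Lie_def)
  moreover have "H = cscale \<i> X" by (simp add: X_def)
  ultimately show "H \<in> iLie S" by (auto simp: iLie_def)
qed

section \<open>Exponential sums\<close>

text \<open>Real frequencies \<open>\<mu>\<close> are told apart by the values of \<open>exp (z \<mu>)\<close> both on the natural numbers and on the
  imaginary axis, which makes an exponential sum determined by its restriction to either of them.\<close>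

inductive expsum :: "(complex \<Rightarrow> complex) \<Rightarrow> bool" where
  monomial: "expsum (\<lambda>z. c * exp (z * of_real \<mu>))"
| add: "expsum f \<Longrightarrow> expsum g \<Longrightarrow> expsum (\<lambda>z. f z + g z)"

lemma expsum_const: "expsum (\<lambda>_. c)"
  using expsum.monomial[of c 0] by simp

lemma expsum_mult:
  assumes "expsum f" "expsum g"
  shows "expsum (\<lambda>z. f z * g z)"
  using assms(1)
proof induction
  case (monomial c \<mu>)
  show ?case
    using assms(2)
  proof induction
    case (monomial d \<nu>)
    show ?case
      using expsum.monomial[of "c * d" "\<mu> + \<nu>"] by (simp add: exp_add distrib_left mult_ac)
  next
    case (add f g)
    then show ?case using expsum.add by (simp add: distrib_left)
  qed
next
  case (add f1 f2)
  then show ?case using expsum.add by (simp add: distrib_right)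
qed

lemma expsum_sum: "(\<And>i. i \<in> I \<Longrightarrow> expsum (f i)) \<Longrightarrow> expsum (\<lambda>z. \<Sum>i\<in>I. f i z)"
  by (induction I rule: infinite_finite_induct) (auto intro: expsum_const expsum.add)

lemma expsum_normal_form:
  assumes "expsum f"
  shows "\<exists>M c. finite M \<and> f = (\<lambda>z. \<Sum>\<mu>\<in>M. c \<mu> * exp (z * of_real \<mu>))"
  using assms
proof induction
  case (monomial c \<mu>)
  show ?case by (rule exI[of _ "{\<mu>}"], rule exI[of _ "\<lambda>_. c"]) simp
next
  case (add f g)
  then obtain M c M' c' where
    f: "finite M" "f = (\<lambda>z. \<Sum>\<mu>\<in>M. c \<mu> * exp (z * of_real \<mu>))" and
    g: "finite M'" "g = (\<lambda>z. \<Sum>\<mu>\<in>M'. c' \<mu> * exp (z * of_real \<mu>))" by blast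
  \<comment> \<open>common frequencies are merged\<close>
  define d where "d \<mu> = (if \<mu> \<in> M then c \<mu> else 0) + (if \<mu> \<in> M' then c' \<mu> else 0)" for \<mu>
  have "f z + g z = (\<Sum>\<mu>\<in>M \<union> M'. d \<mu> * exp (z * of_real \<mu>))" for z
  proof -
    have "f z = (\<Sum>\<mu>\<in>M \<union> M'. if \<mu> \<in> M then c \<mu> * exp (z * of_real \<mu>) else 0)"
      unfolding f(2) using f(1) g(1) by (subst sum.inter_restrict[symmetric]) (auto intro!: sum.cong)
    moreover have "g z = (\<Sum>\<mu>\<in>M \<union> M'. if \<mu> \<in> M' then c' \<mu> * exp (z * of_real \<mu>) else 0)"
      unfolding g(2) using f(1) g(1) by (subst sum.inter_restrict[symmetric]) (auto intro!: sum.cong)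
    ultimately show ?thesis
      by (simp only: sum.distrib[symmetric]) (auto simp: d_def distrib_right intro!: sum.cong)
  qed
  then show ?case using f(1) g(1) by (intro exI[of _ "M \<union> M'"] exI[of _ d]) auto
qed

text \<open>The Vandermonde argument: the sums vanish with any polynomial in place of the powers, and a
  polynomial that vanishes at all nodes but one isolates a coefficient.\<close>

lemma power_sums_zero_imp_zero:
  fixes a c :: "'i \<Rightarrow> complex"
  assumes "finite M" "inj_on a M" and zero: "\<And>k::nat. (\<Sum>\<mu>\<in>M. c \<mu> * a \<mu> ^ k) = 0" and "\<mu> \<in> M"
  shows "c \<mu> = 0"
proof -
  have poly: "(\<Sum>\<mu>\<in>M. c \<mu> * poly q (a \<mu>)) = 0" for q
  proof -
    have "(\<Sum>\<mu>\<in>M. c \<mu> * poly q (a \<mu>)) = (\<Sum>\<mu>\<in>M. \<Sum>i\<le>degree q. coeff q i * (c \<mu> * a \<mu> ^ i))"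
      by (simp add: poly_altdef sum_distrib_left mult_ac)
    also have "\<dots> = (\<Sum>i\<le>degree q. \<Sum>\<mu>\<in>M. coeff q i * (c \<mu> * a \<mu> ^ i))"
      by (rule sum.swap)
    finally show ?thesis by (simp add: sum_distrib_left[symmetric] zero)
  qed
  define q where "q = (\<Prod>\<nu>\<in>M - {\<mu>}. [:- a \<nu>, 1:])"
  have q: "poly q x = (\<Prod>\<nu>\<in>M - {\<mu>}. x - a \<nu>)" for x
    by (simp add: q_def poly_prod)
  have "poly q (a \<nu>) = 0" if "\<nu> \<in> M" "\<nu> \<noteq> \<mu>" for \<nu>
    using that assms(1) by (auto simp: q)
  then have "(\<Sum>\<nu>\<in>M. c \<nu> * poly q (a \<nu>)) = c \<mu> * poly q (a \<mu>)"
    using assms(1,4) by (subst sum.remove[of _ \<mu>]) auto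
  moreover have "poly q (a \<mu>) \<noteq> 0"
    using assms(1,2,4) by (auto simp: q inj_on_def)
  ultimately show ?thesis using poly[of q] by simp
qed

lemma expsum_zero_at_multiples:
  fixes f :: "complex \<Rightarrow> complex" and w :: complex
  assumes M: "finite M" and f: "f = (\<lambda>z. \<Sum>\<mu>\<in>M. c \<mu> * exp (z * of_real \<mu>))"
    and inj: "inj_on (\<lambda>\<mu>::real. exp (w * of_real \<mu>)) M" and zero: "\<And>k::nat. f (of_nat k * w) = 0"
  shows "f z = 0"
proof -
  have pow: "exp (w * of_real \<mu>) ^ k = exp (of_nat k * w * of_real \<mu>)" for k and \<mu> :: real
    using exp_of_nat_mult[of k "w * complex_of_real \<mu>"] by (simp only: mult.assoc)
  have "(\<Sum>\<mu>\<in>M. c \<mu> * exp (w * of_real \<mu>) ^ k) = 0" for k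
    unfolding pow using zero[of k] unfolding f .
  then have "c \<mu> = 0" if "\<mu> \<in> M" for \<mu>
    using power_sums_zero_imp_zero[OF M inj] that by blast
  then show ?thesis by (simp add: f)
qed

lemma expsum_zero_on_nat:
  assumes "expsum f" "\<And>k::nat. f (of_nat k) = 0"
  shows "f z = 0"
proof -
  obtain M c where M: "finite M" "f = (\<lambda>z. \<Sum>\<mu>\<in>M. c \<mu> * exp (z * of_real \<mu>))"
    using expsum_normal_form[OF assms(1)] by blast
  have "inj_on (\<lambda>\<mu>::real. exp (1 * complex_of_real \<mu>)) M"
    by (rule inj_onI) (simp add: exp_of_real)
  then show ?thesis using expsum_zero_at_multiples[OF M, of 1 z] assms(2) by simp
qed

lemma expsum_zero_on_imaginary:
  assumes "expsum f" "\<And>t::real. f (\<i> * of_real t) = 0"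
  shows "f z = 0"
proof -
  obtain M c where M: "finite M" "f = (\<lambda>z. \<Sum>\<mu>\<in>M. c \<mu> * exp (z * of_real \<mu>))"
    using expsum_normal_form[OF assms(1)] by blast
  obtain m where m: "m > 0" "\<And>\<mu>. \<mu> \<in> M \<Longrightarrow> \<bar>\<mu>\<bar> \<le> m"
    using finite_imp_bounded[OF M(1)] by (auto simp: bounded_pos)
  define s where "s = 1 / m"
  \<comment> \<open>the step is so small that the imaginary parts stay in an interval shorter than a period\<close>
  have small: "\<bar>s * \<mu>\<bar> \<le> 1" if "\<mu> \<in> M" for \<mu>
    using m(1) m(2)[OF that] by (simp add: s_def abs_mult)
  have "inj_on (\<lambda>\<mu>::real. exp ((\<i> * of_real s) * complex_of_real \<mu>)) M"
  proof (rule inj_onI)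
    fix \<mu> \<nu> assume in_M: "\<mu> \<in> M" "\<nu> \<in> M"
      and eq: "exp ((\<i> * of_real s) * complex_of_real \<mu>) = exp ((\<i> * of_real s) * complex_of_real \<nu>)"
    have "\<i> * of_real s * complex_of_real \<mu> = \<i> * of_real s * complex_of_real \<nu>"
    proof (rule complex_eqI)
      from eq obtain k where k: "\<i> * of_real s * complex_of_real \<mu> = \<i> * of_real s * complex_of_real \<nu> + of_int (2 * k) * (of_real pi * \<i>)"
        unfolding exp_eq by (auto simp: mult_ac)
      from arg_cong[OF k, of Im] have "s * \<mu> = s * \<nu> + 2 * of_int k * pi" by simp
      then have "2 * \<bar>of_int k\<bar> * pi \<le> 2" using small[OF in_M(1)] small[OF in_M(2)]
        by (simp add: abs_le_iff abs_if split: if_splits)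
      moreover have "\<bar>real_of_int k\<bar> * 3 \<le> \<bar>real_of_int k\<bar> * pi"
        using pi_gt3 by (intro mult_left_mono) auto
      ultimately have "k = 0" by linarith
      with k show "Im (\<i> * of_real s * complex_of_real \<mu>) = Im (\<i> * of_real s * complex_of_real \<nu>)" by simp
    qed simp
    then show "\<mu> = \<nu>" using m(1) by (simp add: s_def)
  qed
  moreover have "f (of_nat k * (\<i> * of_real s)) = 0" for k :: nat
    using assms(2)[of "of_nat k * s"] by (simp add: mult_ac)
  ultimately show ?thesis using expsum_zero_at_multiples[OF M] by blast
qed

lemma expsum_polynomial:
  assumes "polynomial_in matrix_entries p"
  shows "expsum (\<lambda>z. p (U ** diagm (\<lambda>i. exp (z * complex_of_real (d i))) ** V))"
  using assms
proof induction
  case (gen f)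
  then obtain i j where f: "f = (\<lambda>g. g $ i $ j)" by (auto simp: matrix_entries_def)
  have "(U ** diagm (\<lambda>i. exp (z * complex_of_real (d i))) ** V) $ i $ j
    = (\<Sum>k\<in>UNIV. (U $ i $ k * V $ k $ j) * exp (z * of_real (d k)))" for z
    unfolding matrix_matrix_mult_def[of "U ** _" V] by (simp add: mult_diagm_nth mult_ac)
  then show ?case by (simp add: f expsum_sum expsum.monomial)
qed (simp_all add: expsum_const expsum.add expsum_mult)

section \<open>Polar decomposition\<close>

text \<open>The set \<open>A\<close> is any set of parameters on which an exponential sum cannot vanish without vanishing
  identically: the defining polynomials of \<open>G\<close> are such sums along \<open>z \<mapsto> hexp z H\<close>.\<close>

lemma Zariski_closed_hexp:
  fixes G :: "(complex^'n^'n) set"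
  assumes G: "Zariski_closed G" and H: "dagger H = H"
    and vanish: "\<And>f. expsum f \<Longrightarrow> (\<And>w. w \<in> A \<Longrightarrow> f w = 0) \<Longrightarrow> f z = 0"
    and A: "\<And>w. w \<in> A \<Longrightarrow> hexp w H \<in> G"
  shows "hexp z H \<in> G"
proof -
  obtain P where P: "\<And>p. p \<in> P \<Longrightarrow> polynomial_in matrix_entries p"
    and Geq: "G = {g \<in> carrier GL. \<forall>p\<in>P. p g = 0}"
    using G by (auto simp: Zariski_closed_def)
  obtain U and d :: "'n \<Rightarrow> real" where U: "dagger U ** U = mat 1" "U ** dagger U = mat 1"
    and d: "H = U ** diagm (\<lambda>i. complex_of_real (d i)) ** dagger U"
    by (rule hermitian_diagonalization[OF H])
  have "p (hexp z H) = 0" if "p \<in> P" for p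
  proof -
    have "expsum (\<lambda>w. p (hexp w H))"
      unfolding hexp_diagonalized[OF U(1) d] by (rule expsum_polynomial[OF P[OF that]])
    then show ?thesis
      by (rule vanish) (use A that in \<open>auto simp: Geq\<close>)
  qed
  moreover have "hexp z H \<in> carrier GL"
    using hexp_minus[OF H, of z] by (auto simp: GL_def invertible_def)
  ultimately show ?thesis by (simp add: Geq)
qed

lemma group_GL: "group GL"
proof (rule groupI)
  fix x :: "complex^'n^'n" assume "x \<in> carrier GL"
  then show "\<exists>y\<in>carrier GL. y \<otimes>\<^bsub>GL\<^esub> x = \<one>\<^bsub>GL\<^esub>"
    by (auto simp: GL_def invertible_def)
next
  show "\<one>\<^bsub>GL\<^esub> \<in> carrier (GL :: (complex^'n^'n) monoid)"
    by (simp add: GL_def invertible_def)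
qed (auto simp: GL_def matrix_mul_assoc intro: invertible_mult)

lemma subgroup_GL:
  assumes "subgroup G GL"
  shows "mat 1 \<in> G" "g \<in> G \<Longrightarrow> k \<in> G \<Longrightarrow> g ** k \<in> G" "g \<in> G \<Longrightarrow> invertible g"
    "g \<in> G \<Longrightarrow> a ** g = mat 1 \<Longrightarrow> a \<in> G"
proof -
  interpret group "GL :: (complex^'n^'n) monoid" by (rule group_GL)
  show "mat 1 \<in> G" using subgroup.one_closed[OF assms] by (simp add: GL_def)
  show "g \<in> G \<Longrightarrow> k \<in> G \<Longrightarrow> g ** k \<in> G" using subgroup.m_closed[OF assms] by (simp add: GL_def)
  show inv: "g \<in> G \<Longrightarrow> invertible g" for g using subgroup.subset[OF assms] by (auto simp: GL_def)
  assume g: "g \<in> G" and a: "a ** g = mat 1"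
  then have "a \<in> carrier GL" using matrix_left_right_inverse by (auto simp: GL_def invertible_def)
  then have "inv\<^bsub>GL\<^esub> g = a"
    using inv_equality[of a g] a g inv by (auto simp: GL_def)
  then show "a \<in> G" using subgroup.m_inv_closed[OF assms g] by simp
qed

lemma matrix_inv_inverse:
  assumes "invertible (g :: complex^'n^'n)"
  shows "g ** matrix_inv g = mat 1" "matrix_inv g ** g = mat 1"
  using someI_ex[OF assms[unfolded invertible_def]] by (simp_all add: matrix_inv_def)

lemma subgroup_GL_matrix_inv:
  assumes "subgroup G GL" "g \<in> G"
  shows "matrix_inv g \<in> G"
  using subgroup_GL(3,4)[OF assms(1)] assms(2) matrix_inv_inverse(2) by blast

text \<open>The imaginary axis determines exponential sums. This is how \<open>G\<close> contains the complexification
  of \<open>K\<close>.\<close>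

lemma hexp_iLie_in_group:
  assumes G: "symmetric_subgroup G" and H: "H \<in> iLie (G \<inter> unitary_group)"
  shows "hexp z H \<in> G"
proof (rule Zariski_closed_hexp)
  show "Zariski_closed G" using G by (simp add: symmetric_subgroup_def)
  have *: "dagger H = H \<and> (\<forall>t::real. hexp (\<i> * of_real t) H \<in> G \<inter> unitary_group)"
    using H iLie_iff[of "G \<inter> unitary_group"] by auto
  then show "dagger H = H" by blast
  show "hexp w H \<in> G" if "w \<in> range (\<lambda>t. \<i> * complex_of_real t)" for w
    using * that by auto
  show "f z = 0" if "expsum f" "\<And>w. w \<in> range (\<lambda>t. \<i> * complex_of_real t) \<Longrightarrow> f w = 0" for f
    by (rule expsum_zero_on_imaginary[OF that(1)]) (rule that(2), simp)
qed

lemma gram_hermitian: "dagger (dagger g ** g) = dagger g ** g"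
  by (simp add: dagger_mult)

lemma hexp_of_nat:
  assumes "dagger H = H"
  shows "hexp (of_nat k) H = matpow (hexp 1 H) k"
  by (induction k) (simp_all add: hexp_add[OF assms])

text \<open>The positive factor is the square root of \<open>P = dagger g ** g\<close>. All natural powers of \<open>P\<close> lie in \<open>G\<close>,
  and the natural numbers determine exponential sums; so all complex powers of \<open>P\<close> lie in \<open>G\<close>, the
  imaginary ones being unitary.\<close>

lemma polar_decomposition:
  fixes G :: "(complex^'n^'n) set"
  assumes G: "symmetric_subgroup G" and g: "g \<in> G"
  obtains k X where "k \<in> G \<inter> unitary_group" "X \<in> iLie (G \<inter> unitary_group)" "g = k ** hexp 1 X"
    "dagger g ** g = hexp 2 X"
proof -
  have sub: "subgroup G GL" and Zar: "Zariski_closed G" and dag: "\<And>g. g \<in> G \<Longrightarrow> dagger g \<in> G"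
    using G by (auto simp: symmetric_subgroup_def)
  define P where "P = dagger g ** g"
  have PG: "P \<in> G" unfolding P_def using subgroup_GL(2)[OF sub] dag g by blast
  have Ph: "dagger P = P" unfolding P_def by (rule gram_hermitian)
  obtain U and d :: "'n \<Rightarrow> real" where U: "dagger U ** U = mat 1" "U ** dagger U = mat 1"
    and d: "P = U ** diagm (\<lambda>i. complex_of_real (d i)) ** dagger U"
    by (rule hermitian_diagonalization[OF Ph])
  have dpos: "d i > 0" for i
  proof -
    define B where "B = g ** U"
    have "diagm (\<lambda>i. complex_of_real (d i)) = dagger B ** B"
    proof -
      have "dagger B ** B = (dagger U ** U) ** diagm (\<lambda>i. complex_of_real (d i)) ** (dagger U ** U)"
        using d by (simp add: B_def P_def dagger_mult matrix_mul_assoc) (metis matrix_mul_assoc)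
      then show ?thesis by (simp add: U)
    qed
    then have "complex_of_real (d i) = (dagger B ** B) $ i $ i" by (metis diagm_nth)
    also have "\<dots> = of_real (\<Sum>k\<in>UNIV. (cmod (B $ k $ i))\<^sup>2)"
      by (simp add: matrix_matrix_mult_def complex_norm_square mult.commute del: of_real_power)
    finally have di: "d i = (\<Sum>k\<in>UNIV. (cmod (B $ k $ i))\<^sup>2)" by (simp only: of_real_eq_iff)
    obtain a where a: "a ** g = mat 1"
      using subgroup_GL(3)[OF sub g] by (auto simp: invertible_def)
    have "dagger U ** a ** B = mat 1"
      by (simp add: B_def) (metis a U(1) matrix_mul_assoc matrix_mul_rid)
    then have "(dagger U ** a ** B) $ i $ i = 1" by (simp add: mat_def)
    then have "\<exists>k. B $ k $ i \<noteq> 0" unfolding matrix_matrix_mult_def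
      by (metis (no_types, lifting) mult_zero_right sum.neutral vec_lambda_beta zero_neq_one)
    then obtain k where "B $ k $ i \<noteq> 0" by blast
    then show ?thesis unfolding di by (intro sum_pos2[of _ k]) auto
  qed
  define X where "X = U ** diagm (\<lambda>i. complex_of_real (ln (d i) / 2)) ** dagger U"
  have Xh: "dagger X = X" by (simp add: X_def dagger_mult dagger_diagm matrix_mul_assoc)
  have exp: "hexp z X = U ** diagm (\<lambda>i. exp (z * complex_of_real (ln (d i) / 2))) ** dagger U" for z
    by (rule hexp_diagonalized[OF U(1) X_def])
  have "exp (complex_of_real (ln (d i))) = complex_of_real (d i)" for i
    using dpos[of i] by (metis exp_of_real exp_ln)
  then have P2: "P = hexp 2 X" unfolding exp d by simp
  have Yh: "dagger (2 *\<^sub>R X) = 2 *\<^sub>R X" by (simp add: dagger_scaleR Xh)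
  have "hexp z (2 *\<^sub>R X) \<in> G" for z
  proof (rule Zariski_closed_hexp[OF Zar Yh])
    have "matpow P k \<in> G" for k
      by (induction k) (auto simp: subgroup_GL(1,2)[OF sub] PG)
    moreover have "hexp 1 (2 *\<^sub>R X) = P" by (simp add: hexp_scaleR P2)
    ultimately show "hexp w (2 *\<^sub>R X) \<in> G" if "w \<in> range of_nat" for w
      using that by (auto simp: hexp_of_nat[OF Yh])
    show "f z = 0" if "expsum f" "\<And>w. w \<in> range of_nat \<Longrightarrow> f w = 0" for f
      by (rule expsum_zero_on_nat[OF that(1)]) (rule that(2), simp)
  qed
  from this[of "z / 2" for z] have XG: "hexp z X \<in> G" for z
    by (simp add: hexp_scaleR)
  have X: "X \<in> iLie (G \<inter> unitary_group)"
    using iLie_iff[of "G \<inter> unitary_group"] Xh XG hexp_imaginary_unitary[OF Xh] by auto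
  define k where "k = g ** hexp (- 1) X"
  have kG: "k \<in> G" unfolding k_def using subgroup_GL(2)[OF sub g XG] .
  have "dagger k ** k = hexp (- 1) X ** P ** hexp (- 1) X"
    by (simp add: k_def dagger_mult dagger_hexp Xh P_def matrix_mul_assoc)
  also have "\<dots> = mat 1"
    by (simp add: P2 hexp_add[OF Xh, symmetric])
  finally have "k \<in> unitary_group" by (simp add: unitary_group_def)
  moreover have "g = k ** hexp 1 X"
    by (simp add: k_def matrix_mul_assoc[symmetric] hexp_minus[OF Xh])
  ultimately show ?thesis using that X kG P2 P_def by blast
qed

section \<open>The Lie algebra of a compact matrix group\<close>

lemma continuous_on_matrix_mult [continuous_intros]:
  fixes f :: "'a::topological_space \<Rightarrow> complex^'n^'m" and g :: "'a \<Rightarrow> complex^'k^'n"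
  shows "continuous_on S f \<Longrightarrow> continuous_on S g \<Longrightarrow> continuous_on S (\<lambda>x. f x ** g x)"
  by (rule bounded_bilinear.continuous_on[OF bounded_bilinear_matrix_mult])

lemma continuous_on_dagger [continuous_intros]:
  fixes f :: "'a::topological_space \<Rightarrow> complex^'n^'m"
  shows "continuous_on S f \<Longrightarrow> continuous_on S (\<lambda>x. dagger (f x))"
  by (rule bounded_linear.continuous_on[OF bounded_linear_dagger])

lemma tendsto_matrix_mult:
  fixes f :: "'a \<Rightarrow> complex^'n^'m" and g :: "'a \<Rightarrow> complex^'k^'n"
  shows "(f \<longlongrightarrow> a) F \<Longrightarrow> (g \<longlongrightarrow> b) F \<Longrightarrow> ((\<lambda>x. f x ** g x) \<longlongrightarrow> a ** b) F"
  by (rule bounded_bilinear.tendsto[OF bounded_bilinear_matrix_mult])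

lemma tendsto_dagger:
  fixes f :: "'a \<Rightarrow> complex^'n^'m"
  shows "(f \<longlongrightarrow> a) F \<Longrightarrow> ((\<lambda>x. dagger (f x)) \<longlongrightarrow> dagger a) F"
  by (rule bounded_linear.tendsto[OF bounded_linear_dagger])

lemma mult_in_unitary_group:
  "a \<in> unitary_group \<Longrightarrow> b \<in> unitary_group \<Longrightarrow> a ** b \<in> unitary_group"
proof -
  assume a: "a \<in> unitary_group" and b: "b \<in> unitary_group"
  have "dagger (a ** b) ** (a ** b) = dagger b ** (dagger a ** a) ** b"
    by (simp add: dagger_mult matrix_mul_assoc)
  then show ?thesis using a b by (simp add: unitary_group_def)
qed

lemma unitary_groupD:
  assumes "a \<in> unitary_group"
  shows "dagger a ** a = mat 1" "a ** dagger a = mat 1"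
  using assms unitary_commute by (auto simp: unitary_group_def)

lemma norm_unitary: "a \<in> unitary_group \<Longrightarrow> norm a = norm (mat 1 :: complex^'n^'n)"
  for a :: "complex^'n^'n"
  using norm_unitary_mult_left[of a "mat 1"] unitary_groupD by auto

lemma compact_unitary_group: "compact (unitary_group :: (complex^'n^'n) set)"
proof -
  have "closed {a :: complex^'n^'n. dagger a ** a = mat 1}"
    by (intro closed_Collect_eq continuous_intros)
  moreover have "bounded (unitary_group :: (complex^'n^'n) set)"
    unfolding bounded_iff using norm_unitary by (metis order_refl)
  ultimately show ?thesis by (simp add: compact_eq_bounded_closed unitary_group_def)
qed

lemma subgroup_GL_unitaryI:
  assumes S: "S \<subseteq> unitary_group" "mat 1 \<in> S" "\<And>a b. a \<in> S \<Longrightarrow> b \<in> S \<Longrightarrow> a ** b \<in> S"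
    "\<And>a. a \<in> S \<Longrightarrow> dagger a \<in> S"
  shows "subgroup S GL"
proof -
  interpret group "GL :: (complex^'a^'a) monoid" by (rule group_GL)
  have carr: "S \<subseteq> carrier GL"
    using S(1) unitary_groupD by (fastforce simp: GL_def invertible_def)
  show ?thesis
  proof (rule subgroupI[OF carr])
    show "S \<noteq> {}" using S(2) by blast
    fix a assume a: "a \<in> S"
    have "inv\<^bsub>GL\<^esub> a = dagger a"
      using carr a S(4)[OF a] unitary_groupD(1)[of a] S(1)
      by (intro inv_equality) (auto simp: GL_def)
    then show "inv\<^bsub>GL\<^esub> a \<in> S" using S(4)[OF a] by simp
  qed (use S(3) in \<open>auto simp: GL_def\<close>)
qed

lemma subgroup_GL_unitary_dagger:
  "subgroup S GL \<Longrightarrow> S \<subseteq> unitary_group \<Longrightarrow> a \<in> S \<Longrightarrow> dagger a \<in> S"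
  using subgroup_GL(4) unitary_groupD(1) by blast

lemma vector_derivative_in_closed_subspace:
  fixes f :: "real \<Rightarrow> 'a::euclidean_space"
  assumes S: "subspace S" and f: "\<And>t. f t \<in> S" and d: "(f has_vector_derivative f') (at t)"
  shows "f' \<in> S"
proof -
  have "((\<lambda>h. (f (t + h) - f t) /\<^sub>R h) \<longlongrightarrow> f') (at 0)"
  proof -
    have "((\<lambda>h. norm (f (t + h) - f t - h *\<^sub>R f') / norm h) \<longlongrightarrow> 0) (at 0)"
      using d unfolding has_vector_derivative_def has_derivative_at by blast
    then have "((\<lambda>h. norm ((f (t + h) - f t) /\<^sub>R h - f')) \<longlongrightarrow> 0) (at 0)"
    proof (rule Lim_transform_eventually)
      have "norm (f (t + h) - f t - h *\<^sub>R f') / norm h = norm ((f (t + h) - f t) /\<^sub>R h - f')" if "h \<noteq> 0" for h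
      proof -
        have "(f (t + h) - f t) /\<^sub>R h - f' = (f (t + h) - f t - h *\<^sub>R f') /\<^sub>R h"
          using that by (simp add: scaleR_diff_right)
        then show ?thesis by (simp add: divide_inverse mult.commute)
      qed
      then show "\<forall>\<^sub>F h in at 0. norm (f (t + h) - f t - h *\<^sub>R f') / norm h = norm ((f (t + h) - f t) /\<^sub>R h - f')"
        by (simp add: eventually_at_filter)
    qed
    then show ?thesis by (simp add: tendsto_norm_zero_iff LIM_zero_iff)
  qed
  moreover have "closed S" using S by (rule closed_subspace)
  moreover have "(f (t + h) - f t) /\<^sub>R h \<in> S" for h
    using S f by (simp add: subspace_diff subspace_scale)
  ultimately show ?thesis
    by (intro Lim_in_closed_set[of S _ "at 0"]) (auto simp: eventually_at_filter)
qed

lemma hexp_conjugation_derivative: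
  assumes X: "dagger X = X"
  shows "((\<lambda>t. hexp (of_real t * \<i>) X ** Y ** hexp (of_real t * - \<i>) X)
    has_vector_derivative cscale \<i> (X ** Y - Y ** X)) (at 0)"
proof -
  have d: "((\<lambda>t. hexp (of_real t * c) X) has_vector_derivative cscale c X) (at 0)" for c
    using hexp_has_vector_derivative[OF X, of c 0] by simp
  have "((\<lambda>t. hexp (of_real t * \<i>) X ** Y ** hexp (of_real t * - \<i>) X) has_vector_derivative
    (hexp (of_real 0 * \<i>) X ** Y ** cscale (- \<i>) X + (cscale \<i> X ** Y) ** hexp (of_real 0 * - \<i>) X)) (at 0)"
    by (rule bounded_bilinear.has_vector_derivative[OF bounded_bilinear_matrix_mult _ d]
          bounded_linear.has_vector_derivative[OF bounded_linear_mult_left d])+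
  moreover have "hexp (of_real 0 * \<i>) X ** Y ** cscale (- \<i>) X + (cscale \<i> X ** Y) ** hexp (of_real 0 * - \<i>) X
      = cscale \<i> (X ** Y - Y ** X)"
    by (simp add: cscale_mult_left cscale_mult_right) (simp add: vec_eq_iff algebra_simps)
  ultimately show ?thesis by simp
qed

text \<open>Telescoping; multiplication by unitary matrices preserves the Frobenius norm, so the errors add up.\<close>

lemma unitary_matpow_diff:
  assumes "a \<in> unitary_group" "b \<in> unitary_group"
  shows "norm (matpow a k - matpow b k) \<le> real k * norm (a - b :: complex^'n^'n)"
proof -
  have u: "matpow a k \<in> unitary_group" if "a \<in> unitary_group" for a :: "complex^'n^'n" and k
  proof (induction k)
    case 0
    show ?case by (simp add: unitary_group_def)
  next
    case (Suc k)
    with that show ?case by (simp add: mult_in_unitary_group)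
  qed
  show ?thesis
  proof (induction k)
    case (Suc k)
    have "matpow a (Suc k) - matpow b (Suc k) = a ** (matpow a k - matpow b k) + (a - b) ** matpow b k"
      by (simp add: matrix_mult_diff_left matrix_mult_diff_right)
    also have "norm \<dots> \<le> norm (a ** (matpow a k - matpow b k)) + norm ((a - b) ** matpow b k)"
      by (rule norm_triangle_ineq)
    also have "\<dots> = norm (matpow a k - matpow b k) + norm (a - b)"
      by (simp add: norm_unitary_mult_left[OF unitary_groupD(1)[OF assms(1)]]
          norm_unitary_mult_right[OF unitary_groupD(1)[OF u[OF assms(2)]]])
    finally show ?case using Suc by (simp add: algebra_simps)
  qed simp
qed

locale compact_matrix_group =
  fixes K :: "(complex^'n^'n) set"
  assumes subgroup: "subgroup K GL" and unitary: "K \<subseteq> unitary_group" and closed: "closed K"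
begin

lemma compact: "compact K"
  using compact_Int_closed[OF compact_unitary_group closed] unitary by (simp add: Int_absorb1)

lemmas one = subgroup_GL(1)[OF subgroup]
lemmas mult = subgroup_GL(2)[OF subgroup]
lemmas dagger = subgroup_GL_unitary_dagger[OF subgroup unitary]

lemma iLie: "H \<in> iLie K \<longleftrightarrow> dagger H = H \<and> (\<forall>t::real. hexp (\<i> * of_real t) H \<in> K)"
  by (rule iLie_iff[OF unitary])

lemma iLie_hermitian: "H \<in> iLie K \<Longrightarrow> dagger H = H"
  by (simp add: iLie)

lemma iLie_scaleR: "H \<in> iLie K \<Longrightarrow> r *\<^sub>R H \<in> iLie K"
proof -
  assume H: "H \<in> iLie K"
  have "hexp (\<i> * of_real t) (r *\<^sub>R H) = hexp (\<i> * of_real (t * r)) H" for t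
    by (simp add: hexp_scaleR mult_ac)
  then show ?thesis using H by (simp add: iLie dagger_scaleR del: of_real_mult)
qed

lemma matpow: "a \<in> K \<Longrightarrow> matpow a k \<in> K"
  by (induction k) (auto simp: one mult)

text \<open>Lie's product formula: with \<open>s = t / k\<close> the matrices \<open>exp(i s X) exp(i s Y)\<close> and \<open>exp(i s (X + Y))\<close> agree to
  first order in \<open>s\<close>, so their \<open>k\<close>-th powers differ by \<open>k o(1/k)\<close>. The former powers lie in the closed
  group \<open>K\<close>, the latter are \<open>exp(i t (X + Y))\<close>.\<close>

lemma iLie_add:
  assumes X: "X \<in> iLie K" and Y: "Y \<in> iLie K"
  shows "X + Y \<in> iLie K"
proof -
  have Xh: "dagger X = X" and Yh: "dagger Y = Y" using X Y by (auto simp: iLie)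
  then have Sh: "dagger (X + Y) = X + Y" by (simp add: dagger_add)
  define \<phi> where "\<phi> s = hexp (of_real s * \<i>) X ** hexp (of_real s * \<i>) Y - hexp (of_real s * \<i>) (X + Y)" for s :: real
  have d: "((\<lambda>t. hexp (of_real t * \<i>) H) has_vector_derivative cscale \<i> H) (at 0)" if "dagger H = H" for H :: "complex^'n^'n"
    using hexp_has_vector_derivative[OF that, of \<i> 0] by simp
  have "(\<phi> has_vector_derivative (hexp (of_real 0 * \<i>) X ** cscale \<i> Y + cscale \<i> X ** hexp (of_real 0 * \<i>) Y - cscale \<i> (X + Y))) (at 0)"
    unfolding \<phi>_def
    by (intro has_vector_derivative_diff bounded_bilinear.has_vector_derivative[OF bounded_bilinear_matrix_mult] d Xh Yh Sh)
  moreover have "cscale \<i> X + cscale \<i> Y - cscale \<i> (X + Y) = 0"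
    by (simp add: vec_eq_iff algebra_simps)
  ultimately have "(\<phi> has_vector_derivative 0) (at 0)"
    by (simp add: add.commute)
  moreover have "\<phi> 0 = 0" by (simp add: \<phi>_def)
  ultimately have lim: "((\<lambda>s. norm (\<phi> s) / \<bar>s\<bar>) \<longlongrightarrow> 0) (at 0)"
    unfolding has_vector_derivative_def has_derivative_at by simp
  have "hexp (\<i> * of_real t) (X + Y) \<in> K" for t
  proof (cases "t = 0")
    case False
    define s where "s k = t / real (Suc k)" for k
    have s0: "s \<longlonglongrightarrow> 0" unfolding s_def
      by (rule LIMSEQ_Suc[OF lim_const_over_n])
    have "\<forall>k. s k \<noteq> 0" using False by (simp add: s_def)
    with s0 have "filterlim s (at 0) sequentially" by (auto simp: filterlim_at)
    then have lim2: "(\<lambda>k. norm (\<phi> (s k)) / \<bar>s k\<bar>) \<longlonglongrightarrow> 0"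
      by (rule filterlim_compose[OF lim])
    define a where "a k = hexp (of_real (s k) * \<i>) X ** hexp (of_real (s k) * \<i>) Y" for k
    define b where "b k = hexp (of_real (s k) * \<i>) (X + Y)" for k
    have aK: "a k \<in> K" for k using X Y by (auto simp: a_def iLie mult.commute[of _ \<i>] intro!: mult)
    have bU: "b k \<in> unitary_group" for k
      using hexp_imaginary_unitary[OF Sh, of "s k"] by (simp add: b_def mult.commute)
    have pow: "matpow (hexp w (X + Y)) k = hexp (of_nat k * w) (X + Y)" for w k
      by (induction k) (simp_all add: hexp_add[OF Sh] distrib_right)
    have bk: "matpow (b k) (Suc k) = hexp (\<i> * of_real t) (X + Y)" for k
    proof -
      have "of_nat (Suc k) * (complex_of_real (s k) * \<i>) = complex_of_real (real (Suc k) * s k) * \<i>"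
        by (simp only: of_real_mult of_real_of_nat_eq mult.assoc)
      also have "real (Suc k) * s k = t" by (simp add: s_def)
      finally have e: "of_nat (Suc k) * (complex_of_real (s k) * \<i>) = complex_of_real t * \<i>" .
      show ?thesis unfolding b_def pow e by (simp only: mult.commute)
    qed
    have "(\<lambda>k. norm (matpow (a k) (Suc k) - hexp (\<i> * of_real t) (X + Y))) \<longlonglongrightarrow> 0"
    proof (rule tendsto_sandwich[OF _ _ tendsto_const])
      have "norm (matpow (a k) (Suc k) - matpow (b k) (Suc k)) \<le> \<bar>t\<bar> * (norm (\<phi> (s k)) / \<bar>s k\<bar>)" for k
      proof -
        have "norm (matpow (a k) (Suc k) - matpow (b k) (Suc k)) \<le> real (Suc k) * norm (a k - b k)"
          using aK unitary bU by (intro unitary_matpow_diff) auto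
        also have "a k - b k = \<phi> (s k)" by (simp add: a_def b_def \<phi>_def)
        also have "real (Suc k) = \<bar>t\<bar> / \<bar>s k\<bar>" using False by (simp add: s_def)
        finally show ?thesis by simp
      qed
      then show "\<forall>\<^sub>F k in sequentially. norm (matpow (a k) (Suc k) - hexp (\<i> * of_real t) (X + Y)) \<le> \<bar>t\<bar> * (norm (\<phi> (s k)) / \<bar>s k\<bar>)"
        unfolding bk by (intro always_eventually allI)
      show "(\<lambda>k. \<bar>t\<bar> * (norm (\<phi> (s k)) / \<bar>s k\<bar>)) \<longlonglongrightarrow> 0"
        using tendsto_mult_left[OF lim2, of "\<bar>t\<bar>"] by simp
    qed simp
    then have "(\<lambda>k. matpow (a k) (Suc k)) \<longlonglongrightarrow> hexp (\<i> * of_real t) (X + Y)"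
      by (simp add: tendsto_norm_zero_iff LIM_zero_iff)
    then show ?thesis
      by (rule closed_sequentially[OF closed, rotated]) (rule matpow[OF aK])
  qed (simp add: one)
  with Sh show ?thesis by (simp add: iLie)
qed

lemma subspace_iLie: "subspace (iLie K)"
proof -
  have "dagger 0 = (0 :: complex^'n^'n)" by (simp add: vec_eq_iff)
  then have "0 \<in> iLie K" by (simp add: iLie one hexp_zero)
  then show ?thesis by (simp add: subspace_def iLie_add iLie_scaleR)
qed

lemma iLie_conj:
  assumes H: "H \<in> iLie K" and U: "U \<in> K"
  shows "U ** H ** dagger U \<in> iLie K"
proof -
  have "dagger U ** U = mat 1" using U unitary unitary_groupD by blast
  then have "hexp z (U ** H ** dagger U) = U ** hexp z H ** dagger U" for z
    by (rule hexp_unitary_conj)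
  then show ?thesis using H U by (auto simp: iLie dagger_mult matrix_mul_assoc mult dagger)
qed

lemma iLie_bracket:
  assumes X: "X \<in> iLie K" and Y: "Y \<in> iLie K"
  shows "cscale \<i> (X ** Y - Y ** X) \<in> iLie K"
proof (rule vector_derivative_in_closed_subspace[OF subspace_iLie _ hexp_conjugation_derivative])
  show Xh: "dagger X = X" using X by (rule iLie_hermitian)
  fix t :: real
  have "hexp (of_real t * \<i>) X \<in> K" using X by (simp add: iLie mult.commute)
  from iLie_conj[OF Y this] show "hexp (of_real t * \<i>) X ** Y ** hexp (of_real t * - \<i>) X \<in> iLie K"
    by (simp add: dagger_hexp[OF Xh])
qed

end

section \<open>Maximal tori\<close>

lemma cmod_diagonal_unitary:
  assumes "a \<in> unitary_group" "a \<in> diagonal_matrices"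
  shows "cmod (a $ i $ i) = 1"
proof -
  have "a $ i $ j = 0" if "i \<noteq> j" for i j using assms(2) that by (auto simp: diagonal_matrices_def)
  then have a: "a = diagm (\<lambda>i. a $ i $ i)" by (simp add: vec_eq_iff)
  have "dagger a ** a = mat 1" using assms(1) by (rule unitary_groupD)
  then have "(dagger a ** a) $ i $ i = 1" by (simp add: mat_def)
  moreover have "dagger a ** a = diagm (\<lambda>i. cnj (a $ i $ i) * a $ i $ i)"
    by (subst (1 2) a) (simp add: dagger_diagm diagm_mult)
  ultimately have "cnj (a $ i $ i) * a $ i $ i = 1" by (simp only: diagm_nth if_True simp_thms)
  then have "complex_of_real ((cmod (a $ i $ i))\<^sup>2) = 1" by (simp add: complex_norm_square mult.commute del: of_real_power)
  then have "(cmod (a $ i $ i))\<^sup>2 = 1\<^sup>2" by (simp only: of_real_eq_1_iff power_one)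
  then show ?thesis by (rule power2_eq_imp_eq) simp_all
qed

text \<open>Coordinates for the Lie algebra of a group of diagonal matrices. The map is isometric, so weights
  and their distances can be computed in \<open>real^'n\<close>.\<close>

definition rdiag :: "real^'n \<Rightarrow> complex^'n^'n" where
  "rdiag x = diagm (\<lambda>i. of_real (x $ i))"

lemma rdiag_nth [simp]: "rdiag x $ i $ j = (if i = j then of_real (x $ i) else 0)"
  by (simp add: rdiag_def)

lemma dagger_rdiag [simp]: "dagger (rdiag x) = rdiag x"
  by (simp add: vec_eq_iff)

lemma rdiag_add: "rdiag (x + y) = rdiag x + rdiag y"
  by (simp add: vec_eq_iff)

lemma rdiag_scaleR: "rdiag (r *\<^sub>R x) = r *\<^sub>R rdiag x"
  unfolding vec_eq_iff by (simp add: scaleR_conv_of_real[where 'a = complex])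

lemma inner_rdiag: "A \<bullet> rdiag y = (\<Sum>i\<in>UNIV. Re (A $ i $ i) * y $ i)"
proof -
  have "A $ i \<bullet> rdiag y $ i = (\<Sum>j\<in>UNIV. if j = i then Re (A $ i $ i) * y $ i else 0)" for i
    unfolding inner_vec_def by (rule sum.cong) (auto simp: inner_complex_def)
  then show ?thesis by (simp add: inner_vec_def[of A])
qed

lemma inner_rdiag_rdiag: "rdiag x \<bullet> rdiag y = x \<bullet> y"
  by (simp add: inner_rdiag) (simp add: inner_vec_def)

lemma norm_rdiag: "norm (rdiag x) = norm x"
  by (simp add: norm_eq_sqrt_inner inner_rdiag_rdiag)

lemma rdiag_inject: "rdiag x = rdiag y \<longleftrightarrow> x = y"
  by (auto simp: vec_eq_iff split: if_splits)

lemma hermitian_diagonal_rdiag: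
  assumes "dagger H = H" "H \<in> diagonal_matrices"
  obtains x where "H = rdiag x"
proof -
  have "H $ i $ i = of_real (Re (H $ i $ i))" for i
  proof -
    have "cnj (H $ i $ i) = H $ i $ i" using assms(1) by (metis dagger_nth)
    then show ?thesis by (simp add: complex_eq_iff)
  qed
  then have "H = rdiag (\<chi> i. Re (H $ i $ i))"
    using assms(2) by (auto simp: vec_eq_iff diagonal_matrices_def)
  then show ?thesis using that by blast
qed

lemma hexp_rdiag: "hexp z (rdiag x) = diagm (\<lambda>i. exp (z * of_real (x $ i)))"
  unfolding rdiag_def by (rule hexp_diagm)

lemma hexp_rdiag_add: "hexp z (rdiag (x + y)) = hexp z (rdiag x) ** hexp z (rdiag y)"
  by (simp add: hexp_rdiag diagm_mult exp_add distrib_left)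

lemma continuous_on_hexp_rdiag:
  assumes "continuous_on S f"
  shows "continuous_on S (\<lambda>s. hexp z (rdiag (f s)))"
  unfolding hexp_rdiag diagm_def
proof (intro continuous_on_vec_lambda)
  fix i j
  show "continuous_on S (\<lambda>s. if i = j then exp (z * of_real (f s $ i)) else 0)"
    by (cases "i = j") (auto intro!: continuous_intros assms)
qed

lemma commute_rdiag:
  "A ** rdiag x = rdiag x ** A \<longleftrightarrow> (\<forall>i j. x $ i \<noteq> x $ j \<longrightarrow> A $ i $ j = 0)"
proof -
  have 1: "(A ** rdiag x) $ i $ j = A $ i $ j * x $ j" for i j
    unfolding rdiag_def by (rule mult_diagm_nth)
  have 2: "(rdiag x ** A) $ i $ j = x $ i * A $ i $ j" for i j
    unfolding rdiag_def by (rule diagm_mult_nth)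
  show ?thesis unfolding vec_eq_iff 1 2 by (auto simp: mult.commute) metis+
qed

lemma commute_hexp_rdiag:
  assumes "A ** rdiag x = rdiag x ** A"
  shows "A ** hexp z (rdiag x) = hexp z (rdiag x) ** A"
proof -
  have "A $ i $ j * exp (z * of_real (x $ j)) = exp (z * of_real (x $ i)) * A $ i $ j" for i j
    using assms[unfolded commute_rdiag] by (cases "x $ i = x $ j") auto
  then show ?thesis by (simp add: vec_eq_iff hexp_rdiag mult_diagm_nth diagm_mult_nth)
qed

lemma subspace_diagonal_matrices: "subspace (diagonal_matrices :: (complex^'n^'n) set)"
  by (auto simp: subspace_def diagonal_matrices_def)

text \<open>A real vector space is not a finite union of proper subspaces; here the subspaces are the kernels
  of the functionals in \<open>L\<close> that do not vanish on all of \<open>E\<close>.\<close>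

lemma generic_element:
  fixes E :: "'a::real_vector set"
  assumes E: "subspace E" and L: "finite L" "\<And>l. l \<in> L \<Longrightarrow> linear (l :: 'a \<Rightarrow> real)"
  shows "\<exists>x\<in>E. \<forall>l\<in>L. (\<exists>y\<in>E. l y \<noteq> 0) \<longrightarrow> l x \<noteq> 0"
  using L
proof (induction L rule: finite_induct)
  case empty
  then show ?case using E subspace_0 by auto
next
  case (insert m L)
  then obtain x where x: "x \<in> E" "\<forall>l\<in>L. (\<exists>y\<in>E. l y \<noteq> 0) \<longrightarrow> l x \<noteq> 0" by auto
  show ?case
  proof (cases "m x \<noteq> 0 \<or> (\<forall>y\<in>E. m y = 0)")
    case True
    then show ?thesis using x by auto
  next
    case False
    then obtain y where y: "y \<in> E" "m y \<noteq> 0" and mx: "m x = 0" by blast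
    \<comment> \<open>only finitely many multiples of \<open>y\<close> destroy what \<open>x\<close> already satisfies\<close>
    have "finite (insert 0 ((\<lambda>l. - l x / l y) ` L))" using insert.hyps(1) by simp
    then obtain s :: real where s: "s \<notin> insert 0 ((\<lambda>l. - l x / l y) ` L)"
      using ex_new_if_finite[OF infinite_UNIV_char_0] by blast
    have "l (x + s *\<^sub>R y) \<noteq> 0" if l: "l \<in> insert m L" and ne: "\<exists>y\<in>E. l y \<noteq> 0" for l
    proof -
      have lin: "l (x + s *\<^sub>R y) = l x + s * l y"
        using insert.prems l by (simp add: linear_add linear_scale)
      show ?thesis
      proof (cases "l = m")
        case True
        then show ?thesis using lin mx y s by auto
      next
        case False
        then have "l \<in> L" using l by blast
        then have lx: "l x \<noteq> 0" "s \<noteq> - l x / l y" using x(2) ne s by auto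
        then show ?thesis unfolding lin by (cases "l y = 0") (auto simp: field_simps)
      qed
    qed
    moreover have "x + s *\<^sub>R y \<in> E" using E x y by (simp add: subspace_add subspace_scale)
    ultimately show ?thesis by blast
  qed
qed

locale maximal_diagonal_torus = compact_matrix_group K for K :: "(complex^'n^'n) set" +
  fixes T :: "(complex^'n^'n) set"
  assumes maximal: "maximal_torus K T" and diagonal: "T \<subseteq> diagonal_matrices"
begin

lemma T_subgroup: "subgroup T GL" and T_subset: "T \<subseteq> K" and T_connected: "connected T"
  and T_commute: "a \<in> T \<Longrightarrow> b \<in> T \<Longrightarrow> a ** b = b ** a"
  using maximal by (auto simp: maximal_torus_def connected_commutative_subgroup_of_def)

lemma T_maximal:
  assumes "subgroup S GL" "S \<subseteq> K" "connected S" "\<And>a b. a \<in> S \<Longrightarrow> b \<in> S \<Longrightarrow> a ** b = b ** a" "T \<subseteq> S"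
  shows "S = T"
proof -
  have "connected_commutative_subgroup_of K S"
    using assms by (auto simp: connected_commutative_subgroup_of_def)
  then show ?thesis using maximal assms(5) unfolding maximal_torus_def by blast
qed

lemma T_unitary: "T \<subseteq> unitary_group"
  using T_subset unitary by blast

lemmas T_mult = subgroup_GL(2)[OF T_subgroup]
lemmas T_one = subgroup_GL(1)[OF T_subgroup]
lemmas T_dagger = subgroup_GL_unitary_dagger[OF T_subgroup T_unitary]

text \<open>The closure of a connected commutative subgroup is another one, so maximality applies.\<close>

lemma T_closed: "closed T"
proof -
  let ?S = "closure T"
  have SK: "?S \<subseteq> K" using T_subset closed by (rule closure_minimal)
  have lim: "a \<in> ?S \<Longrightarrow> \<exists>f. (\<forall>n. f n \<in> T) \<and> f \<longlonglongrightarrow> a" for a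
    by (simp add: closure_sequential)
  have "subgroup ?S GL"
  proof (rule subgroup_GL_unitaryI)
    show "?S \<subseteq> unitary_group" using SK unitary by blast
    show "mat 1 \<in> ?S" using T_one closure_subset by blast
    show "a ** b \<in> ?S" if ab: "a \<in> ?S" "b \<in> ?S" for a b
    proof -
      obtain f g where f: "\<forall>n. f n \<in> T" "f \<longlonglongrightarrow> a" and g: "\<forall>n. g n \<in> T" "g \<longlonglongrightarrow> b"
        using lim ab by metis
      have "(\<lambda>n. f n ** g n) \<longlonglongrightarrow> a ** b" by (rule tendsto_matrix_mult[OF f(2) g(2)])
      moreover have "\<forall>n. f n ** g n \<in> T" using f g T_mult by blast
      ultimately show ?thesis unfolding closure_sequential by (intro exI conjI)
    qed
    show "dagger a \<in> ?S" if a: "a \<in> ?S" for a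
    proof -
      obtain f where f: "\<forall>n. f n \<in> T" "f \<longlonglongrightarrow> a" using lim a by metis
      have "(\<lambda>n. dagger (f n)) \<longlonglongrightarrow> dagger a" by (rule tendsto_dagger[OF f(2)])
      moreover have "\<forall>n. dagger (f n) \<in> T" using f T_dagger by blast
      ultimately show ?thesis unfolding closure_sequential by (intro exI conjI)
    qed
  qed
  moreover have "connected ?S" using T_connected by (rule connected_imp_connected_closure)
  moreover have "a ** b = b ** a" if ab: "a \<in> ?S" "b \<in> ?S" for a b
  proof -
    obtain f g where f: "\<forall>n. f n \<in> T" "f \<longlonglongrightarrow> a" and g: "\<forall>n. g n \<in> T" "g \<longlonglongrightarrow> b"
      using lim ab by metis
    have "(\<lambda>n. f n ** g n) \<longlonglongrightarrow> a ** b" by (rule tendsto_matrix_mult[OF f(2) g(2)])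
    moreover have "(\<lambda>n. g n ** f n) \<longlonglongrightarrow> b ** a" by (rule tendsto_matrix_mult[OF g(2) f(2)])
    moreover have "f n ** g n = g n ** f n" for n using T_commute f g by blast
    ultimately show ?thesis using LIMSEQ_unique by simp
  qed
  ultimately have "?S = T" by (intro T_maximal SK closure_subset)
  then show ?thesis by (metis closed_closure)
qed

sublocale T: compact_matrix_group T
  by (rule compact_matrix_group.intro[OF T_subgroup T_unitary T_closed])

lemma iLie_T_subset: "iLie T \<subseteq> iLie K"
proof
  fix H assume "H \<in> iLie T"
  then show "H \<in> iLie K" unfolding T.iLie iLie using T_subset by blast
qed

text \<open>The elements of \<open>iLie T\<close> are real and diagonal, so \<open>E\<close> parametrizes all of them.\<close>

definition E :: "(real^'n) set" where
  "E = {x. rdiag x \<in> iLie T}"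

lemma iLie_T_rdiag:
  assumes "H \<in> iLie T"
  obtains x where "x \<in> E" "H = rdiag x"
proof -
  have H: "dagger H = H" "\<And>t::real. hexp (\<i> * of_real t) H \<in> T"
    using assms by (auto simp: T.iLie)
  have "cscale \<i> H ** hexp (of_real 0 * \<i>) H \<in> diagonal_matrices"
  proof (rule vector_derivative_in_closed_subspace[OF subspace_diagonal_matrices _ hexp_has_vector_derivative[OF H(1)]])
    show "hexp (of_real t * \<i>) H \<in> diagonal_matrices" for t :: real
      using H(2)[of t] diagonal by (auto simp: mult.commute)
  qed
  then have "H \<in> diagonal_matrices" by (auto simp: diagonal_matrices_def)
  then show ?thesis
    using hermitian_diagonal_rdiag[OF H(1)] assms that by (metis E_def mem_Collect_eq)
qed

lemma iLie_T_eq: "iLie T = rdiag ` E"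
  using iLie_T_rdiag by (auto simp: E_def)

lemma subspace_E: "subspace E"
  using T.subspace_iLie by (auto simp: subspace_def E_def rdiag_add rdiag_scaleR vec_eq_iff[of "rdiag 0"])
    (metis rdiag_scaleR scaleR_zero_left)

lemma E_iff: "x \<in> E \<longleftrightarrow> (\<forall>t::real. hexp \<i> (rdiag (t *\<^sub>R x)) \<in> T)"
  by (simp add: E_def T.iLie rdiag_scaleR hexp_scaleR)

text \<open>The logarithm maps a neighbourhood of \<open>1\<close> in the closed group \<open>T\<close> into its Lie algebra. Otherwise there are
  elements \<open>t k \<longlonglongrightarrow> 1\<close> of \<open>T\<close> whose angle vectors \<open>\<theta> k\<close> have nonzero components \<open>\<beta> k\<close> orthogonal to \<open>E\<close>, and
  \<open>exp(i \<beta> k)\<close> lies in \<open>T\<close> as well. A limit direction \<open>l\<close> of the \<open>\<beta> k\<close> is orthogonal to \<open>E\<close>; but any \<open>s l\<close> is a limit of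
  integer multiples of the \<open>\<beta> k\<close>, hence \<open>exp(i s l)\<close> lies in \<open>T\<close> and \<open>l\<close> in \<open>E\<close>. So what holds for all \<open>exp(i x)\<close>
  with \<open>x \<in> E\<close> holds for all elements of \<open>T\<close> close to \<open>1\<close>.\<close>

lemma T_near_one:
  assumes P: "\<And>x. x \<in> E \<Longrightarrow> P (hexp \<i> (rdiag x))"
  shows "\<exists>e>0. \<forall>t\<in>T. norm (t - mat 1) < e \<longrightarrow> P t"
proof (rule ccontr)
  assume "\<not> ?thesis"
  then have "\<exists>t\<in>T. norm (t - mat 1) < 1 / real (Suc k) \<and> \<not> P t" for k
    by (metis of_nat_0_less_iff zero_less_Suc zero_less_divide_1_iff)
  then obtain t where t: "\<And>k. t k \<in> T" "\<And>k. norm (t k - mat 1) < 1 / real (Suc k)" "\<And>k. \<not> P (t k)"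
    by metis
  have t1: "t \<longlonglongrightarrow> mat 1"
  proof -
    have "(\<lambda>k. norm (t k - mat 1)) \<longlonglongrightarrow> 0"
      by (rule tendsto_sandwich[OF _ _ tendsto_const LIMSEQ_Suc[OF lim_1_over_n]])
         (auto intro!: always_eventually less_imp_le t(2)[unfolded of_nat_Suc] simp: add.commute)
    then show ?thesis by (simp add: tendsto_norm_zero_iff LIM_zero_iff)
  qed
  define \<theta> where "\<theta> k = (\<chi> i. Arg (t k $ i $ i))" for k
  have t_exp: "t k = hexp \<i> (rdiag (\<theta> k))" for k
  proof -
    have diag: "t k $ i $ j = 0" if "i \<noteq> j" for i j
      using diagonal t(1) that by (auto simp: diagonal_matrices_def)
    have "cmod (t k $ i $ i) = 1" for i
      using t(1) T_unitary diagonal by (intro cmod_diagonal_unitary) auto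
    then have "t k $ i $ i = exp (\<i> * of_real (Arg (t k $ i $ i)))" for i
      using Arg_eq[of "t k $ i $ i"] by (metis mult_1 norm_zero of_real_1 zero_neq_one)
    then show ?thesis by (simp add: vec_eq_iff hexp_rdiag \<theta>_def diag)
  qed
  have \<theta>0: "\<theta> \<longlonglongrightarrow> 0"
  proof (rule vec_tendstoI)
    fix i
    have "(\<lambda>k. t k $ i $ i) \<longlonglongrightarrow> mat 1 $ i $ i" by (intro tendsto_vec_nth t1)
    then have "(\<lambda>k. Arg (t k $ i $ i)) \<longlonglongrightarrow> Arg (mat 1 $ i $ i)"
      by (rule isCont_tendsto_compose[rotated]) (rule continuous_at_Arg, simp add: mat_def)
    then show "(\<lambda>k. \<theta> k $ i) \<longlonglongrightarrow> 0 $ i" by (simp add: \<theta>_def mat_def)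
  qed
  have "\<exists>\<alpha> \<beta>. \<alpha> \<in> E \<and> (\<forall>w\<in>E. \<beta> \<bullet> w = 0) \<and> \<theta> k = \<alpha> + \<beta>" for k
    using orthogonal_subspace_decomp_exists[of E "\<theta> k"] subspace_E
    by (metis orthogonal_def span_eq_iff)
  then obtain \<alpha> \<beta> where \<alpha>: "\<And>k. \<alpha> k \<in> E" and \<beta>: "\<And>k w. w \<in> E \<Longrightarrow> \<beta> k \<bullet> w = 0"
    and \<theta>_eq: "\<And>k. \<theta> k = \<alpha> k + \<beta> k" by metis
  have \<beta>ne: "\<beta> k \<noteq> 0" for k
    using P[OF \<alpha>[of k]] t(3)[of k] t_exp[of k] \<theta>_eq[of k] by auto
  have \<beta>le: "norm (\<beta> k) \<le> norm (\<theta> k)" for k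
  proof -
    have "(norm (\<theta> k))\<^sup>2 = (norm (\<alpha> k))\<^sup>2 + (norm (\<beta> k))\<^sup>2"
      using \<beta>[OF \<alpha>, of k k] by (simp add: \<theta>_eq power2_norm_eq_inner inner_add_left inner_add_right inner_commute)
    then have "(norm (\<beta> k))\<^sup>2 \<le> (norm (\<theta> k))\<^sup>2" by simp
    then show ?thesis by (rule power2_le_imp_le) simp
  qed
  have \<beta>0: "(\<lambda>k. norm (\<beta> k)) \<longlonglongrightarrow> 0"
    by (rule tendsto_sandwich[OF _ _ tendsto_const tendsto_norm_zero[OF \<theta>0]]) (auto simp: \<beta>le)
  have \<beta>T: "hexp \<i> (rdiag (\<beta> k)) \<in> T" for k
  proof -
    have "hexp \<i> (rdiag (\<beta> k)) = t k ** hexp \<i> (rdiag ((-1) *\<^sub>R \<alpha> k))"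
      unfolding t_exp by (subst hexp_rdiag_add[symmetric]) (simp add: \<theta>_eq)
    moreover have "hexp \<i> (rdiag ((-1) *\<^sub>R \<alpha> k)) \<in> T" using \<alpha> E_iff by blast
    ultimately show ?thesis using T_mult t(1) by simp
  qed
  have \<beta>T_int: "hexp \<i> (rdiag (of_int m *\<^sub>R \<beta> k)) \<in> T" for m k
  proof -
    have nat: "hexp \<i> (rdiag (of_nat m *\<^sub>R \<beta> k)) \<in> T" for m
    proof (induction m)
      case 0
      show ?case by (simp add: hexp_rdiag diagm_1 T_one)
    next
      case (Suc m)
      then show ?case by (simp add: scaleR_left_distrib hexp_rdiag_add T_mult \<beta>T)
    qed
    show ?thesis
    proof (cases "m \<ge> 0")
      case True
      then show ?thesis using nat[of "nat m"] by simp
    next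
      case False
      have "dagger (hexp \<i> (rdiag (of_nat (nat (- m)) *\<^sub>R \<beta> k))) = hexp (- \<i>) (rdiag (of_nat (nat (- m)) *\<^sub>R \<beta> k))"
        by (simp add: dagger_hexp)
      also have "\<dots> = hexp \<i> (rdiag (of_int m *\<^sub>R \<beta> k))"
        using False by (simp add: hexp_rdiag)
      finally show ?thesis using T_dagger[OF nat[of "nat (- m)"]] by simp
    qed
  qed
  define u where "u k = (1 / norm (\<beta> k)) *\<^sub>R \<beta> k" for k
  have "u k \<in> sphere 0 1" for k using \<beta>ne by (simp add: u_def)
  moreover have "compact (sphere (0::real^'n) 1)" by simp
  ultimately obtain l r where l: "l \<in> sphere 0 1" and r: "strict_mono (r :: nat \<Rightarrow> nat)" and ul: "(u \<circ> r) \<longlonglongrightarrow> l"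
    unfolding compact_def by (metis)
  have "l \<in> E"
    unfolding E_iff
  proof
    fix s :: real
    define m where "m k = \<lfloor>s / norm (\<beta> k)\<rfloor>" for k
    have m: "(\<lambda>k. of_int (m k) * norm (\<beta> k)) \<longlonglongrightarrow> s"
    proof -
      have "\<bar>of_int (m k) * norm (\<beta> k) - s\<bar> \<le> norm (\<beta> k)" for k
      proof -
        have "\<bar>of_int (m k) - s / norm (\<beta> k)\<bar> \<le> 1" unfolding m_def by linarith
        then have "\<bar>of_int (m k) - s / norm (\<beta> k)\<bar> * norm (\<beta> k) \<le> 1 * norm (\<beta> k)"
          by (rule mult_right_mono) simp
        also have "\<bar>of_int (m k) - s / norm (\<beta> k)\<bar> * norm (\<beta> k) = \<bar>(of_int (m k) - s / norm (\<beta> k)) * norm (\<beta> k)\<bar>"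
          by (simp add: abs_mult)
        finally show ?thesis using \<beta>ne[of k] by (simp add: left_diff_distrib)
      qed
      then have "(\<lambda>k. \<bar>of_int (m k) * norm (\<beta> k) - s\<bar>) \<longlonglongrightarrow> 0"
        by (intro tendsto_sandwich[OF _ _ tendsto_const \<beta>0]) auto
      then show ?thesis by (simp add: tendsto_rabs_zero_iff LIM_zero_iff)
    qed
    have "(\<lambda>k. (of_int (m (r k)) * norm (\<beta> (r k))) *\<^sub>R u (r k)) \<longlonglongrightarrow> s *\<^sub>R l"
      using tendsto_scaleR[OF LIMSEQ_subseq_LIMSEQ[OF m r] ul] by (simp add: o_def)
    moreover have "(of_int (m k) * norm (\<beta> k)) *\<^sub>R u k = of_int (m k) *\<^sub>R \<beta> k" for k
      using \<beta>ne by (simp add: u_def)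
    ultimately have lim: "(\<lambda>k. of_int (m (r k)) *\<^sub>R \<beta> (r k)) \<longlonglongrightarrow> s *\<^sub>R l" by simp
    have "continuous_on UNIV (\<lambda>x :: real^'n. hexp \<i> (rdiag x))" by (rule continuous_on_hexp_rdiag) (rule continuous_on_id)
    then have "isCont (\<lambda>x. hexp \<i> (rdiag x)) (s *\<^sub>R l)" by (simp add: continuous_on_eq_continuous_at)
    from isCont_tendsto_compose[OF this lim]
    show "hexp \<i> (rdiag (s *\<^sub>R l)) \<in> T"
      by (rule closed_sequentially[OF T_closed, rotated]) (rule \<beta>T_int)
  qed
  moreover have "l \<bullet> w = 0" if "w \<in> E" for w
  proof -
    have "(\<lambda>k. (u \<circ> r) k \<bullet> w) \<longlonglongrightarrow> l \<bullet> w" by (intro tendsto_intros ul)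
    moreover have "(u \<circ> r) k \<bullet> w = 0" for k using \<beta>[OF that] by (simp add: u_def)
    ultimately show ?thesis by (simp add: LIMSEQ_const_iff)
  qed
  ultimately have "l \<bullet> l = 0" by blast
  then show False using l by simp
qed

text \<open>The elements of \<open>T\<close> that commute with \<open>Y\<close> form a closed subgroup, which is open by the preceding
  lemma; and \<open>T\<close> is connected.\<close>

lemma commutes_with_T:
  assumes Y: "\<And>x. x \<in> E \<Longrightarrow> Y ** rdiag x = rdiag x ** Y" and a: "a \<in> T"
  shows "Y ** a = a ** Y"
proof -
  have "\<exists>e>0. \<forall>t\<in>T. norm (t - mat 1) < e \<longrightarrow> Y ** t = t ** Y"
    by (rule T_near_one) (rule commute_hexp_rdiag[OF Y])
  then obtain e where e: "e > 0" "\<And>t. t \<in> T \<Longrightarrow> norm (t - mat 1) < e \<Longrightarrow> Y ** t = t ** Y" by blast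
  define U where "U = {t \<in> T. Y ** t = t ** Y}"
  have "closedin (top_of_set T) U"
  proof -
    have "closed {t. Y ** t = t ** Y}" by (intro closed_Collect_eq continuous_intros)
    moreover have "U = T \<inter> {t. Y ** t = t ** Y}" by (auto simp: U_def)
    ultimately show ?thesis by (simp add: closedin_closed_Int)
  qed
  moreover have "openin (top_of_set T) U"
    unfolding openin_euclidean_subtopology_iff
  proof (intro conjI ballI)
    show "U \<subseteq> T" by (auto simp: U_def)
    fix b assume b: "b \<in> U"
    then have bT: "b \<in> T" and bY: "Y ** b = b ** Y" by (auto simp: U_def)
    have bu: "dagger b ** b = mat 1" "b ** dagger b = mat 1" using bT T_unitary unitary_groupD by auto
    have "c \<in> U" if c: "c \<in> T" "dist c b < e" for c
    proof -
      have "dagger b ** c - mat 1 = dagger b ** (c - b)"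
        by (simp add: matrix_mult_diff_right bu)
      then have "norm (dagger b ** c - mat 1) = norm (c - b)"
        using norm_unitary_mult_left[of "dagger b"] bu by simp
      then have "Y ** (dagger b ** c) = (dagger b ** c) ** Y"
        using e(2)[OF T_mult[OF T_dagger[OF bT] c(1)]] c(2) by (simp add: dist_norm)
      then have "b ** Y ** (dagger b ** c) = b ** (dagger b ** c ** Y)"
        by (simp add: matrix_mul_assoc[symmetric])
      then have "Y ** (b ** dagger b) ** c = (b ** dagger b) ** c ** Y"
        unfolding bY[symmetric] by (simp only: matrix_mul_assoc)
      then show ?thesis using c by (simp add: U_def bu)
    qed
    then show "\<exists>e>0. \<forall>x'\<in>T. dist x' b < e \<longrightarrow> x' \<in> U" using e(1) by blast
  qed
  moreover have "mat 1 \<in> U" by (simp add: U_def T_one)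
  ultimately have "U = T" using T_connected unfolding connected_clopen by blast
  then show ?thesis using a by (auto simp: U_def)
qed

text \<open>If \<open>Y\<close> centralizes the torus, then \<open>T\<close> and the one-parameter group of \<open>Y\<close> together generate a connected
  commutative group, which cannot exceed \<open>T\<close>.\<close>

lemma centralizer_of_E:
  assumes Y: "Y \<in> iLie K" and comm: "\<And>x. x \<in> E \<Longrightarrow> Y ** rdiag x = rdiag x ** Y"
  shows "Y \<in> iLie T"
proof -
  have Yh: "dagger Y = Y" using Y by (rule iLie_hermitian)
  define y where "y s = hexp (of_real s * \<i>) Y" for s :: real
  have yK: "y s \<in> K" for s using Y by (simp add: y_def iLie mult.commute)
  have y_add: "y (s + s') = y s ** y s'" for s s' by (simp add: y_def distrib_right hexp_add[OF Yh])
  have y_dag: "dagger (y s) = y (- s)" for s by (simp add: y_def dagger_hexp[OF Yh])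
  have y0: "y 0 = mat 1" by (simp add: y_def)
  have ya: "a ** y s = y s ** a" if a: "a \<in> T" for a s
  proof -
    have au: "dagger a ** a = mat 1" "a ** dagger a = mat 1" using a T_unitary unitary_groupD by auto
    have "a ** Y ** dagger a = Y ** (a ** dagger a)"
      using commutes_with_T[OF comm a] by (simp add: matrix_mul_assoc)
    then have "a ** Y ** dagger a = Y" by (simp add: au)
    then have "a ** y s ** dagger a = y s"
      using hexp_unitary_conj[OF au(1), of _ Y] by (metis y_def)
    then have "a ** y s ** (dagger a ** a) = y s ** a" by (simp add: matrix_mul_assoc)
    then show ?thesis by (simp add: au)
  qed
  define S where "S = (\<lambda>(a, s). a ** y s) ` (T \<times> UNIV)"
  have mem: "a ** y s \<in> S" if "a \<in> T" for a s using that by (force simp: S_def)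
  have prod: "(a ** y s) ** (b ** y s') = (a ** b) ** y (s + s')" if "a \<in> T" "b \<in> T" for a b s s'
  proof -
    have "(a ** y s) ** (b ** y s') = a ** (y s ** b) ** y s'" by (simp add: matrix_mul_assoc)
    also have "y s ** b = b ** y s" using ya[OF that(2)] by simp
    finally show ?thesis by (simp add: matrix_mul_assoc y_add)
  qed
  have "S = T"
  proof (rule T_maximal)
    show SK: "S \<subseteq> K" using T_subset mult yK by (auto simp: S_def)
    show "subgroup S GL"
    proof (rule subgroup_GL_unitaryI)
      show "S \<subseteq> unitary_group" using SK unitary by blast
      show "mat 1 \<in> S" using mem[OF T_one, of 0] by (simp add: y0)
      show "c ** d \<in> S" if cd: "c \<in> S" "d \<in> S" for c d
      proof -
        obtain a s b s' where "a \<in> T" "c = a ** y s" "b \<in> T" "d = b ** y s'" using cd by (auto simp: S_def)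
        then show ?thesis by (simp add: prod mem T_mult)
      qed
      show "dagger c \<in> S" if c: "c \<in> S" for c
      proof -
        obtain a s where a: "a \<in> T" "c = a ** y s" using c by (auto simp: S_def)
        have "dagger c = dagger a ** y (- s)"
          by (simp add: a dagger_mult y_dag ya[OF T_dagger[OF a(1)]])
        then show ?thesis using mem[OF T_dagger[OF a(1)]] by simp
      qed
    qed
    show "connected S"
      unfolding S_def
    proof (rule connected_continuous_image)
      show "connected (T \<times> (UNIV :: real set))" by (intro connected_Times T_connected connected_UNIV)
      have "continuous_on (T \<times> UNIV) (\<lambda>p. fst p ** y (snd p))"
        unfolding y_def
        by (intro continuous_intros continuous_on_compose2[OF continuous_hexp[OF Yh, of UNIV]]) auto
      then show "continuous_on (T \<times> UNIV) (\<lambda>(a, s). a ** y s)" by (simp add: case_prod_beta)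
    qed
    show "c ** d = d ** c" if cd: "c \<in> S" "d \<in> S" for c d
    proof -
      obtain a s b s' where ab: "a \<in> T" "c = a ** y s" "b \<in> T" "d = b ** y s'" using cd by (auto simp: S_def)
      show ?thesis using T_commute[OF ab(1,3)] by (simp add: ab prod add.commute)
    qed
    show "T \<subseteq> S" using mem[of _ 0] by (auto simp: y0)
  qed
  then have "y s \<in> T" for s using mem[OF T_one, of s] by simp
  then show ?thesis using Yh by (simp add: T.iLie y_def mult.commute)
qed

text \<open>Choose \<open>x0 \<in> E\<close> with as many distinct entries as possible, so that commuting with \<open>rdiag x0\<close> means
  commuting with the whole torus. Let \<open>k\<close> maximize \<open>(k Y k\<^sup>*) \<bullet> rdiag x0\<close> over the compact group \<open>K\<close>.
  The derivative of this function in the direction of \<open>Z = i [k Y k\<^sup>*, rdiag x0]\<close> is \<open>|Z|\<^sup>2\<close>, so at the maximum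
  \<open>k Y k\<^sup>*\<close> commutes with \<open>rdiag x0\<close>.\<close>

theorem conjugate_into_torus:
  assumes Y: "Y \<in> iLie K"
  shows "\<exists>k\<in>K. k ** Y ** dagger k \<in> iLie T"
proof -
  define L where "L = (\<lambda>(i, j). \<lambda>x :: real^'n. x $ i - x $ j) ` UNIV"
  have "linear l" if "l \<in> L" for l
    using that by (auto simp: L_def linear_iff algebra_simps)
  moreover have "finite L" by (simp add: L_def)
  ultimately obtain x0 where x0: "x0 \<in> E" "\<forall>l\<in>L. (\<exists>y\<in>E. l y \<noteq> 0) \<longrightarrow> l x0 \<noteq> 0"
    using generic_element[OF subspace_E, of L] by blast
  have gen: "x0 $ i \<noteq> x0 $ j" if "x \<in> E" "x $ i \<noteq> x $ j" for x i j
  proof -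
    have "(\<lambda>x. x $ i - x $ j) \<in> L" by (force simp: L_def)
    then show ?thesis using x0(2) that by fastforce
  qed
  let ?f = "\<lambda>k. (k ** Y ** dagger k) \<bullet> rdiag x0"
  have "\<exists>k\<in>K. \<forall>k'\<in>K. ?f k' \<le> ?f k"
    using one by (intro continuous_attains_sup compact continuous_intros) auto
  then obtain k where k: "k \<in> K" and max: "\<And>k'. k' \<in> K \<Longrightarrow> ?f k' \<le> ?f k" by blast
  define Y' where "Y' = k ** Y ** dagger k"
  have Y': "Y' \<in> iLie K" unfolding Y'_def by (rule iLie_conj[OF Y k])
  define Z where "Z = cscale \<i> (Y' ** rdiag x0 - rdiag x0 ** Y')"
  have X0: "rdiag x0 \<in> iLie K" using x0(1) iLie_T_subset by (auto simp: E_def)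
  have Z: "Z \<in> iLie K" unfolding Z_def by (rule iLie_bracket[OF Y' X0])
  have Zh: "dagger Z = Z" and Y'h: "dagger Y' = Y'" using Z Y' iLie_hermitian by auto
  define \<psi> where "\<psi> t = (hexp (of_real t * \<i>) Z ** Y' ** hexp (of_real t * - \<i>) Z) \<bullet> rdiag x0" for t :: real
  have "(\<psi> has_vector_derivative (cscale \<i> (Z ** Y' - Y' ** Z) \<bullet> rdiag x0)) (at 0)"
    unfolding \<psi>_def
    by (rule bounded_linear.has_vector_derivative[OF bounded_linear_inner_left hexp_conjugation_derivative[OF Zh]])
  then have der: "DERIV \<psi> 0 :> cscale \<i> (Z ** Y' - Y' ** Z) \<bullet> rdiag x0"
    by (simp add: has_real_derivative_iff_has_vector_derivative)
  moreover have "\<psi> t \<le> \<psi> 0" for t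
  proof -
    have "hexp (of_real t * \<i>) Z ** k \<in> K"
      using Z k mult by (simp add: iLie mult.commute)
    from max[OF this] show ?thesis
      by (simp add: \<psi>_def Y'_def dagger_mult dagger_hexp[OF Zh] matrix_mul_assoc)
  qed
  ultimately have "cscale \<i> (Z ** Y' - Y' ** Z) \<bullet> rdiag x0 = 0"
    using DERIV_local_max[OF der, of 1] by auto
  moreover have "cscale \<i> (Z ** Y' - Y' ** Z) \<bullet> rdiag x0 = Z \<bullet> Z"
  proof -
    have "cscale \<i> (Z ** Y' - Y' ** Z) \<bullet> rdiag x0 = Re (trace (cscale \<i> (Z ** Y' - Y' ** Z) ** rdiag x0))"
    proof -
      have "dagger (cscale \<i> (Z ** Y' - Y' ** Z)) = cscale \<i> (Z ** Y' - Y' ** Z)"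
        by (simp add: dagger_cscale dagger_diff dagger_mult Zh Y'h) (simp add: vec_eq_iff algebra_simps)
      then show ?thesis by (simp add: inner_matrix_trace)
    qed
    also have "cscale \<i> (Z ** Y' - Y' ** Z) ** rdiag x0 = cscale \<i> (Z ** (Y' ** rdiag x0)) - cscale \<i> (Y' ** (Z ** rdiag x0))"
      by (simp add: cscale_mult_left matrix_mult_diff_left matrix_mul_assoc) (simp add: vec_eq_iff algebra_simps)
    also have "trace \<dots> = \<i> * trace (Z ** (Y' ** rdiag x0)) - \<i> * trace (Y' ** (Z ** rdiag x0))"
      by (simp add: trace_def sum_subtractf sum_distrib_left)
    also have "trace (Y' ** (Z ** rdiag x0)) = trace (Z ** (rdiag x0 ** Y'))"
      by (metis matrix_mul_assoc trace_mul_sym)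
    also have "\<i> * trace (Z ** (Y' ** rdiag x0)) - \<i> * trace (Z ** (rdiag x0 ** Y')) = trace (Z ** Z)"
    proof -
      have "Z ** Z = cscale \<i> (Z ** (Y' ** rdiag x0) - Z ** (rdiag x0 ** Y'))"
        by (subst (2) Z_def) (simp add: cscale_mult_right matrix_mult_diff_right)
      then show ?thesis by (simp add: trace_def sum_subtractf sum_distrib_left right_diff_distrib)
    qed
    finally show ?thesis by (simp add: inner_matrix_trace Zh)
  qed
  ultimately have "Z = 0" by simp
  then have comm0: "Y' ** rdiag x0 = rdiag x0 ** Y'"
    by (simp add: Z_def vec_eq_iff)
  have "Y' ** rdiag x = rdiag x ** Y'" if "x \<in> E" for x
    using comm0 gen[OF that] unfolding commute_rdiag by blast
  then have "Y' \<in> iLie T" by (rule centralizer_of_E[OF Y'])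
  then show ?thesis using k Y'_def by blast
qed

end

section \<open>Rational representations\<close>

lemma polynomial_in_sum:
  "(\<And>i. i \<in> I \<Longrightarrow> polynomial_in S (f i)) \<Longrightarrow> polynomial_in S (\<lambda>x. \<Sum>i\<in>I. f i x)"
  by (induction I rule: infinite_finite_induct) (auto intro: polynomial_in.intros)

lemma polynomial_in_prod:
  "(\<And>i. i \<in> I \<Longrightarrow> polynomial_in S (f i)) \<Longrightarrow> polynomial_in S (\<lambda>x. \<Prod>i\<in>I. f i x)"
  by (induction I rule: infinite_finite_induct) (auto intro: polynomial_in.intros)

lemma polynomial_in_entry: "polynomial_in matrix_entries (\<lambda>g. g $ i $ j)"
  by (rule polynomial_in.gen) (auto simp: matrix_entries_def)

lemma polynomial_in_det: "polynomial_in matrix_entries (det :: complex^'n^'n \<Rightarrow> complex)"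
  unfolding det_def
  by (intro polynomial_in_sum polynomial_in.mult polynomial_in.const polynomial_in_prod polynomial_in_entry)

lemma polynomial_in_continuous:
  assumes "polynomial_in matrix_entries p"
  shows "continuous_on S p"
  using assms
proof induction
  case (gen f)
  then obtain i j where "f = (\<lambda>g. g $ i $ j)" by (auto simp: matrix_entries_def)
  then show ?case by (auto intro!: continuous_intros)
qed (auto intro!: continuous_intros)

text \<open>Complex linearity of the derivative carries information on the action of unitary elements over
  to the Hermitian directions.\<close>

definition has_complex_derivative ::
    "(complex^'n^'n \<Rightarrow> complex) \<Rightarrow> (complex^'n^'n \<Rightarrow> complex) \<Rightarrow> complex^'n^'n \<Rightarrow> bool" where
  "has_complex_derivative f D a \<longleftrightarrow> (f has_derivative D) (at a) \<and> (\<forall>c X. D (cscale c X) = c * D X)"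

lemma polynomial_in_complex_derivative:
  assumes "polynomial_in S p" and "\<And>f. f \<in> S \<Longrightarrow> \<exists>D. has_complex_derivative f D a"
  shows "\<exists>D. has_complex_derivative p D a"
  using assms
proof induction
  case (const c)
  then show ?case by (intro exI[of _ "\<lambda>_. 0"]) (auto simp: has_complex_derivative_def)
next
  case (add f g)
  then obtain D E where "has_complex_derivative f D a" "has_complex_derivative g E a" by blast
  then show ?case
    by (intro exI[of _ "\<lambda>x. D x + E x"]) (auto simp: has_complex_derivative_def distrib_left intro: has_derivative_add)
next
  case (mult f g)
  then obtain D E where "has_complex_derivative f D a" "has_complex_derivative g E a" by blast
  moreover from this have "((\<lambda>x. f x * g x) has_derivative (\<lambda>x. f a * E x + D x * g a)) (at a)"
    by (intro has_derivative_mult) (auto simp: has_complex_derivative_def)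
  ultimately show ?case
    by (intro exI[of _ "\<lambda>x. f a * E x + D x * g a"])
      (auto simp: has_complex_derivative_def algebra_simps)
qed auto

lemma matrix_entries_complex_derivative:
  "f \<in> matrix_entries \<Longrightarrow> \<exists>D. has_complex_derivative f D a"
proof -
  assume "f \<in> matrix_entries"
  then obtain i j where "f = (\<lambda>g. g $ i $ j)" by (auto simp: matrix_entries_def)
  then have "has_complex_derivative f f a"
    by (auto simp: has_complex_derivative_def intro: bounded_linear_imp_has_derivative bounded_linear_matrix_nth)
  then show ?thesis by blast
qed

lemma inverse_det_complex_derivative:
  assumes "det a \<noteq> 0"
  shows "\<exists>D. has_complex_derivative (\<lambda>g. inverse (det g)) D a"
proof -
  obtain D where D: "has_complex_derivative det D a"
    using polynomial_in_complex_derivative[OF polynomial_in_det matrix_entries_complex_derivative] by blast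
  then have "((\<lambda>g. inverse (det g)) has_derivative (\<lambda>h. - (inverse (det a) * D h * inverse (det a)))) (at a)"
    by (intro Deriv.has_derivative_inverse assms) (simp add: has_complex_derivative_def)
  then show ?thesis using D
    by (intro exI[of _ "\<lambda>h. - (inverse (det a) * D h * inverse (det a))"]) (simp add: has_complex_derivative_def)
qed

lemma rational_representation_derivative:
  fixes G :: "(complex^'n^'n) set" and \<pi> :: "complex^'n^'n \<Rightarrow> complex^'m^'m"
  assumes "rational_representation G \<pi>"
  shows "\<exists>D P. (P has_derivative D) (at (mat 1)) \<and> (\<forall>g\<in>G. \<pi> g = P g) \<and> (\<forall>c X. D (cscale c X) = cscale c (D X))"
proof -
  obtain p where p: "\<And>k l. polynomial_in (insert (\<lambda>g. inverse (det g)) matrix_entries) (p k l)"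
    and eq: "\<And>k l g. g \<in> G \<Longrightarrow> \<pi> g $ k $ l = p k l g"
    using assms unfolding rational_representation_def by metis
  have "\<exists>D. has_complex_derivative (p k l) D (mat 1)" for k l
    by (rule polynomial_in_complex_derivative[OF p])
      (auto intro: inverse_det_complex_derivative matrix_entries_complex_derivative)
  then obtain D where D: "\<And>k l. has_complex_derivative (p k l) (D k l) (mat 1)" by metis
  define P :: "complex^'n^'n \<Rightarrow> complex^'m^'m" where "P g = (\<chi> k l. p k l g)" for g
  have "(P has_derivative (\<lambda>X. \<chi> k l. D k l X)) (at (mat 1))"
    unfolding P_def using D by (intro has_derivative_vec) (auto simp: has_complex_derivative_def)
  moreover have "\<forall>g\<in>G. \<pi> g = P g" by (simp add: P_def eq vec_eq_iff)
  moreover have "\<forall>c X. (\<chi> k l. D k l (cscale c X)) = cscale c (\<chi> k l. D k l X)"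
    using D by (simp add: has_complex_derivative_def vec_eq_iff)
  ultimately show ?thesis by blast
qed

lemma compact_matrix_group_symmetric:
  assumes "symmetric_subgroup G"
  shows "compact_matrix_group (G \<inter> unitary_group)"
proof (rule compact_matrix_group.intro)
  have sub: "subgroup G GL" and Zar: "Zariski_closed G" and dag: "\<And>g. g \<in> G \<Longrightarrow> dagger g \<in> G"
    using assms by (auto simp: symmetric_subgroup_def)
  have d: "dagger a \<in> unitary_group" if "a \<in> unitary_group" for a :: "complex^'a^'a"
    using unitary_groupD(2)[OF that] by (simp add: unitary_group_def)
  have "mat 1 \<in> (unitary_group :: (complex^'a^'a) set)" by (simp add: unitary_group_def)
  then show "subgroup (G \<inter> unitary_group) GL"
    by (intro subgroup_GL_unitaryI) (auto simp: subgroup_GL(1,2)[OF sub] mult_in_unitary_group dag d)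
  obtain P where P: "\<And>p. p \<in> P \<Longrightarrow> polynomial_in matrix_entries p"
    and Geq: "G = {g \<in> carrier GL. \<forall>p\<in>P. p g = 0}"
    using Zar by (auto simp: Zariski_closed_def)
  have "G \<inter> unitary_group = unitary_group \<inter> (\<Inter>p\<in>P. {g. p g = 0})"
    using unitary_groupD by (fastforce simp: Geq GL_def invertible_def)
  moreover have "closed (\<Inter>p\<in>P. {g. p g = 0})"
    by (intro closed_INT ballI closed_Collect_eq polynomial_in_continuous P continuous_on_const)
  then have "closed (unitary_group \<inter> (\<Inter>p\<in>P. {g. p g = 0}))"
    by (rule closed_Int[OF compact_imp_closed[OF compact_unitary_group]])
  ultimately show "closed (G \<inter> unitary_group)" by simp
qed simp

locale symmetric_representation = hermitian_form h
  for h :: "complex^'m \<Rightarrow> complex^'m \<Rightarrow> complex" +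
  fixes G K :: "(complex^'n^'n) set" and \<pi> :: "complex^'n^'n \<Rightarrow> complex^'m^'m"
  assumes symmetric: "symmetric_subgroup G" and K_eq: "K = G \<inter> unitary_group"
    and rational: "rational_representation G \<pi>" and invariant: "invariant_inner_product K \<pi> h"
begin

sublocale compact_matrix_group K
  unfolding K_eq by (rule compact_matrix_group_symmetric[OF symmetric])

lemma G_subgroup: "subgroup G GL"
  using symmetric by (simp add: symmetric_subgroup_def)

lemmas G_one = subgroup_GL(1)[OF G_subgroup]
lemmas G_mult = subgroup_GL(2)[OF G_subgroup]
lemmas G_invertible = subgroup_GL(3)[OF G_subgroup]

lemma K_in_G: "k \<in> K \<Longrightarrow> k \<in> G"
  by (simp add: K_eq)

lemma hexp_in_G: "H \<in> iLie K \<Longrightarrow> hexp z H \<in> G"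
  using hexp_iLie_in_group[OF symmetric] by (simp add: K_eq)

lemma pi_mult: "g \<in> G \<Longrightarrow> k \<in> G \<Longrightarrow> \<pi> (g ** k) = \<pi> g ** \<pi> k"
  using rational by (auto simp: rational_representation_def hom_def GL_def)

lemma pi_invertible: "g \<in> G \<Longrightarrow> invertible (\<pi> g)"
  using rational by (auto simp: rational_representation_def hom_def GL_def)

lemma pi_one: "\<pi> (mat 1) = mat 1"
proof -
  obtain a where a: "a ** \<pi> (mat 1) = mat 1"
    using pi_invertible[OF G_one] by (auto simp: invertible_def)
  have "\<pi> (mat 1) = \<pi> (mat 1) ** \<pi> (mat 1)" using pi_mult[OF G_one G_one] by simp
  then have "a ** \<pi> (mat 1) = (a ** \<pi> (mat 1)) ** \<pi> (mat 1)" by (metis matrix_mul_assoc)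
  then show ?thesis by (simp add: a)
qed

lemma hnorm_K: "k \<in> K \<Longrightarrow> hnorm h (\<pi> k *v x) = hnorm h x"
  using invariant by (simp add: invariant_inner_product_def hnorm_def)

text \<open>The derivative at \<open>1\<close> of a function that is differentiable on a neighbourhood of \<open>1\<close> in the space
  of all matrices and extends \<open>\<pi>\<close>. It is complex linear on all matrices and agrees with
  \<open>Lie_rep \<pi>\<close> on \<open>iLie K\<close>.\<close>

definition dpi :: "complex^'n^'n \<Rightarrow> complex^'m^'m" where
  "dpi = (SOME D. \<exists>P. (P has_derivative D) (at (mat 1)) \<and> (\<forall>g\<in>G. \<pi> g = P g)
      \<and> (\<forall>c X. D (cscale c X) = cscale c (D X)))"

lemma dpi: "\<exists>P. (P has_derivative dpi) (at (mat 1)) \<and> (\<forall>g\<in>G. \<pi> g = P g)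
      \<and> (\<forall>c X. dpi (cscale c X) = cscale c (dpi X))"
  unfolding dpi_def using someI_ex[OF rational_representation_derivative[OF rational]] .

lemma dpi_bounded_linear: "bounded_linear dpi"
  using dpi has_derivative_bounded_linear by blast

lemmas dpi_linear = bounded_linear.linear[OF dpi_bounded_linear]

lemma dpi_cscale: "dpi (cscale c X) = cscale c (dpi X)"
  using dpi by blast

lemma pi_curve_derivative:
  assumes "\<And>t. f t \<in> G" "f 0 = mat 1" "(f has_vector_derivative f') (at (0::real))"
  shows "((\<lambda>t. \<pi> (f t)) has_vector_derivative dpi f') (at 0)"
proof -
  obtain P where P: "(P has_derivative dpi) (at (mat 1))" "\<forall>g\<in>G. \<pi> g = P g" using dpi by blast
  have "((P \<circ> f) has_vector_derivative dpi f') (at 0)"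
    by (rule vector_derivative_diff_chain_within[OF assms(3)])
      (use P(1) assms(2) in \<open>auto intro: has_derivative_at_withinI\<close>)
  moreover have "P \<circ> f = (\<lambda>t. \<pi> (f t))" using P(2) assms(1) by auto
  ultimately show ?thesis by simp
qed

lemma pi_hexp_add:
  assumes "H \<in> iLie K"
  shows "\<pi> (hexp (z + w) H) = \<pi> (hexp z H) ** \<pi> (hexp w H)"
  by (simp add: hexp_add[OF iLie_hermitian[OF assms]] pi_mult hexp_in_G assms)

lemma pi_hexp_derivative_0:
  assumes "H \<in> iLie K"
  shows "((\<lambda>t. \<pi> (hexp (of_real t * c) H)) has_vector_derivative cscale c (dpi H)) (at 0)"
proof -
  have "((\<lambda>t. hexp (of_real t * c) H) has_vector_derivative cscale c H) (at 0)"
    using hexp_has_vector_derivative[OF iLie_hermitian[OF assms], of c 0] by simp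
  from pi_curve_derivative[OF _ _ this] show ?thesis
    by (simp add: hexp_in_G[OF assms] dpi_cscale)
qed

lemma pi_hexp_derivative:
  assumes "H \<in> iLie K"
  shows "((\<lambda>t. \<pi> (hexp (of_real t * c) H)) has_vector_derivative cscale c (dpi H) ** \<pi> (hexp (of_real t * c) H)) (at t)"
    and "((\<lambda>t. \<pi> (hexp (of_real t * c) H)) has_vector_derivative \<pi> (hexp (of_real t * c) H) ** cscale c (dpi H)) (at t)"
proof -
  have "((\<lambda>s. \<pi> (hexp (of_real (s - t) * c) H)) has_vector_derivative cscale c (dpi H)) (at t)"
    using vector_diff_chain_at[of "\<lambda>s. s - t" 1 t "\<lambda>t. \<pi> (hexp (of_real t * c) H)" "cscale c (dpi H)"]
      pi_hexp_derivative_0[OF assms, of c]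
    by (simp add: o_def has_vector_derivative_diff_const has_vector_derivative_id)
  note d = this
  have 1: "\<pi> (hexp (of_real s * c) H) = \<pi> (hexp (of_real (s - t) * c) H) ** \<pi> (hexp (of_real t * c) H)" for s
    by (subst pi_hexp_add[OF assms, symmetric]) (simp add: algebra_simps)
  have 2: "\<pi> (hexp (of_real s * c) H) = \<pi> (hexp (of_real t * c) H) ** \<pi> (hexp (of_real (s - t) * c) H)" for s
    by (subst pi_hexp_add[OF assms, symmetric]) (simp add: algebra_simps)
  show "((\<lambda>t. \<pi> (hexp (of_real t * c) H)) has_vector_derivative cscale c (dpi H) ** \<pi> (hexp (of_real t * c) H)) (at t)"
    by (subst 1) (rule bounded_linear.has_vector_derivative[OF bounded_linear_mult_left d])
  show "((\<lambda>t. \<pi> (hexp (of_real t * c) H)) has_vector_derivative \<pi> (hexp (of_real t * c) H) ** cscale c (dpi H)) (at t)"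
    by (subst 2) (rule bounded_linear.has_vector_derivative[OF bounded_linear_mult_right d])
qed

lemma Lie_rep_eq: "H \<in> iLie K \<Longrightarrow> Lie_rep \<pi> H = dpi H"
  unfolding Lie_rep_def mexp_scaleR_hexp
  using pi_hexp_derivative_0[of H 1] by (simp add: vector_derivative_at)

text \<open>The operators \<open>\<pi>(exp(i t H))\<close> preserve the inner product; their derivative \<open>i dpi H\<close> at \<open>0\<close> is therefore
  skew-adjoint.\<close>

lemma dpi_self_adjoint:
  assumes "H \<in> iLie K"
  shows "self_adjoint (dpi H)"
  unfolding self_adjoint_def
proof (intro allI)
  fix x y
  define u where "u t = \<pi> (hexp (of_real t * \<i>) H)" for t :: real
  have uK: "hexp (of_real t * \<i>) H \<in> K" for t using assms by (simp add: iLie mult.commute)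
  have const: "h (u t *v x) (u t *v y) = h x y" for t
    using invariant uK by (simp add: invariant_inner_product_def u_def)
  have d: "((\<lambda>t. u t *v z) has_vector_derivative cscale \<i> (dpi H) *v z) (at 0)" for z
    unfolding u_def
    by (rule bounded_linear.has_vector_derivative[OF bounded_linear_vector_left pi_hexp_derivative_0[OF assms]])
  have "((\<lambda>t. h (u t *v x) (u t *v y)) has_vector_derivative
      h (u 0 *v x) (cscale \<i> (dpi H) *v y) + h (cscale \<i> (dpi H) *v x) (u 0 *v y)) (at 0)"
    by (rule bounded_bilinear.has_vector_derivative[OF bounded_bilinear d d])
  then have "h (u 0 *v x) (cscale \<i> (dpi H) *v y) + h (cscale \<i> (dpi H) *v x) (u 0 *v y) = 0"
    unfolding const using vector_derivative_unique_at has_vector_derivative_const by blast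
  then have "\<i> * h x (dpi H *v y) - \<i> * h (dpi H *v x) y = 0"
    by (simp add: u_def pi_one cscale_mult_vec scale_right scale_left)
  then show "h (dpi H *v x) y = h x (dpi H *v y)" by simp
qed

text \<open>Both sides solve the same linear differential equation along \<open>t \<mapsto> t z\<close>.\<close>

lemma pi_hexp_eigenvector:
  assumes H: "H \<in> iLie K" and b: "dpi H *v b = l *s b"
  shows "\<pi> (hexp z H) *v b = exp (z * l) *s b"
proof (rule vec_eq_iff[THEN iffD2, rule_format])
  fix i
  define w where "w t = (\<pi> (hexp (of_real t * z) H) *v b) $ i" for t :: real
  have "((\<lambda>t. (\<pi> (hexp (of_real t * z) H) *v b) $ i) has_vector_derivative
      (\<pi> (hexp (of_real t * z) H) ** cscale z (dpi H) *v b) $ i) (at t)" for t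
    by (rule bounded_linear.has_vector_derivative[OF bounded_linear_vec_nth
        bounded_linear.has_vector_derivative[OF bounded_linear_vector_left pi_hexp_derivative(2)[OF H]]])
  moreover have "(\<pi> (hexp (of_real t * z) H) ** cscale z (dpi H) *v b) $ i = z * l * w t" for t
    by (simp add: w_def matrix_vector_mul_assoc[symmetric] cscale_mult_vec b vec.scale)
  ultimately have w: "(w has_vector_derivative z * l * w t) (at t)" for t
    by (simp add: w_def[abs_def])
  have e: "((\<lambda>t. exp (- (of_real t * (z * l)))) has_vector_derivative - (z * l) * exp (- (of_real t * (z * l)))) (at t)" for t
  proof -
    have "((\<lambda>x. exp (- (x * (z * l)))) has_field_derivative - (z * l) * exp (- (of_real t * (z * l)))) (at (of_real t))"
      by (auto intro!: derivative_eq_intros)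
    then show ?thesis by (rule has_vector_derivative_real_field)
  qed
  have "((\<lambda>t. exp (- (of_real t * (z * l))) * w t) has_vector_derivative 0) (at t within UNIV)" for t
    using has_vector_derivative_mult[OF e w, of t] by (simp add: algebra_simps)
  then obtain c where c: "\<And>t. exp (- (of_real t * (z * l))) * w t = c"
    using has_vector_derivative_zero_constant[of UNIV "\<lambda>t. exp (- (of_real t * (z * l))) * w t"] by auto
  have "c = b $ i" using c[of 0] by (simp add: w_def pi_one)
  then have "exp (- (z * l)) * w 1 = b $ i" using c[of 1] by simp
  then have "w 1 = exp (z * l) * b $ i" by (simp add: exp_minus field_simps)
  then show "(\<pi> (hexp z H) *v b) $ i = (exp (z * l) *s b) $ i" by (simp add: w_def)
qed

lemma dpi_commute:
  assumes H: "H \<in> iLie K" "H' \<in> iLie K" and comm: "\<And>z w. hexp z H ** hexp w H' = hexp w H' ** hexp z H"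
  shows "dpi H ** dpi H' = dpi H' ** dpi H"
proof -
  have d: "((\<lambda>t. \<pi> (hexp (of_real t) H)) has_vector_derivative dpi H) (at 0)" if "H \<in> iLie K" for H
    using pi_hexp_derivative_0[OF that, of 1] by simp
  have eq: "\<pi> (hexp z H) ** \<pi> (hexp w H') = \<pi> (hexp w H') ** \<pi> (hexp z H)" for z w
    by (simp add: pi_mult[symmetric] hexp_in_G H comm)
  have "dpi H ** \<pi> (hexp w H') = \<pi> (hexp w H') ** dpi H" for w
    using bounded_linear.has_vector_derivative[OF bounded_linear_mult_left d[OF H(1)], of "\<pi> (hexp w H')"]
      bounded_linear.has_vector_derivative[OF bounded_linear_mult_right d[OF H(1)], of "\<pi> (hexp w H')"]
    unfolding eq by (rule vector_derivative_unique_at)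
  note eq2 = this
  show ?thesis
    using bounded_linear.has_vector_derivative[OF bounded_linear_mult_right d[OF H(2)], of "dpi H"]
      bounded_linear.has_vector_derivative[OF bounded_linear_mult_left d[OF H(2)], of "dpi H"]
    unfolding eq2 by (rule vector_derivative_unique_at)
qed

end

section \<open>Weights\<close>

lemma Riesz_subspace:
  fixes l :: "'a::euclidean_space \<Rightarrow> real"
  assumes "linear l" "subspace E"
  shows "\<exists>w\<in>E. \<forall>x\<in>E. l x = x \<bullet> w"
proof -
  have "\<exists>a. \<forall>x. l x = x \<bullet> a"
    using adjoint_works[OF assms(1), of _ 1] by (intro exI[of _ "adjoint l 1"]) simp
  then obtain a where l: "\<And>x. l x = x \<bullet> a" by blast
  obtain y z where yz: "y \<in> span E" "\<And>w. w \<in> span E \<Longrightarrow> orthogonal z w" "a = y + z"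
    using orthogonal_subspace_decomp_exists[of E a] by blast
  have s: "span E = E" using assms(2) span_eq_iff by blast
  have "l x = x \<bullet> y" if "x \<in> E" for x
    using yz(2)[of x] that by (simp add: l s yz(3) orthogonal_def inner_add_right inner_commute)
  then show ?thesis using yz s by blast
qed

locale torus_representation = symmetric_representation h G K \<pi> + maximal_diagonal_torus K T
  for h :: "complex^'m \<Rightarrow> complex^'m \<Rightarrow> complex" and G K T :: "(complex^'n^'n) set"
    and \<pi> :: "complex^'n^'n \<Rightarrow> complex^'m^'m"
begin

lemma E_iLie: "x \<in> E \<Longrightarrow> rdiag x \<in> iLie K"
  using iLie_T_subset by (auto simp: E_def)

text \<open>The operators \<open>dpi (rdiag x)\<close> with \<open>x \<in> E\<close> are self-adjoint and commute. On a joint eigenvector the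
  eigenvalue is a linear functional of \<open>x\<close>, represented by a vector \<open>\<omega> b\<close> of \<open>E\<close>.\<close>

lemma weight_basis:
  obtains B \<omega> where "orthonormal B" "\<And>x. x = (\<Sum>b\<in>B. h b x *s b)" "\<And>b. b \<in> B \<Longrightarrow> \<omega> b \<in> E"
    "\<And>b x. b \<in> B \<Longrightarrow> x \<in> E \<Longrightarrow> dpi (rdiag x) *v b = of_real (x \<bullet> \<omega> b) *s b"
proof -
  have comm: "dpi (rdiag x) ** dpi (rdiag y) = dpi (rdiag y) ** dpi (rdiag x)" if "x \<in> E" "y \<in> E" for x y
    by (rule dpi_commute) (auto simp: E_iLie that hexp_rdiag diagm_mult mult.commute)
  have "\<exists>B. orthonormal B \<and> (\<forall>A\<in>(\<lambda>x. dpi (rdiag x)) ` E. \<forall>b\<in>B. \<exists>l::real. A *v b = of_real l *s b) \<and> (\<forall>x. x = (\<Sum>b\<in>B. h b x *s b))"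
    by (rule joint_eigenbasis[of "(\<lambda>x. dpi (rdiag x)) ` E"]) (use dpi_self_adjoint E_iLie in blast, use comm in blast, blast)
  then obtain B where on: "orthonormal B" and ex: "\<And>x. x = (\<Sum>b\<in>B. h b x *s b)"
    and eig: "\<And>x b. x \<in> E \<Longrightarrow> b \<in> B \<Longrightarrow> \<exists>l::real. dpi (rdiag x) *v b = of_real l *s b"
    by blast
  have "\<exists>w\<in>E. \<forall>x\<in>E. dpi (rdiag x) *v b = of_real (x \<bullet> w) *s b" if b: "b \<in> B" for b
  proof -
    have bb: "h b b = 1" using on b by (simp add: orthonormal_def)
    define l where "l x = Re (h b (dpi (rdiag x) *v b))" for x
    have "linear l"
      by (rule linearI) (simp_all add: l_def rdiag_add rdiag_scaleR linear_add[OF dpi_linear] linear_scale[OF dpi_linear]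
          matrix_vector_mult_add_rdistrib add_right bounded_bilinear.scaleR_left[OF bounded_bilinear_matrix_vector] scaleR_right)
    then obtain w where w: "w \<in> E" "\<And>x. x \<in> E \<Longrightarrow> l x = x \<bullet> w" using Riesz_subspace[OF _ subspace_E] by blast
    have "dpi (rdiag x) *v b = of_real (x \<bullet> w) *s b" if x: "x \<in> E" for x
    proof -
      obtain r :: real where r: "dpi (rdiag x) *v b = of_real r *s b" using eig x b by blast
      then have "l x = r" by (simp add: l_def scale_right bb)
      then show ?thesis using r w x by simp
    qed
    then show ?thesis using w by blast
  qed
  then obtain \<omega> where "\<And>b. b \<in> B \<Longrightarrow> \<omega> b \<in> E \<and> (\<forall>x\<in>E. dpi (rdiag x) *v b = of_real (x \<bullet> \<omega> b) *s b)"
    by metis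
  then show ?thesis using that[OF on ex, of \<omega>] by blast
qed

text \<open>Absolute values and phases of the entries separate the two factors of \<open>mexp (t H)\<close>: the absolute
  values give the real part \<open>x\<close>, the phases the imaginary part \<open>y\<close> of the diagonal of \<open>H\<close>.\<close>

lemma Lie_complexified_torus:
  assumes H: "H \<in> Lie (complexified_torus T)"
  obtains x y where "x \<in> E" "y \<in> E" "H = diagm (\<lambda>i. Complex (x $ i) (y $ i))"
proof -
  have "\<exists>a x. a \<in> T \<and> x \<in> E \<and> mexp (t *\<^sub>R H) = a ** hexp 1 (rdiag x)" for t
    using H iLie_T_eq by (force simp: Lie_def complexified_torus_def hexp_def)
  then obtain a x where a: "\<And>t. a t \<in> T" and x: "\<And>t. x t \<in> E" and e: "\<And>t. mexp (t *\<^sub>R H) = a t ** hexp 1 (rdiag (x t))"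
    by metis
  have ad: "a t $ i $ j = 0" if "i \<noteq> j" for i j t
    using a diagonal that by (auto simp: diagonal_matrices_def)
  have ent: "mexp (t *\<^sub>R H) $ i $ j = a t $ i $ j * exp (of_real (x t $ j))" for t i j
    by (simp add: e hexp_rdiag mult_diagm_nth)
  have "H \<in> diagonal_matrices"
    by (rule vector_derivative_in_closed_subspace[OF subspace_diagonal_matrices _ mexp_has_vector_derivative_0])
      (simp add: diagonal_matrices_def ent ad)
  define X where "X = (\<chi> i. Re (H $ i $ i))"
  define Y where "Y = (\<chi> i. Im (H $ i $ i))"
  have Heq: "H = diagm (\<lambda>i. Complex (X $ i) (Y $ i))"
    using \<open>H \<in> diagonal_matrices\<close> by (auto simp: vec_eq_iff diagonal_matrices_def X_def Y_def)
  have mH: "mexp (t *\<^sub>R H) $ i $ i = exp (of_real t * Complex (X $ i) (Y $ i))" for t i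
    unfolding mexp_scaleR_hexp by (subst Heq) (simp add: hexp_diagm)
  have aii: "cmod (a t $ i $ i) = 1" for t i
    using a T_unitary diagonal by (intro cmod_diagonal_unitary) auto
  have xt: "x t $ i = t * X $ i" for t i
  proof -
    have "exp (t * X $ i) = cmod (mexp (t *\<^sub>R H) $ i $ i)" unfolding mH by (simp add: norm_exp_eq_Re)
    also have "\<dots> = exp (x t $ i)" unfolding ent by (simp add: norm_mult aii norm_exp_eq_Re)
    finally show ?thesis by simp
  qed
  have "X = x 1" by (simp add: vec_eq_iff xt)
  then have XE: "X \<in> E" using x by simp
  have "Y \<in> E"
    unfolding E_iff
  proof
    fix t :: real
    have "hexp \<i> (rdiag (t *\<^sub>R Y)) = a t"
    proof -
      have "exp (of_real t * Complex (X $ i) (Y $ i)) = a t $ i $ i * exp (of_real (t * X $ i))" for i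
        using mH[of t i] ent[of t i i] by (simp add: xt)
      moreover have "exp (of_real t * Complex (X $ i) (Y $ i)) = exp (\<i> * of_real (t * Y $ i)) * exp (of_real (t * X $ i))" for i
        by (simp add: exp_add[symmetric] Complex_eq algebra_simps)
      ultimately have "exp (\<i> * of_real (t * Y $ i)) = a t $ i $ i" for i by simp
      then show ?thesis by (simp add: vec_eq_iff hexp_rdiag ad)
    qed
    then show "hexp \<i> (rdiag (t *\<^sub>R Y)) \<in> T" using a by simp
  qed
  with XE Heq show ?thesis using that by blast
qed

lemma rdiag_in_Lie_complexified:
  assumes "x \<in> E"
  shows "rdiag x \<in> Lie (complexified_torus T)"
  unfolding Lie_def
proof (intro CollectI allI)
  fix t :: real
  have "t *\<^sub>R rdiag x \<in> iLie T" using assms T.iLie_scaleR by (simp add: E_def)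
  then show "mexp (t *\<^sub>R rdiag x) \<in> complexified_torus T"
    using T_one by (force simp: complexified_torus_def)
qed

lemma trace_diagm_rdiag: "trace (diagm f ** rdiag w) = (\<Sum>i\<in>UNIV. f i * of_real (w $ i))"
  by (simp add: rdiag_def diagm_mult trace_def)

text \<open>A vector of weight \<open>W\<close> has a nonzero component along some \<open>b\<close>, on which the torus acts by the
  character of \<open>\<omega> b\<close> as well as by that of \<open>W\<close>. In particular there are only finitely many weights, which makes the
  weight margin positive.\<close>

lemma weights_basis_weights:
  assumes on: "orthonormal B" and ex: "\<And>x. x = (\<Sum>b\<in>B. h b x *s b)" and \<omega>: "\<And>b. b \<in> B \<Longrightarrow> \<omega> b \<in> E"
    and eig: "\<And>b x. b \<in> B \<Longrightarrow> x \<in> E \<Longrightarrow> dpi (rdiag x) *v b = of_real (x \<bullet> \<omega> b) *s b"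
  shows "weights T \<pi> = (\<lambda>b. rdiag (\<omega> b)) ` B"
proof (intro equalityI subsetI)
  fix W assume "W \<in> (\<lambda>b. rdiag (\<omega> b)) ` B"
  then obtain b where b: "b \<in> B" "W = rdiag (\<omega> b)" by blast
  have eig': "\<pi> (hexp z (rdiag x)) *v b = exp (z * of_real (x \<bullet> \<omega> b)) *s b" if "x \<in> E" for x z
    by (rule pi_hexp_eigenvector[OF E_iLie[OF that] eig[OF b(1) that]])
  have "b \<in> weight_space T \<pi> W"
    unfolding weight_space_def
  proof (intro CollectI ballI)
    fix H assume "H \<in> Lie (complexified_torus T)"
    then obtain x y where xy: "x \<in> E" "y \<in> E" and H: "H = diagm (\<lambda>i. Complex (x $ i) (y $ i))"
      by (rule Lie_complexified_torus)
    have "mexp H = hexp 1 (rdiag x) ** hexp \<i> (rdiag y)"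
      by (simp add: H mexp_diagm hexp_rdiag diagm_mult exp_add[symmetric] Complex_eq)
    then have "\<pi> (mexp H) *v b = \<pi> (hexp 1 (rdiag x)) *v (\<pi> (hexp \<i> (rdiag y)) *v b)"
      by (simp add: pi_mult hexp_in_G E_iLie xy matrix_vector_mul_assoc)
    also have "\<dots> = (exp (\<i> * of_real (y \<bullet> \<omega> b)) * exp (of_real (x \<bullet> \<omega> b))) *s b"
      using eig'[OF xy(2), of \<i>] eig'[OF xy(1), of 1] by (simp add: vec.scale)
    also have "exp (\<i> * of_real (y \<bullet> \<omega> b)) * exp (of_real (x \<bullet> \<omega> b)) = exp (trace (H ** W))"
    proof -
      have "trace (H ** W) = of_real (x \<bullet> \<omega> b) + \<i> * of_real (y \<bullet> \<omega> b)"
        by (simp add: H b(2) trace_diagm_rdiag inner_vec_def Complex_eq sum_distrib_left algebra_simps flip: sum.distrib)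
      then show ?thesis by (simp add: exp_add mult.commute)
    qed
    finally show "\<pi> (mexp H) *v b = exp (trace (H ** W)) *s b" .
  qed
  moreover have "h b b = 1" using on b(1) by (simp add: orthonormal_def)
  then have "b \<noteq> 0" by auto
  moreover have "W \<in> iLie T" using \<omega>[OF b(1)] b(2) by (simp add: E_def)
  ultimately show "W \<in> weights T \<pi>" by (auto simp: weights_def)
next
  fix W assume W: "W \<in> weights T \<pi>"
  then have "W \<in> iLie T" by (simp add: weights_def)
  then obtain w where w: "w \<in> E" "W = rdiag w" by (rule iLie_T_rdiag)
  have "0 \<in> weight_space T \<pi> W" by (simp add: weight_space_def)
  then obtain v where v: "v \<in> weight_space T \<pi> W" "v \<noteq> 0"
    using W by (auto simp: weights_def)
  have "\<exists>b\<in>B. h b v \<noteq> 0"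
  proof (rule ccontr)
    assume "\<not> ?thesis"
    then have "(\<Sum>b\<in>B. h b v *s b) = 0" by simp
    then show False using ex[of v] v(2) by simp
  qed
  then obtain b where b: "b \<in> B" "h b v \<noteq> 0" by blast
  have "x \<bullet> \<omega> b = x \<bullet> w" if x: "x \<in> E" for x
  proof -
    let ?A = "\<pi> (hexp 1 (rdiag x))"
    have "?A *v v = exp (trace (rdiag x ** W)) *s v"
      using v(1) rdiag_in_Lie_complexified[OF x] unfolding weight_space_def by (simp add: hexp_def)
    also have "trace (rdiag x ** W) = of_real (x \<bullet> w)"
      by (simp add: w(2) rdiag_def[of x] trace_diagm_rdiag inner_vec_def)
    finally have 1: "h b (?A *v v) = exp (of_real (x \<bullet> w)) * h b v" by (simp add: scale_right)
    have "?A *v v = (\<Sum>c\<in>B. h c v *s (?A *v c))"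
      by (subst ex[of v]) (simp add: vec.sum vec.scale)
    also have "\<dots> = (\<Sum>c\<in>B. h c v *s (exp (of_real (x \<bullet> \<omega> c)) *s c))"
    proof (rule sum.cong)
      fix c assume "c \<in> B"
      show "h c v *s (?A *v c) = h c v *s (exp (of_real (x \<bullet> \<omega> c)) *s c)"
        using pi_hexp_eigenvector[OF E_iLie[OF x] eig[OF \<open>c \<in> B\<close> x], of 1] by simp
    qed simp
    finally have "h b (?A *v v) = (\<Sum>c\<in>B. h c v * (exp (of_real (x \<bullet> \<omega> c)) * h b c))"
      by (simp add: sum_right scale_right mult.assoc)
    also have "\<dots> = (\<Sum>c\<in>B. if c = b then h b v * exp (of_real (x \<bullet> \<omega> b)) else 0)"
      using on b(1) by (intro sum.cong) (auto simp: orthonormal_def)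
    also have "\<dots> = h b v * exp (of_real (x \<bullet> \<omega> b))"
      using on b(1) by (simp add: orthonormal_def)
    finally have "exp (complex_of_real (x \<bullet> \<omega> b)) = exp (complex_of_real (x \<bullet> w))"
      using 1 b(2) by simp
    then show ?thesis by (simp add: exp_of_real)
  qed
  then have "x \<bullet> (\<omega> b - w) = 0" if "x \<in> E" for x using that by (simp add: inner_diff_right)
  from this[of "\<omega> b - w"] have "\<omega> b = w"
    using subspace_diff[OF subspace_E \<omega>[OF b(1)] w(1)] by simp
  then show "W \<in> (\<lambda>b. rdiag (\<omega> b)) ` B" using b w by blast
qed

lemma hnorm_torus:
  assumes on: "orthonormal B" and ex: "\<And>x. x = (\<Sum>b\<in>B. h b x *s b)"
    and eig: "\<And>b x. b \<in> B \<Longrightarrow> x \<in> E \<Longrightarrow> dpi (rdiag x) *v b = of_real (x \<bullet> \<omega> b) *s b"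
    and x: "x \<in> E"
  shows "(hnorm h (\<pi> (hexp 1 (rdiag x)) *v v))\<^sup>2 = (\<Sum>b\<in>B. (cmod (h b v))\<^sup>2 * exp (2 * (x \<bullet> \<omega> b)))"
proof -
  let ?A = "\<pi> (hexp 1 (rdiag x))"
  define c where "c b = h b v * exp (of_real (x \<bullet> \<omega> b))" for b
  have c: "(cmod (c a))\<^sup>2 = (cmod (h a v))\<^sup>2 * exp (2 * (x \<bullet> \<omega> a))" for a
    by (simp add: c_def norm_mult power_mult_distrib norm_exp_eq_Re exp_double)
  have fin: "finite B" and ortho: "\<And>a b. a \<in> B \<Longrightarrow> b \<in> B \<Longrightarrow> h a b = (if a = b then 1 else 0)"
    using on by (auto simp: orthonormal_def)
  have "?A *v v = (\<Sum>b\<in>B. h b v *s (?A *v b))"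
    by (subst ex[of v]) (simp add: vec.sum vec.scale)
  also have "\<dots> = (\<Sum>b\<in>B. c b *s b)"
  proof (rule sum.cong)
    fix b assume "b \<in> B"
    show "h b v *s (?A *v b) = c b *s b"
      using pi_hexp_eigenvector[OF E_iLie[OF x] eig[OF \<open>b \<in> B\<close> x], of 1] by (simp add: c_def vector_smult_assoc)
  qed simp
  finally have Av: "?A *v v = (\<Sum>b\<in>B. c b *s b)" .
  have "h (?A *v v) (?A *v v) = (\<Sum>a\<in>B. \<Sum>b\<in>B. cnj (c a) * (c b * h a b))"
    unfolding Av by (simp add: sum_left scale_left) (simp add: sum_right scale_right sum_distrib_left)
  also have "\<dots> = (\<Sum>a\<in>B. \<Sum>b\<in>B. if b = a then cnj (c a) * c a else 0)"
    by (intro sum.cong) (auto simp: ortho)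
  also have "\<dots> = (\<Sum>a\<in>B. cnj (c a) * c a)" using fin by simp
  also have "\<dots> = of_real (\<Sum>a\<in>B. (cmod (c a))\<^sup>2)"
    by (simp add: complex_norm_square mult.commute del: of_real_power)
  finally have "(hnorm h (?A *v v))\<^sup>2 = (\<Sum>a\<in>B. (cmod (c a))\<^sup>2)" by (simp add: hnorm_sq)
  then show ?thesis by (simp add: c)
qed

end

section \<open>Geometric programs\<close>

lemma convex_hull_image_coefficients:
  fixes \<omega> :: "'b \<Rightarrow> 'a::real_vector"
  assumes "finite S" "x \<in> convex hull (\<omega> ` S)"
  shows "\<exists>q. (\<forall>b\<in>S. q b \<ge> 0) \<and> sum q S = 1 \<and> x = (\<Sum>b\<in>S. q b *\<^sub>R \<omega> b)"
proof -
  define C where "C = {x. \<exists>q. (\<forall>b\<in>S. q b \<ge> 0) \<and> sum q S = 1 \<and> x = (\<Sum>b\<in>S. q b *\<^sub>R \<omega> b)}"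
  have "convex C"
  proof (rule convexI)
    fix x y and u v :: real assume "x \<in> C" "y \<in> C" and uv: "0 \<le> u" "0 \<le> v" "u + v = 1"
    then obtain q q' where q: "\<forall>b\<in>S. q b \<ge> 0" "sum q S = 1" "x = (\<Sum>b\<in>S. q b *\<^sub>R \<omega> b)"
      and q': "\<forall>b\<in>S. q' b \<ge> 0" "sum q' S = 1" "y = (\<Sum>b\<in>S. q' b *\<^sub>R \<omega> b)"
      unfolding C_def by auto
    have "(\<Sum>b\<in>S. u * q b + v * q' b) = 1"
      by (simp add: sum.distrib sum_distrib_left[symmetric] q q' uv)
    moreover have "u *\<^sub>R x + v *\<^sub>R y = (\<Sum>b\<in>S. (u * q b + v * q' b) *\<^sub>R \<omega> b)"
      by (simp add: q q' scaleR_sum_right scaleR_left_distrib sum.distrib)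
    moreover have "\<forall>b\<in>S. u * q b + v * q' b \<ge> 0" using q q' uv by simp
    ultimately show "u *\<^sub>R x + v *\<^sub>R y \<in> C"
      unfolding C_def by (intro CollectI exI[of _ "\<lambda>b. u * q b + v * q' b"] conjI)
  qed
  moreover have "\<omega> ` S \<subseteq> C"
  proof
    fix y assume "y \<in> \<omega> ` S"
    then obtain c where c: "c \<in> S" "y = \<omega> c" by blast
    have "(\<Sum>b\<in>S. (if b = c then 1 else 0) *\<^sub>R \<omega> b) = (\<Sum>b\<in>S. if b = c then \<omega> b else 0)"
      by (rule sum.cong) auto
    then show "y \<in> C"
      unfolding C_def using c assms(1) by (intro CollectI exI[of _ "\<lambda>b. if b = c then 1 else 0"]) auto
  qed
  ultimately have "convex hull (\<omega> ` S) \<subseteq> C" by (intro hull_minimal)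
  then show ?thesis using assms(2) unfolding C_def by blast
qed

text \<open>As long as \<open>0\<close> is a convex combination of the \<open>\<omega> b\<close> with \<open>b\<close> in the support of what is left, a multiple of this
  combination can be split off so that the support shrinks.\<close>

lemma maximal_balanced_part:
  fixes \<omega> :: "'b \<Rightarrow> 'a::real_vector" and c :: "'b \<Rightarrow> real"
  assumes B: "finite B" and "\<And>b. b \<in> B \<Longrightarrow> c b \<ge> 0"
  shows "\<exists>a. (\<forall>b\<in>B. 0 \<le> a b \<and> a b \<le> c b) \<and> (\<Sum>b\<in>B. a b *\<^sub>R \<omega> b) = 0
     \<and> 0 \<notin> convex hull (\<omega> ` {b \<in> B. c b - a b > 0})"
  using assms(2)
proof (induction "card {b \<in> B. c b > 0}" arbitrary: c rule: less_induct)
  case less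
  let ?S = "{b \<in> B. c b > 0}"
  show ?case
  proof (cases "0 \<in> convex hull (\<omega> ` ?S)")
    case False
    then show ?thesis using less.prems by (intro exI[of _ "\<lambda>_. 0"]) auto
  next
    case True
    obtain q where q: "\<And>b. b \<in> ?S \<Longrightarrow> q b \<ge> 0" "sum q ?S = 1" "(\<Sum>b\<in>?S. q b *\<^sub>R \<omega> b) = 0"
      using convex_hull_image_coefficients[OF _ True] B by auto
    let ?Q = "{b \<in> ?S. q b > 0}"
    have "?Q \<noteq> {}"
    proof
      assume "?Q = {}"
      then have "sum q ?S = 0" using q(1) by (intro sum.neutral) force
      then show False using q(2) by simp
    qed
    moreover have "finite ?Q" using B by simp
    ultimately have "Min ((\<lambda>b. c b / q b) ` ?Q) \<in> (\<lambda>b. c b / q b) ` ?Q"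
      by (intro Min_in) auto
    then obtain m where m: "m \<in> ?Q" and m_eq: "Min ((\<lambda>b. c b / q b) ` ?Q) = c m / q m" by blast
    have min: "c m / q m \<le> c b / q b" if "b \<in> ?Q" for b
      unfolding m_eq[symmetric] using that \<open>finite ?Q\<close> by (intro Min_le) auto
    \<comment> \<open>the largest multiple of the vanishing combination that fits below \<open>c\<close>\<close>
    define s where "s = c m / q m"
    define e where "e b = (if b \<in> ?S then s * q b else 0)" for b
    have s: "s > 0" using m by (simp add: s_def)
    have e: "0 \<le> e b" "e b \<le> c b" if "b \<in> B" for b
    proof -
      show "0 \<le> e b" using q(1) s by (simp add: e_def)
      show "e b \<le> c b"
      proof (cases "b \<in> ?Q")
        case True
        then have "s \<le> c b / q b" using min unfolding s_def by blast
        then show ?thesis using True by (simp add: e_def field_simps)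
      next
        case False
        then have "e b = 0" using q(1)[of b] by (auto simp: e_def)
        then show ?thesis using less.prems that by simp
      qed
    qed
    have em: "e m = c m" using m by (simp add: e_def s_def)
    have esum: "(\<Sum>b\<in>B. e b *\<^sub>R \<omega> b) = 0"
    proof -
      have "(\<Sum>b\<in>B. e b *\<^sub>R \<omega> b) = (\<Sum>b\<in>?S. (s * q b) *\<^sub>R \<omega> b)"
        using B by (intro sum.mono_neutral_cong_right) (auto simp: e_def)
      also have "\<dots> = s *\<^sub>R (\<Sum>b\<in>?S. q b *\<^sub>R \<omega> b)" by (simp add: scaleR_sum_right)
      finally show ?thesis by (simp add: q(3))
    qed
    define c' where "c' b = c b - e b" for b
    have "{b \<in> B. c' b > 0} \<subset> ?S"
    proof
      show "{b \<in> B. c' b > 0} \<subseteq> ?S" using e by (force simp: c'_def)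
      have "m \<notin> {b \<in> B. c' b > 0}" using em by (simp add: c'_def)
      moreover have "m \<in> ?S" using m by simp
      ultimately show "{b \<in> B. c' b > 0} \<noteq> ?S" by blast
    qed
    then have "card {b \<in> B. c' b > 0} < card ?S" using B by (intro psubset_card_mono) auto
    moreover have "c' b \<ge> 0" if "b \<in> B" for b using e that by (simp add: c'_def)
    ultimately obtain a where a: "\<forall>b\<in>B. 0 \<le> a b \<and> a b \<le> c' b" "(\<Sum>b\<in>B. a b *\<^sub>R \<omega> b) = 0"
      "0 \<notin> convex hull (\<omega> ` {b \<in> B. c' b - a b > 0})"
      using less.hyps[of c'] by blast
    have "(\<Sum>b\<in>B. (a b + e b) *\<^sub>R \<omega> b) = 0"
      by (simp add: scaleR_left_distrib sum.distrib a esum)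
    moreover have "\<forall>b\<in>B. 0 \<le> a b + e b \<and> a b + e b \<le> c b" using a(1) e by (auto simp: c'_def)
    moreover have "c' b - a b = c b - (a b + e b)" for b by (simp add: c'_def)
    then have "0 \<notin> convex hull (\<omega> ` {b \<in> B. c b - (a b + e b) > 0})" using a(3) by (simp only: not_False_eq_True)
    ultimately show ?thesis by (intro exI[of _ "\<lambda>b. a b + e b"] conjI)
  qed
qed

text \<open>The value \<open>sum c B\<close> and the gradient \<open>2 (\<Sum>b\<in>B. c b *\<^sub>R \<omega> b)\<close> are those of the exponential sum at \<open>0\<close>. Split
  \<open>c = a + d\<close> with \<open>a\<close> balanced and \<open>0\<close> outside the convex hull of the support of \<open>d\<close>. The balanced part
  contributes at least \<open>sum a B\<close> to every value of the exponential sum, since \<open>exp u \<ge> 1 + u\<close>, and nothing to the gradient; so the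
  gap is at most \<open>sum d B\<close>, and \<open>\<gamma> * sum d B\<close> is at most the norm of half the gradient.\<close>

lemma gradient_lower_bound:
  fixes \<omega> :: "'b \<Rightarrow> 'a::real_inner" and c :: "'b \<Rightarrow> real"
  assumes B: "finite B" and c: "\<And>b. b \<in> B \<Longrightarrow> c b \<ge> 0" and \<gamma>: "\<gamma> \<ge> 0"
    and margin: "\<And>d. (\<And>b. b \<in> B \<Longrightarrow> d b \<ge> 0) \<Longrightarrow> 0 \<notin> convex hull (\<omega> ` {b \<in> B. d b > 0}) \<Longrightarrow>
      \<gamma> * sum d B \<le> norm (\<Sum>b\<in>B. d b *\<^sub>R \<omega> b)"
  shows "\<gamma> * (sum c B - (\<Sum>b\<in>B. c b * exp (2 * (x \<bullet> \<omega> b)))) \<le> norm (\<Sum>b\<in>B. c b *\<^sub>R \<omega> b)"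
proof -
  obtain a where a: "\<And>b. b \<in> B \<Longrightarrow> 0 \<le> a b \<and> a b \<le> c b" "(\<Sum>b\<in>B. a b *\<^sub>R \<omega> b) = 0"
    "0 \<notin> convex hull (\<omega> ` {b \<in> B. c b - a b > 0})"
    using maximal_balanced_part[where \<omega> = \<omega> and c = c, OF B c] by blast
  have "sum a B = (\<Sum>b\<in>B. a b * (1 + 2 * (x \<bullet> \<omega> b)))"
  proof -
    have "(\<Sum>b\<in>B. a b * (1 + 2 * (x \<bullet> \<omega> b))) = sum a B + 2 * (x \<bullet> (\<Sum>b\<in>B. a b *\<^sub>R \<omega> b))"
      by (simp add: inner_sum_right sum_distrib_left sum.distrib distrib_left mult_ac)
    then show ?thesis by (simp add: a(2))
  qed
  also have "\<dots> \<le> (\<Sum>b\<in>B. a b * exp (2 * (x \<bullet> \<omega> b)))"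
    using a(1) exp_ge_add_one_self by (intro sum_mono mult_left_mono) auto
  also have "\<dots> \<le> (\<Sum>b\<in>B. c b * exp (2 * (x \<bullet> \<omega> b)))"
    using a(1) by (intro sum_mono mult_right_mono) auto
  finally have "sum c B - (\<Sum>b\<in>B. c b * exp (2 * (x \<bullet> \<omega> b))) \<le> (\<Sum>b\<in>B. c b - a b)"
    by (simp add: sum_subtractf)
  then have "\<gamma> * (sum c B - (\<Sum>b\<in>B. c b * exp (2 * (x \<bullet> \<omega> b)))) \<le> \<gamma> * (\<Sum>b\<in>B. c b - a b)"
    using \<gamma> by (rule mult_left_mono)
  also have "\<dots> \<le> norm (\<Sum>b\<in>B. (c b - a b) *\<^sub>R \<omega> b)"
    using a by (intro margin) auto
  also have "(\<Sum>b\<in>B. (c b - a b) *\<^sub>R \<omega> b) = (\<Sum>b\<in>B. c b *\<^sub>R \<omega> b)"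
    by (simp add: scaleR_diff_left sum_subtractf a(2))
  finally show ?thesis .
qed

lemma exp_quadratic_upper_bound:
  fixes s :: real
  assumes "s \<le> 1 / 2"
  shows "exp s \<le> 1 + s + 2 * s\<^sup>2"
proof -
  have "1 - s \<le> exp (- s)" using exp_ge_add_one_self[of "- s"] by simp
  then have "exp s * (1 - s) \<le> exp s * exp (- s)" by (intro mult_left_mono) auto
  then have "exp s * (1 - s) \<le> 1" by (simp add: exp_minus)
  also have "1 \<le> (1 + s + 2 * s\<^sup>2) * (1 - s)"
  proof -
    have "0 \<le> s\<^sup>2 * (1 - 2 * s)" using assms by (intro mult_nonneg_nonneg) auto
    then show ?thesis by (simp add: power2_eq_square algebra_simps)
  qed
  finally show ?thesis using assms by (simp add: mult_le_cancel_right)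
qed

text \<open>Gradient descent with steps of fixed length \<open>\<eta> = r / k\<close>. One step multiplies the gap by \<open>1 - 2 \<gamma> \<eta>\<close> up to an
  error \<open>M \<eta>\<^sup>2\<close> from the second order term; after \<open>k\<close> steps the factor is at most \<open>exp(- 2 \<gamma> r)\<close> and the total
  error \<open>M r\<^sup>2 / k\<close> is as small as desired.\<close>

lemma geometric_program_descent:
  fixes \<omega> :: "'b \<Rightarrow> 'a::real_inner" and c :: "'b \<Rightarrow> real" and B :: "'b set"
  defines "f \<equiv> \<lambda>x. \<Sum>b\<in>B. c b * exp (2 * (x \<bullet> \<omega> b))"
  assumes B: "finite B" and c: "\<And>b. b \<in> B \<Longrightarrow> c b \<ge> 0" and \<gamma>: "\<gamma> > 0"
    and margin: "\<And>d. (\<And>b. b \<in> B \<Longrightarrow> d b \<ge> 0) \<Longrightarrow> 0 \<notin> convex hull (\<omega> ` {b \<in> B. d b > 0}) \<Longrightarrow>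
      \<gamma> * sum d B \<le> norm (\<Sum>b\<in>B. d b *\<^sub>R \<omega> b)"
    and E: "subspace E" "\<And>b. b \<in> B \<Longrightarrow> \<omega> b \<in> E"
    and r: "r \<ge> 0" and \<delta>: "\<delta> > 0" and x0: "f x0 \<le> f 0"
  shows "\<exists>x\<in>E. norm x \<le> r \<and> f x - f x0 \<le> exp (- 2 * \<gamma> * r) * (f 0 - f x0) + \<delta>"
proof -
  define \<Omega> where "\<Omega> = (\<Sum>b\<in>B. norm (\<omega> b)) + 1"
  have \<Omega>: "norm (\<omega> b) \<le> \<Omega>" if "b \<in> B" for b
    using member_le_sum[OF that, of "\<lambda>b. norm (\<omega> b)"] B by (simp add: \<Omega>_def)
  define M where "M = 8 * \<Omega>\<^sup>2 * exp (2 * r * \<Omega>) * sum c B"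
  have M: "M \<ge> 0" using c by (auto simp: M_def sum_nonneg)
  define g where "g x = (\<Sum>b\<in>B. (2 * (c b * exp (2 * (x \<bullet> \<omega> b)))) *\<^sub>R \<omega> b)" for x
  have gE: "g x \<in> E" for x
    unfolding g_def using E by (intro subspace_sum) (auto intro: subspace_scale)
  have g_lower: "2 * \<gamma> * (f x - f x0) \<le> norm (g x)" for x
  proof -
    have "\<gamma> * (f x - (\<Sum>b\<in>B. (c b * exp (2 * (x \<bullet> \<omega> b))) * exp (2 * ((x0 - x) \<bullet> \<omega> b))))
      \<le> norm (\<Sum>b\<in>B. (c b * exp (2 * (x \<bullet> \<omega> b))) *\<^sub>R \<omega> b)"
      unfolding f_def
      by (rule gradient_lower_bound[OF B _ _ margin]) (use c \<gamma> in auto)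
    also have "(\<Sum>b\<in>B. (c b * exp (2 * (x \<bullet> \<omega> b))) * exp (2 * ((x0 - x) \<bullet> \<omega> b))) = f x0"
      by (simp add: f_def mult.assoc exp_add[symmetric] inner_diff_left)
    also have "norm (\<Sum>b\<in>B. (c b * exp (2 * (x \<bullet> \<omega> b))) *\<^sub>R \<omega> b) = norm (g x) / 2"
    proof -
      have "g x = 2 *\<^sub>R (\<Sum>b\<in>B. (c b * exp (2 * (x \<bullet> \<omega> b))) *\<^sub>R \<omega> b)"
        by (simp add: g_def scaleR_sum_right)
      then show ?thesis by simp
    qed
    finally show ?thesis by simp
  qed
  have taylor: "f (x + y) \<le> f x + g x \<bullet> y + M * \<eta>\<^sup>2"
    if x: "norm x \<le> r" and y: "norm y \<le> \<eta>" and \<eta>: "4 * \<eta> * \<Omega> \<le> 1" for x y \<eta>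
  proof -
    have \<eta>0: "\<eta> \<ge> 0" using y norm_ge_zero order_trans by blast
    have "c b * exp (2 * ((x + y) \<bullet> \<omega> b)) \<le> c b * exp (2 * (x \<bullet> \<omega> b)) + (2 * (c b * exp (2 * (x \<bullet> \<omega> b)))) * (\<omega> b \<bullet> y)
        + c b * (8 * \<Omega>\<^sup>2 * exp (2 * r * \<Omega>) * \<eta>\<^sup>2)" if b: "b \<in> B" for b
    proof -
      define s where "s = 2 * (y \<bullet> \<omega> b)"
      have yb: "\<bar>y \<bullet> \<omega> b\<bar> \<le> \<eta> * \<Omega>"
        using Cauchy_Schwarz_ineq2[of y "\<omega> b"] mult_mono[OF y \<Omega>[OF b]] \<eta>0 by (auto intro: order_trans)
      then have s: "s \<le> 1 / 2" using \<eta> by (simp add: s_def abs_le_iff)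
      have s2: "s\<^sup>2 \<le> 4 * (\<eta>\<^sup>2 * \<Omega>\<^sup>2)"
      proof -
        have "(y \<bullet> \<omega> b)\<^sup>2 \<le> (\<eta> * \<Omega>)\<^sup>2"
          using power_mono[OF yb, of 2] by simp
        then show ?thesis by (simp add: s_def power_mult_distrib)
      qed
      have xb: "exp (2 * (x \<bullet> \<omega> b)) \<le> exp (2 * r * \<Omega>)"
      proof -
        have "x \<bullet> \<omega> b \<le> r * \<Omega>"
          using norm_cauchy_schwarz[of x "\<omega> b"] mult_mono[OF x \<Omega>[OF b]] r by (auto intro: order_trans)
        then show ?thesis by simp
      qed
      have "exp (2 * ((x + y) \<bullet> \<omega> b)) = exp (2 * (x \<bullet> \<omega> b)) * exp s"
        by (simp add: s_def inner_add_left exp_add[symmetric] distrib_left)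
      also have "\<dots> \<le> exp (2 * (x \<bullet> \<omega> b)) * (1 + s + 2 * s\<^sup>2)"
        by (intro mult_left_mono exp_quadratic_upper_bound s) auto
      also have "\<dots> = exp (2 * (x \<bullet> \<omega> b)) * (1 + s) + exp (2 * (x \<bullet> \<omega> b)) * (2 * s\<^sup>2)"
        by (simp add: algebra_simps)
      also have "exp (2 * (x \<bullet> \<omega> b)) * (2 * s\<^sup>2) \<le> exp (2 * r * \<Omega>) * (2 * (4 * (\<eta>\<^sup>2 * \<Omega>\<^sup>2)))"
        using xb s2 by (intro mult_mono) auto
      finally have "exp (2 * ((x + y) \<bullet> \<omega> b)) \<le> exp (2 * (x \<bullet> \<omega> b)) * (1 + s) + 8 * \<Omega>\<^sup>2 * exp (2 * r * \<Omega>) * \<eta>\<^sup>2"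
        by (simp add: mult_ac)
      from mult_left_mono[OF this c[OF b]] show ?thesis
        by (simp add: s_def inner_commute algebra_simps)
    qed
    then have "f (x + y) \<le> (\<Sum>b\<in>B. c b * exp (2 * (x \<bullet> \<omega> b)) + (2 * (c b * exp (2 * (x \<bullet> \<omega> b)))) * (\<omega> b \<bullet> y)
        + c b * (8 * \<Omega>\<^sup>2 * exp (2 * r * \<Omega>) * \<eta>\<^sup>2))"
      unfolding f_def by (rule sum_mono)
    also have "\<dots> = f x + g x \<bullet> y + M * \<eta>\<^sup>2"
      by (simp add: f_def g_def M_def sum.distrib inner_sum_left sum_distrib_left sum_distrib_right mult_ac)
    finally show ?thesis .
  qed
  \<comment> \<open>gradient descent with \<open>k\<close> steps of length \<open>r / k\<close>\<close>
  obtain k :: nat where k: "k > 0" "4 * r * \<Omega> \<le> real k" "2 * \<gamma> * r \<le> real k" "M * r\<^sup>2 / \<delta> \<le> real k"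
  proof -
    obtain k where "max (max (4 * r * \<Omega>) (2 * \<gamma> * r)) (M * r\<^sup>2 / \<delta>) \<le> real k" using real_arch_simple by blast
    then show ?thesis using that[of "Suc k"] by simp
  qed
  define \<eta> where "\<eta> = r / real k"
  have \<eta>: "\<eta> \<ge> 0" "4 * \<eta> * \<Omega> \<le> 1" "2 * \<gamma> * \<eta> \<le> 1" and k\<eta>: "real k * \<eta> = r"
    using r k by (auto simp: \<eta>_def field_simps)
  have iter: "\<exists>x\<in>E. norm x \<le> real j * \<eta> \<and> f x - f x0 \<le> (1 - 2 * \<gamma> * \<eta>) ^ j * (f 0 - f x0) + real j * (M * \<eta>\<^sup>2)"
    if "j \<le> k" for j
    using that
  proof (induction j)
    case 0
    then show ?case using E(1) by (intro bexI[of _ 0]) (auto simp: subspace_0)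
  next
    case (Suc j)
    then obtain x where x: "x \<in> E" "norm x \<le> real j * \<eta>"
      and fx: "f x - f x0 \<le> (1 - 2 * \<gamma> * \<eta>) ^ j * (f 0 - f x0) + real j * (M * \<eta>\<^sup>2)" by auto
    have xr: "norm x \<le> r"
    proof -
      have "real j * \<eta> \<le> real k * \<eta>" using Suc.prems \<eta>(1) by (intro mult_right_mono) auto
      then show ?thesis using x(2) k\<eta> by simp
    qed
    define y where "y = (- \<eta> / norm (g x)) *\<^sub>R g x"
    have yE: "y \<in> E" unfolding y_def using E(1) gE by (intro subspace_scale)
    have ny: "norm y \<le> \<eta>" using \<eta>(1) by (simp add: y_def)
    have gy: "g x \<bullet> y = - \<eta> * norm (g x)"
      by (simp add: y_def power2_norm_eq_inner[symmetric] power2_eq_square)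
    have "f (x + y) - f x0 \<le> (f x - f x0) - \<eta> * norm (g x) + M * \<eta>\<^sup>2"
      using taylor[OF xr ny \<eta>(2)] gy by simp
    also have "\<dots> \<le> (f x - f x0) - \<eta> * (2 * \<gamma> * (f x - f x0)) + M * \<eta>\<^sup>2"
      using mult_left_mono[OF g_lower[of x] \<eta>(1)] by simp
    also have "\<dots> = (1 - 2 * \<gamma> * \<eta>) * (f x - f x0) + M * \<eta>\<^sup>2" by (simp add: algebra_simps)
    also have "\<dots> \<le> (1 - 2 * \<gamma> * \<eta>) * ((1 - 2 * \<gamma> * \<eta>) ^ j * (f 0 - f x0) + real j * (M * \<eta>\<^sup>2)) + M * \<eta>\<^sup>2"
      using fx \<eta>(3) by (intro add_right_mono mult_left_mono) auto
    also have "\<dots> \<le> (1 - 2 * \<gamma> * \<eta>) ^ Suc j * (f 0 - f x0) + real (Suc j) * (M * \<eta>\<^sup>2)"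
    proof -
      have "(1 - 2 * \<gamma> * \<eta>) * (real j * (M * \<eta>\<^sup>2)) \<le> 1 * (real j * (M * \<eta>\<^sup>2))"
        using \<gamma> \<eta>(1) M by (intro mult_right_mono) auto
      then show ?thesis by (simp add: algebra_simps)
    qed
    finally have "f (x + y) - f x0 \<le> (1 - 2 * \<gamma> * \<eta>) ^ Suc j * (f 0 - f x0) + real (Suc j) * (M * \<eta>\<^sup>2)" .
    moreover have "norm (x + y) \<le> real (Suc j) * \<eta>"
      using norm_triangle_ineq[of x y] x(2) ny by (simp add: algebra_simps)
    moreover have "x + y \<in> E" using E(1) x(1) yE by (rule subspace_add)
    ultimately show ?case by blast
  qed
  obtain x where x: "x \<in> E" "norm x \<le> r"
    and fx: "f x - f x0 \<le> (1 - 2 * \<gamma> * \<eta>) ^ k * (f 0 - f x0) + real k * (M * \<eta>\<^sup>2)"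
    using iter[of k] k\<eta> by auto
  have "(1 - 2 * \<gamma> * \<eta>) ^ k \<le> exp (- 2 * \<gamma> * r)"
  proof -
    have "(1 - 2 * \<gamma> * \<eta>) ^ k \<le> exp (- (2 * \<gamma> * \<eta>)) ^ k"
      using exp_ge_add_one_self[of "- (2 * \<gamma> * \<eta>)"] \<eta>(3) by (intro power_mono) auto
    also have "\<dots> = exp (- 2 * \<gamma> * (real k * \<eta>))"
      by (simp add: exp_of_nat_mult[symmetric] algebra_simps)
    finally show ?thesis by (simp add: k\<eta>)
  qed
  then have "(1 - 2 * \<gamma> * \<eta>) ^ k * (f 0 - f x0) \<le> exp (- 2 * \<gamma> * r) * (f 0 - f x0)"
    using x0 by (intro mult_right_mono) auto
  moreover have "real k * (M * \<eta>\<^sup>2) \<le> \<delta>"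
  proof -
    have "real k * (M * \<eta>\<^sup>2) = M * r\<^sup>2 / real k"
      using k(1) by (simp add: \<eta>_def power_divide power2_eq_square)
    also have "\<dots> \<le> \<delta>" using k(1,4) \<delta> by (simp add: field_simps)
    finally show ?thesis .
  qed
  ultimately show ?thesis using x fx by (intro bexI[of _ x]) auto
qed

section \<open>Near-optimal group elements of small condition number\<close>

lemma linear_rdiag: "linear rdiag"
  by (rule linearI) (simp_all add: rdiag_add rdiag_scaleR)

context torus_representation
begin

text \<open>Positivity comes from the finiteness of the set of weights: the infimum runs over finitely many
  compact convex hulls that avoid \<open>0\<close>. The last part is the definition of the margin, scaled from
  convex combinations to nonnegative coefficients and carried over to \<open>real^'n\<close>.\<close>

lemma weight_margin_properties:
  assumes on: "orthonormal B" and ex: "\<And>x. x = (\<Sum>b\<in>B. h b x *s b)" and \<omega>: "\<And>b. b \<in> B \<Longrightarrow> \<omega> b \<in> E"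
    and eig: "\<And>b x. b \<in> B \<Longrightarrow> x \<in> E \<Longrightarrow> dpi (rdiag x) *v b = of_real (x \<bullet> \<omega> b) *s b"
    and \<gamma>: "\<gamma> = real_of_ereal (min (weight_margin T \<pi>) 1)"
  shows "0 < \<gamma>" "\<gamma> \<le> 1"
    "(\<And>b. b \<in> B \<Longrightarrow> d b \<ge> 0) \<Longrightarrow> 0 \<notin> convex hull (\<omega> ` {b \<in> B. d b > 0}) \<Longrightarrow>
      \<gamma> * sum d B \<le> norm (\<Sum>b\<in>B. d b *\<^sub>R \<omega> b)"
proof -
  have fin: "finite B" using on by (simp add: orthonormal_def)
  have W: "weights T \<pi> = (\<lambda>b. rdiag (\<omega> b)) ` B" by (rule weights_basis_weights[OF on ex \<omega> eig])
  define \<G> where "\<G> = {\<Gamma>. \<Gamma> \<subseteq> weights T \<pi> \<and> \<Gamma> \<noteq> {} \<and> 0 \<notin> convex hull \<Gamma>}"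
  have "finite (Pow (weights T \<pi>))" using fin by (simp add: W)
  then have finG: "finite \<G>" by (rule finite_subset[rotated]) (auto simp: \<G>_def)
  have pos: "infdist 0 (convex hull \<Gamma>) > 0" if "\<Gamma> \<in> \<G>" for \<Gamma>
  proof (rule infdist_pos_not_in_closed)
    have "finite \<Gamma>" using that fin finite_subset unfolding \<G>_def W by blast
    then show "closed (convex hull \<Gamma>)"
      by (intro compact_imp_closed compact_convex_hull finite_imp_compact)
  qed (use that in \<open>auto simp: \<G>_def\<close>)
  define m where "m = Min (insert 1 ((\<lambda>\<Gamma>. infdist 0 (convex hull \<Gamma>)) ` \<G>))"
  have m: "m > 0" "m \<le> 1" "\<And>\<Gamma>. \<Gamma> \<in> \<G> \<Longrightarrow> m \<le> infdist 0 (convex hull \<Gamma>)"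
    using finG pos by (auto simp: m_def)
  have wm: "weight_margin T \<pi> = (INF \<Gamma>\<in>\<G>. ereal (infdist 0 (convex hull \<Gamma>)))"
    by (simp add: weight_margin_def \<G>_def)
  have "ereal m \<le> weight_margin T \<pi>" unfolding wm by (rule INF_greatest) (simp add: m(3))
  then have lo: "ereal m \<le> min (weight_margin T \<pi>) 1" using m(2) by simp
  have hi: "min (weight_margin T \<pi>) 1 \<le> 1" by simp
  have e\<gamma>: "min (weight_margin T \<pi>) 1 = ereal \<gamma>"
    unfolding \<gamma> using lo hi by (cases "min (weight_margin T \<pi>) 1") simp_all
  have "m \<le> \<gamma>" using lo unfolding e\<gamma> by simp
  then show \<gamma>0: "0 < \<gamma>" using m(1) by linarith
  show "\<gamma> \<le> 1" using hi unfolding e\<gamma> by simp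
  have le: "\<gamma> \<le> infdist 0 (convex hull \<Gamma>)" if "\<Gamma> \<in> \<G>" for \<Gamma>
  proof -
    have "ereal \<gamma> \<le> weight_margin T \<pi>" using e\<gamma> by (metis min.cobounded1)
    also have "\<dots> \<le> ereal (infdist 0 (convex hull \<Gamma>))" unfolding wm by (rule INF_lower[OF that])
    finally show ?thesis by simp
  qed
  assume d: "\<And>b. b \<in> B \<Longrightarrow> d b \<ge> 0" and hull: "0 \<notin> convex hull (\<omega> ` {b \<in> B. d b > 0})"
  let ?S = "{b \<in> B. d b > 0}"
  have sumS: "sum d B = sum d ?S"
    using fin d by (intro sum.mono_neutral_right) (auto simp: order_less_le)
  show "\<gamma> * sum d B \<le> norm (\<Sum>b\<in>B. d b *\<^sub>R \<omega> b)"
  proof (cases "?S = {}")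
    case True
    have "sum d B = 0" using sumS unfolding True by simp
    then show ?thesis by simp
  next
    case False
    define D where "D = sum d ?S"
    have D: "D > 0" unfolding D_def using fin False by (intro sum_pos) auto
    let ?\<Gamma> = "(\<lambda>b. rdiag (\<omega> b)) ` ?S"
    have "convex hull ?\<Gamma> = rdiag ` (convex hull (\<omega> ` ?S))"
      using convex_hull_linear_image[OF linear_rdiag, of "\<omega> ` ?S"] by (simp add: image_image)
    then have "0 \<notin> convex hull ?\<Gamma>"
      using hull rdiag_inject linear_0[OF linear_rdiag] by (metis (no_types, lifting) image_iff)
    then have "?\<Gamma> \<in> \<G>" using False by (auto simp: \<G>_def W)
    have "(\<Sum>b\<in>?S. (d b / D) *\<^sub>R rdiag (\<omega> b)) \<in> convex hull ?\<Gamma>"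
    proof (rule convex_sum)
      show "(\<Sum>b\<in>?S. d b / D) = 1" using D by (simp add: D_def sum_divide_distrib[symmetric])
    qed (use fin D hull_subset[of ?\<Gamma>] in \<open>auto simp: convex_convex_hull intro!: hull_inc\<close>)
    then have "\<gamma> \<le> dist 0 (\<Sum>b\<in>?S. (d b / D) *\<^sub>R rdiag (\<omega> b))"
      using le[OF \<open>?\<Gamma> \<in> \<G>\<close>] infdist_le order_trans by blast
    also have "(\<Sum>b\<in>?S. (d b / D) *\<^sub>R rdiag (\<omega> b)) = (1 / D) *\<^sub>R rdiag (\<Sum>b\<in>?S. d b *\<^sub>R \<omega> b)"
      by (simp add: linear_sum[OF linear_rdiag] rdiag_scaleR scaleR_sum_right)
    also have "(\<Sum>b\<in>?S. d b *\<^sub>R \<omega> b) = (\<Sum>b\<in>B. d b *\<^sub>R \<omega> b)"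
      using fin d by (intro sum.mono_neutral_left) (auto simp: order_less_le)
    finally have "\<gamma> \<le> norm (\<Sum>b\<in>B. d b *\<^sub>R \<omega> b) / D"
      using D by (simp add: norm_rdiag)
    then show ?thesis using D by (simp add: sumS D_def[symmetric] field_simps)
  qed
qed

end

lemma matrix_inv_eqI:
  fixes a b :: "complex^'n^'n"
  assumes "a ** b = mat 1"
  shows "matrix_inv b = a"
proof -
  have ba: "b ** a = mat 1" using assms matrix_left_right_inverse by blast
  then have "invertible b" using assms by (auto simp: invertible_def)
  then have "matrix_inv b ** b = mat 1" by (rule matrix_inv_inverse)
  then have "matrix_inv b ** (b ** a) = a" by (simp add: matrix_mul_assoc)
  then show ?thesis by (simp add: ba)
qed

lemma norm_hexp_rdiag: "(norm (hexp (of_real s) (rdiag x)))\<^sup>2 = (\<Sum>i\<in>UNIV. exp (2 * s * x $ i))"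
proof -
  have "(\<Sum>j\<in>UNIV. (cmod (hexp (of_real s) (rdiag x) $ i $ j))\<^sup>2) = (\<Sum>j\<in>UNIV. if j = i then exp (2 * s * x $ i) else 0)" for i
  proof (rule sum.cong)
    fix j
    have "(cmod (exp (complex_of_real s * complex_of_real (x $ i))))\<^sup>2 = exp (2 * (s * x $ i))"
      by (simp add: norm_exp_eq_Re exp_double)
    then show "(cmod (hexp (of_real s) (rdiag x) $ i $ j))\<^sup>2 = (if j = i then exp (2 * s * x $ i) else 0)"
      by (auto simp: hexp_rdiag mult.assoc)
  qed simp
  then show ?thesis by (simp add: norm_matrix_sq)
qed

lemma reg_one: "reg (mat 1 :: complex^'n^'n) = 2 * real CARD('n)"
proof -
  have "matrix_inv (mat 1) = (mat 1 :: complex^'n^'n)" by (rule matrix_inv_eqI) simp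
  moreover have "(norm (mat 1 :: complex^'n^'n))\<^sup>2 = real CARD('n)"
    using norm_hexp_rdiag[of 0 "0 :: real^'n"] by simp
  ultimately show ?thesis by (simp add: reg_def)
qed

lemma reg_unitary_left:
  assumes "k \<in> unitary_group" "invertible g"
  shows "reg (k ** g) = reg (g :: complex^'n^'n)"
proof -
  note u = unitary_groupD[OF assms(1)]
  have "(matrix_inv g ** dagger k) ** (k ** g) = matrix_inv g ** (dagger k ** k) ** g"
    by (simp add: matrix_mul_assoc)
  also have "\<dots> = mat 1" by (simp add: u matrix_inv_inverse[OF assms(2)])
  finally have "matrix_inv (k ** g) = matrix_inv g ** dagger k" by (rule matrix_inv_eqI)
  moreover have "norm (matrix_inv g ** dagger k) = norm (matrix_inv g)"
    by (rule norm_unitary_mult_right) (simp add: u)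
  ultimately show ?thesis by (simp add: reg_def norm_unitary_mult_left[OF u(1)])
qed

lemma reg_unitary_right:
  assumes "k \<in> unitary_group" "invertible g"
  shows "reg (g ** k) = reg (g :: complex^'n^'n)"
proof -
  note u = unitary_groupD[OF assms(1)]
  have "(dagger k ** matrix_inv g) ** (g ** k) = dagger k ** (matrix_inv g ** g) ** k"
    by (simp add: matrix_mul_assoc)
  also have "\<dots> = mat 1" by (simp add: u matrix_inv_inverse[OF assms(2)])
  finally have "matrix_inv (g ** k) = dagger k ** matrix_inv g" by (rule matrix_inv_eqI)
  moreover have "norm (dagger k ** matrix_inv g) = norm (matrix_inv g)"
    by (rule norm_unitary_mult_left) (simp add: u)
  ultimately show ?thesis by (simp add: reg_def norm_unitary_mult_right[OF u(1)])
qed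

context symmetric_representation
begin

lemma hnorm_pi_pos:
  assumes "capacity G \<pi> h v > 0" "g \<in> G"
  shows "capacity G \<pi> h v \<le> hnorm h (\<pi> g *v v)" "hnorm h (\<pi> g *v v) > 0"
proof -
  have "bdd_below ((\<lambda>g. hnorm h (\<pi> g *v v)) ` G)" by (rule bdd_belowI[of _ 0]) auto
  then show "capacity G \<pi> h v \<le> hnorm h (\<pi> g *v v)"
    unfolding capacity_def using assms(2) by (rule cINF_lower)
  then show "hnorm h (\<pi> g *v v) > 0" using assms(1) by linarith
qed

end

context torus_representation
begin

text \<open>An almost optimal \<open>g = k exp(X)\<close> can be written as \<open>k l\<^sup>* exp(x1) l\<close> with \<open>k, l \<in> K\<close> and \<open>x1\<close> in the Lie algebra of the torus. So
  the capacity is almost attained on the torus orbit of \<open>w = \<pi>(l) v\<close>, where the squared norm \<open>F x\<close> is a geometric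
  program. Descending from \<open>0\<close> over the distance \<open>r\<close> yields \<open>x\<close> with \<open>F x \<le> cap\<^sup>2 exp(2 \<epsilon> + 2 \<delta>)\<close>, and
  all entries of \<open>x\<close> are bounded by \<open>r\<close>.\<close>

lemma near_optimal_element:
  fixes v :: "complex^'m" and \<epsilon> C \<gamma> \<delta> :: real
  assumes cap: "capacity G \<pi> h v > 0" and \<epsilon>: "0 < \<epsilon>" "\<epsilon> < 1 / 2"
    and C: "C \<ge> ln (hnorm h v / capacity G \<pi> h v)"
    and \<gamma>: "\<gamma> = real_of_ereal (min (weight_margin T \<pi>) 1)" and \<delta>: "\<delta> > 0"
  shows "\<exists>g\<in>G. reg g \<le> 2 * real CARD('n) * (exp (2 * C) / (2 * \<epsilon>)) powr (1 / \<gamma>)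
    \<and> ln (hnorm h (\<pi> g *v v)) \<le> ln (capacity G \<pi> h v) + \<epsilon> + \<delta>"
proof -
  define cap' where "cap' = capacity G \<pi> h v"
  have cap0: "cap' > 0" using cap by (simp add: cap'_def)
  note lower = hnorm_pi_pos[OF cap, folded cap'_def]
  obtain B \<omega> where on: "orthonormal B" and ex: "\<And>x. x = (\<Sum>b\<in>B. h b x *s b)" and \<omega>: "\<And>b. b \<in> B \<Longrightarrow> \<omega> b \<in> E"
    and eig: "\<And>b x. b \<in> B \<Longrightarrow> x \<in> E \<Longrightarrow> dpi (rdiag x) *v b = of_real (x \<bullet> \<omega> b) *s b"
    by (rule weight_basis) blast
  note margin = weight_margin_properties[OF on ex \<omega> eig \<gamma>]
  have fin: "finite B" using on by (simp add: orthonormal_def)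
  have hv: "cap' \<le> hnorm h v" using lower(1)[OF G_one] by (simp add: pi_one)
  have "ln (hnorm h v / cap') \<ge> 0" using hv cap0 by simp
  then have C0: "C \<ge> 0" using C by (simp add: cap'_def)
  have "hnorm h v / cap' \<le> exp C"
    using C hv cap0 by (simp add: cap'_def ln_le_cancel_iff ln_div[symmetric] flip: ln_exp)
      (metis divide_pos_pos exp_le_cancel_iff exp_ln less_le_trans)
  then have hvC: "(hnorm h v)\<^sup>2 \<le> exp (2 * C) * cap'\<^sup>2"
  proof -
    have "hnorm h v \<le> exp C * cap'" using \<open>hnorm h v / cap' \<le> exp C\<close> cap0 by (simp add: divide_le_eq)
    then have "(hnorm h v)\<^sup>2 \<le> (exp C * cap')\<^sup>2" by (rule power_mono) simp
    then show ?thesis by (simp add: power_mult_distrib exp_double)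
  qed
  \<comment> \<open>an almost optimal element, brought into the torus by unitaries on both sides\<close>
  have "\<exists>g\<in>G. hnorm h (\<pi> g *v v) < cap' * exp (\<delta> / 2)"
  proof -
    have "cap' * 1 < cap' * exp (\<delta> / 2)" using cap0 \<delta> by (intro mult_strict_left_mono) auto
    then have "(INF g\<in>G. hnorm h (\<pi> g *v v)) < cap' * exp (\<delta> / 2)" by (simp add: cap'_def capacity_def)
    moreover have "bdd_below ((\<lambda>g. hnorm h (\<pi> g *v v)) ` G)" by (rule bdd_belowI[of _ 0]) auto
    moreover have "G \<noteq> {}" using G_one by blast
    ultimately show ?thesis by (simp add: cINF_less_iff)
  qed
  then obtain g where g: "g \<in> G" "hnorm h (\<pi> g *v v) < cap' * exp (\<delta> / 2)" by blast
  obtain k X where k: "k \<in> K" and X: "X \<in> iLie K" and gk: "g = k ** hexp 1 X"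
    by (rule polar_decomposition[OF symmetric g(1)]) (auto simp: K_eq)
  obtain l where l: "l \<in> K" "l ** X ** dagger l \<in> iLie T" using conjugate_into_torus[OF X] by blast
  obtain x1 where x1: "x1 \<in> E" "l ** X ** dagger l = rdiag x1" using iLie_T_rdiag[OF l(2)] by blast
  note lu = unitary_groupD[OF subsetD[OF unitary l(1)]]
  define w where "w = \<pi> l *v v"
  have hw: "hnorm h w = hnorm h v" unfolding w_def by (rule hnorm_K[OF l(1)])
  define F where "F x = (hnorm h (\<pi> (hexp 1 (rdiag x)) *v w))\<^sup>2" for x
  define c where "c b = (cmod (h b w))\<^sup>2" for b
  have F: "F x = (\<Sum>b\<in>B. c b * exp (2 * (x \<bullet> \<omega> b)))" if "x \<in> E" for x
    unfolding F_def c_def by (rule hnorm_torus[OF on ex eig that])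
  have Fval: "F x = (hnorm h (\<pi> (hexp 1 (rdiag x) ** l) *v v))\<^sup>2" "hexp 1 (rdiag x) ** l \<in> G" if "x \<in> E" for x
    using that by (auto simp: F_def w_def pi_mult hexp_in_G E_iLie K_in_G l(1) G_mult matrix_vector_mul_assoc)
  have Fcap: "cap'\<^sup>2 \<le> F x" if "x \<in> E" for x
    unfolding Fval(1)[OF that] using lower(1)[OF Fval(2)[OF that]] cap0 by (intro power_mono) auto
  have E0: "0 \<in> E" by (rule subspace_0[OF subspace_E])
  have F0: "F 0 = (hnorm h v)\<^sup>2"
    by (simp add: F_def hexp_rdiag diagm_1 pi_one hw)
  have F1: "F x1 \<le> exp \<delta> * cap'\<^sup>2"
  proof -
    have "hexp 1 X = dagger l ** hexp 1 (rdiag x1) ** l"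
    proof -
      have "hexp 1 (rdiag x1) = l ** hexp 1 X ** dagger l"
        unfolding x1(2)[symmetric] by (rule hexp_unitary_conj[OF lu(1)])
      then have "dagger l ** hexp 1 (rdiag x1) ** l = (dagger l ** l) ** hexp 1 X ** (dagger l ** l)"
        by (simp add: matrix_mul_assoc)
      then show ?thesis by (simp add: lu)
    qed
    then have "g = (k ** dagger l) ** (hexp 1 (rdiag x1) ** l)" by (simp add: gk matrix_mul_assoc)
    moreover have "k ** dagger l \<in> K" using k l(1) by (intro mult dagger)
    ultimately have "hnorm h (\<pi> g *v v) = hnorm h (\<pi> (hexp 1 (rdiag x1) ** l) *v v)"
      by (simp add: pi_mult K_in_G Fval(2)[OF x1(1)] matrix_vector_mul_assoc[symmetric] hnorm_K)
    then have "F x1 = (hnorm h (\<pi> g *v v))\<^sup>2" by (simp add: Fval(1)[OF x1(1)])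
    also have "\<dots> \<le> (cap' * exp (\<delta> / 2))\<^sup>2" using g(2) by (intro power_mono) auto
    also have "\<dots> = exp \<delta> * cap'\<^sup>2" by (simp add: power_mult_distrib exp_double[symmetric] mult.commute)
    finally show ?thesis .
  qed
  \<comment> \<open>descent from \<open>0\<close> requires a comparison point that is not worse than \<open>0\<close>\<close>
  define x0 where "x0 = (if F x1 \<le> F 0 then x1 else 0)"
  have x0: "x0 \<in> E" "F x0 \<le> F 0" "F x0 \<le> exp \<delta> * cap'\<^sup>2"
    using x1(1) E0 F1 by (auto simp: x0_def)
  define r where "r = (1 / (2 * \<gamma>)) * ln (exp (2 * C) / (2 * \<epsilon>))"
  have arg: "exp (2 * C) / (2 * \<epsilon>) \<ge> 1" using \<epsilon> C0 by (simp add: le_divide_eq order_trans[of _ 1])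
  have r0: "r \<ge> 0" using arg margin(1) by (simp add: r_def)
  have er: "exp (- 2 * \<gamma> * r) = 2 * \<epsilon> * exp (- 2 * C)"
  proof -
    have "- 2 * \<gamma> * r = - ln (exp (2 * C) / (2 * \<epsilon>))" using margin(1) by (simp add: r_def)
    then have "exp (- 2 * \<gamma> * r) = inverse (exp (2 * C) / (2 * \<epsilon>))"
      using arg by (simp only: exp_minus) (simp add: exp_ln)
    also have "\<dots> = 2 * \<epsilon> / exp (2 * C)" by (rule inverse_divide)
    also have "\<dots> = 2 * \<epsilon> * exp (- (2 * C))" unfolding exp_minus by (rule divide_inverse)
    finally show ?thesis by simp
  qed
  have "\<exists>x\<in>E. norm x \<le> r \<and> (\<Sum>b\<in>B. c b * exp (2 * (x \<bullet> \<omega> b))) - (\<Sum>b\<in>B. c b * exp (2 * (x0 \<bullet> \<omega> b)))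
      \<le> exp (- 2 * \<gamma> * r) * ((\<Sum>b\<in>B. c b * exp (2 * (0 \<bullet> \<omega> b))) - (\<Sum>b\<in>B. c b * exp (2 * (x0 \<bullet> \<omega> b)))) + \<delta> * cap'\<^sup>2"
    by (rule geometric_program_descent[OF fin _ margin(1) margin(3) subspace_E \<omega> r0])
      (use x0(2) \<delta> cap0 in \<open>auto simp: F[OF x0(1)] F[OF E0] c_def\<close>)
  then obtain x where x: "x \<in> E" "norm x \<le> r" and Fx: "F x - F x0 \<le> exp (- 2 * \<gamma> * r) * (F 0 - F x0) + \<delta> * cap'\<^sup>2"
    using F x0(1) E0 by auto
  have "F x \<le> exp (2 * (\<epsilon> + \<delta>)) * cap'\<^sup>2"
  proof -
    have "F 0 - F x0 \<le> exp (2 * C) * cap'\<^sup>2"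
      using hvC Fcap[OF x0(1)] zero_le_power2[of cap'] unfolding F0 by linarith
    then have "exp (- 2 * \<gamma> * r) * (F 0 - F x0) \<le> 2 * \<epsilon> * exp (- 2 * C) * (exp (2 * C) * cap'\<^sup>2)"
      unfolding er using \<epsilon> by (intro mult_left_mono) auto
    also have "\<dots> = 2 * \<epsilon> * cap'\<^sup>2" by (simp add: exp_minus)
    finally have "F x \<le> exp \<delta> * cap'\<^sup>2 + 2 * \<epsilon> * cap'\<^sup>2 + \<delta> * cap'\<^sup>2" using Fx x0(3) by linarith
    also have "\<dots> = (exp \<delta> + 2 * \<epsilon> + \<delta>) * cap'\<^sup>2" by (simp add: algebra_simps)
    also have "\<dots> \<le> exp (2 * (\<epsilon> + \<delta>)) * cap'\<^sup>2"
    proof (rule mult_right_mono)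
      have "exp \<delta> + 2 * \<epsilon> + \<delta> \<le> exp \<delta> * (1 + (2 * \<epsilon> + \<delta>))"
      proof -
        have "1 * (2 * \<epsilon> + \<delta>) \<le> exp \<delta> * (2 * \<epsilon> + \<delta>)" using \<delta> \<epsilon> by (intro mult_right_mono) auto
        then show ?thesis by (simp add: algebra_simps)
      qed
      also have "\<dots> \<le> exp \<delta> * exp (2 * \<epsilon> + \<delta>)"
        by (intro mult_left_mono exp_ge_add_one_self) auto
      also have "\<dots> = exp (2 * (\<epsilon> + \<delta>))" by (simp add: exp_add[symmetric])
      finally show "exp \<delta> + 2 * \<epsilon> + \<delta> \<le> exp (2 * (\<epsilon> + \<delta>))" .
    qed simp
    finally show ?thesis .
  qed
  define g' where "g' = hexp 1 (rdiag x) ** l"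
  have g': "g' \<in> G" unfolding g'_def by (rule Fval(2)[OF x(1)])
  have "ln (hnorm h (\<pi> g' *v v)) \<le> ln cap' + \<epsilon> + \<delta>"
  proof -
    have "(hnorm h (\<pi> g' *v v))\<^sup>2 \<le> (exp (\<epsilon> + \<delta>) * cap')\<^sup>2"
      using \<open>F x \<le> exp (2 * (\<epsilon> + \<delta>)) * cap'\<^sup>2\<close>
      by (simp add: Fval(1)[OF x(1)] g'_def power_mult_distrib exp_double[symmetric])
    then have "hnorm h (\<pi> g' *v v) \<le> exp (\<epsilon> + \<delta>) * cap'"
      by (rule power2_le_imp_le) (use cap0 in simp)
    then have "ln (hnorm h (\<pi> g' *v v)) \<le> ln (exp (\<epsilon> + \<delta>) * cap')"
      using lower(2)[OF g'] cap0 by (subst ln_le_cancel_iff) auto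
    then show ?thesis using cap0 by (simp add: ln_mult)
  qed
  moreover have "reg g' \<le> 2 * real CARD('n) * (exp (2 * C) / (2 * \<epsilon>)) powr (1 / \<gamma>)"
  proof -
    have xi: "\<bar>x $ i\<bar> \<le> r" for i using component_le_norm_cart[of x i] x(2) by linarith
    have inv: "hexp (- 1) (rdiag x) ** hexp 1 (rdiag x) = mat 1" by (rule hexp_minus) simp
    have "invertible (hexp 1 (rdiag x))" using G_invertible hexp_in_G[OF E_iLie[OF x(1)]] by blast
    then have "reg g' = reg (hexp 1 (rdiag x))"
      unfolding g'_def using l(1) unitary by (intro reg_unitary_right) auto
    also have "\<dots> = (\<Sum>i\<in>UNIV. exp (2 * x $ i)) + (\<Sum>i\<in>UNIV. exp (- 2 * x $ i))"
      using norm_hexp_rdiag[of 1 x] norm_hexp_rdiag[of "- 1" x]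
      by (simp add: reg_def matrix_inv_eqI[OF inv])
    also have "\<dots> \<le> (\<Sum>i\<in>(UNIV::'n set). exp (2 * r)) + (\<Sum>i\<in>(UNIV::'n set). exp (2 * r))"
    proof (intro add_mono sum_mono)
      show "exp (2 * x $ i) \<le> exp (2 * r)" "exp (- 2 * x $ i) \<le> exp (2 * r)" for i
        using xi[of i] by (simp_all add: abs_le_iff)
    qed
    also have "\<dots> = 2 * real CARD('n) * exp (2 * r)" by simp
    also have "exp (2 * r) = (exp (2 * C) / (2 * \<epsilon>)) powr (1 / \<gamma>)"
      using \<epsilon> by (simp add: r_def powr_def)
    finally show ?thesis .
  qed
  ultimately show ?thesis using g' by (auto simp: cap'_def)
qed

end

section \<open>Convexity and robustness along geodesics\<close>

lemma self_adjoint_flow_derivatives: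
  fixes B :: "'a::real_normed_vector \<Rightarrow> 'a \<Rightarrow> real" and x :: "real \<Rightarrow> 'a"
  assumes B: "bounded_bilinear B" and sym: "\<And>x y. B x y = B y x"
    and A: "bounded_linear A" and adj: "\<And>x y. B (A x) y = B x (A y)"
    and x: "\<And>t. (x has_vector_derivative A (x t)) (at t)"
  shows "((\<lambda>t. B (x t) (x t)) has_real_derivative 2 * B (x t) (A (x t))) (at t)"
    and "((\<lambda>t. B (x t) (A (x t))) has_real_derivative 2 * B (A (x t)) (A (x t))) (at t)"
    and "((\<lambda>t. B (A (x t)) (A (x t))) has_real_derivative 2 * B (A (x t)) (A (A (x t)))) (at t)"
proof -
  have Ax: "((\<lambda>t. A (x t)) has_vector_derivative A (A (x t))) (at t)"
    by (rule bounded_linear.has_vector_derivative[OF A x])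
  show "((\<lambda>t. B (x t) (x t)) has_real_derivative 2 * B (x t) (A (x t))) (at t)"
    using bounded_bilinear.has_vector_derivative[OF B x x, of t] sym[of "A (x t)" "x t"]
    by (simp add: has_real_derivative_iff_has_vector_derivative)
  show "((\<lambda>t. B (x t) (A (x t))) has_real_derivative 2 * B (A (x t)) (A (x t))) (at t)"
    using bounded_bilinear.has_vector_derivative[OF B x Ax] adj[of "x t" "A (x t)"]
    by (simp add: has_real_derivative_iff_has_vector_derivative)
  show "((\<lambda>t. B (A (x t)) (A (x t))) has_real_derivative 2 * B (A (x t)) (A (A (x t)))) (at t)"
    using bounded_bilinear.has_vector_derivative[OF B Ax Ax] sym[of "A (A (x t))" "A (x t)"]
    by (simp add: has_real_derivative_iff_has_vector_derivative)
qed

text \<open>With \<open>p0, \<dots>, p3\<close> the moments of a self-adjoint operator along its flow, the derivatives of \<open>ln p0 / 2\<close> are its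
  first three cumulants up to the factors \<open>1\<close>, \<open>2\<close> and \<open>4\<close>.\<close>

lemma half_ln_derivatives:
  fixes p0 p1 p2 p3 :: "real \<Rightarrow> real"
  assumes pos: "\<And>t. p0 t > 0"
    and d0: "\<And>t. (p0 has_real_derivative 2 * p1 t) (at t)"
    and d1: "\<And>t. (p1 has_real_derivative 2 * p2 t) (at t)"
    and d2: "\<And>t. (p2 has_real_derivative 2 * p3 t) (at t)"
  shows "((\<lambda>t. ln (p0 t) / 2) has_real_derivative p1 t / p0 t) (at t)"
    and "((\<lambda>t. p1 t / p0 t) has_real_derivative 2 * (p2 t / p0 t - p1 t * p1 t / (p0 t)\<^sup>2)) (at t)"
    and "((\<lambda>t. 2 * (p2 t / p0 t - p1 t * p1 t / (p0 t)\<^sup>2)) has_real_derivative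
        4 * (p3 t / p0 t - 3 * (p1 t / p0 t) * (p2 t / p0 t) + 2 * (p1 t / p0 t) ^ 3)) (at t)"
proof -
  have ne: "p0 t \<noteq> 0" using pos[of t] by simp
  show "((\<lambda>t. ln (p0 t) / 2) has_real_derivative p1 t / p0 t) (at t)"
    using pos[of t] by (auto intro!: derivative_eq_intros d0 simp: field_simps)
  show "((\<lambda>t. p1 t / p0 t) has_real_derivative 2 * (p2 t / p0 t - p1 t * p1 t / (p0 t)\<^sup>2)) (at t)"
    using ne by (auto intro!: derivative_eq_intros d0 d1 simp: field_simps power2_eq_square)
  show "((\<lambda>t. 2 * (p2 t / p0 t - p1 t * p1 t / (p0 t)\<^sup>2)) has_real_derivative
        4 * (p3 t / p0 t - 3 * (p1 t / p0 t) * (p2 t / p0 t) + 2 * (p1 t / p0 t) ^ 3)) (at t)"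
    using ne by (auto intro!: derivative_eq_intros d0 d1 d2 simp: field_simps power2_eq_square power3_eq_cube)
qed

context hermitian_form
begin

lemma Cauchy_Schwarz: "\<bar>Re (h x y)\<bar> \<le> hnorm h x * hnorm h y"
proof (cases "y = 0")
  case False
  have hy: "Re (h y y) > 0" by (rule pos[OF False])
  define t where "t = Re (h x y) / Re (h y y)"
  have "0 \<le> Re (h (x - t *\<^sub>R y) (x - t *\<^sub>R y))" by (rule nonneg)
  also have "\<dots> = Re (h x x) - 2 * t * Re (h x y) + t\<^sup>2 * Re (h y y)"
    using Re_sym[of y x]
    by (simp add: diff_left diff_right scaleR_left scaleR_right power2_eq_square algebra_simps)
  also have "\<dots> = Re (h x x) - (Re (h x y))\<^sup>2 / Re (h y y)"
    using hy by (simp add: t_def power2_eq_square field_simps)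
  finally have "(Re (h x y))\<^sup>2 \<le> Re (h x x) * Re (h y y)" using hy by (simp add: field_simps)
  then have "\<bar>Re (h x y)\<bar>\<^sup>2 \<le> (hnorm h x * hnorm h y)\<^sup>2" by (simp add: power_mult_distrib hnorm_sq)
  then show ?thesis by (rule power2_le_imp_le) simp
qed (simp add: hnorm_def)

lemma hnorm_zero [simp]: "hnorm h 0 = 0"
  by (simp add: hnorm_def)

lemma hnorm_le_norm: "\<exists>M. \<forall>x. hnorm h x \<le> M * norm x"
proof -
  obtain M where M: "\<And>x y. norm (h x y) \<le> norm x * norm y * M" "M \<ge> 0"
    using bounded_bilinear.nonneg_bounded[OF bounded_bilinear] by blast
  have "hnorm h x \<le> sqrt M * norm x" for x
  proof -
    have "Re (h x x) \<le> norm x * norm x * M" using M(1)[of x x] complex_Re_le_cmod[of "h x x"] by linarith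
    then have "hnorm h x \<le> sqrt (norm x * norm x * M)" unfolding hnorm_def by simp
    then show ?thesis by (simp add: real_sqrt_mult mult.commute)
  qed
  then show ?thesis by blast
qed

lemma norm_le_hnorm: "\<exists>M\<ge>0. \<forall>x. norm x \<le> M * hnorm h x"
proof -
  have "\<exists>x\<in>sphere 0 1. \<forall>y\<in>sphere 0 1. Re (h x x) \<le> Re (h y y)"
    by (intro continuous_attains_inf continuous_intros) auto
  then obtain u :: "complex^'m" where u: "norm u = 1" and min: "\<And>y. norm y = 1 \<Longrightarrow> Re (h u u) \<le> Re (h y y)"
    by auto
  have "u \<noteq> 0" using u by auto
  then have m: "hnorm h u > 0" using pos by (simp add: hnorm_def)
  have "norm x \<le> (1 / hnorm h u) * hnorm h x" for x
  proof (cases "x = 0")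
    case False
    have "Re (h u u) \<le> Re (h ((1 / norm x) *\<^sub>R x) ((1 / norm x) *\<^sub>R x))"
      by (rule min) (use False in simp)
    then have "Re (h u u) * (norm x)\<^sup>2 \<le> Re (h x x)"
      using False by (simp add: scaleR_left scaleR_right field_simps power2_eq_square)
    then have "(hnorm h u * norm x)\<^sup>2 \<le> (hnorm h x)\<^sup>2" by (simp add: power_mult_distrib hnorm_sq)
    then have "hnorm h u * norm x \<le> hnorm h x" by (rule power2_le_imp_le) simp
    then show ?thesis using m by (simp add: field_simps)
  qed simp
  then show ?thesis using m by (intro exI[of _ "1 / hnorm h u"]) auto
qed

lemma hopnorm_bound:
  obtains M where "M \<ge> 0" "\<And>A x. hnorm h (A *v x) \<le> M * norm A * hnorm h x"
proof -
  obtain M1 where M1: "\<And>x. hnorm h x \<le> M1 * norm x" using hnorm_le_norm by blast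
  obtain M2 where M2: "M2 \<ge> 0" "\<And>x. norm x \<le> M2 * hnorm h x" using norm_le_hnorm by blast
  have "hnorm h (A *v x) \<le> \<bar>M1\<bar> * M2 * norm A * hnorm h x" for A x
  proof -
    have "hnorm h (A *v x) \<le> M1 * norm (A *v x)" by (rule M1)
    also have "\<dots> \<le> \<bar>M1\<bar> * norm (A *v x)" by (intro mult_right_mono) auto
    also have "\<dots> \<le> \<bar>M1\<bar> * (norm A * (M2 * hnorm h x))"
      using norm_matrix_vector_mult[of A x] mult_left_mono[OF M2(2)[of x], of "norm A"]
      by (intro mult_left_mono) auto
    finally show ?thesis by (simp add: mult_ac)
  qed
  then show ?thesis using M2(1) that[of "\<bar>M1\<bar> * M2"] by auto
qed

lemma hopnorm_bdd: "bdd_above ((\<lambda>x. hnorm h (A *v x)) ` {x. hnorm h x = 1})"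
proof -
  obtain M where M: "\<And>A x. hnorm h (A *v x) \<le> M * norm A * hnorm h x" using hopnorm_bound by blast
  show ?thesis
  proof (rule bdd_aboveI2[of _ _ "M * norm A"])
    show "hnorm h (A *v x) \<le> M * norm A" if "x \<in> {x. hnorm h x = 1}" for x
      using M[of A x] that by simp
  qed
qed

lemma hnorm_le_hopnorm: "hnorm h (A *v x) \<le> hopnorm h A * hnorm h x"
proof (cases "x = 0")
  case False
  have hx: "hnorm h x > 0" using pos[OF False] by (simp add: hnorm_def)
  define u where "u = complex_of_real (1 / hnorm h x) *s x"
  have "hnorm h u = 1" using hx by (simp add: u_def hnorm_scale norm_divide)
  then have "hnorm h (A *v u) \<le> hopnorm h A"
    unfolding hopnorm_def by (intro cSUP_upper hopnorm_bdd) auto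
  moreover have "hnorm h (A *v u) = hnorm h (A *v x) / hnorm h x"
    using hx by (simp add: u_def vec.scale hnorm_scale norm_divide)
  ultimately show ?thesis using hx by (simp add: divide_le_eq)
qed simp

lemma unit_vector_exists: "\<exists>x. hnorm h x = 1"
proof -
  define y :: "complex^'m" where "y = axis undefined 1"
  have "y \<noteq> 0" by (simp add: y_def axis_eq_0_iff)
  then have "hnorm h y > 0" using pos by (simp add: hnorm_def)
  then have "hnorm h (complex_of_real (1 / hnorm h y) *s y) = 1" by (simp add: hnorm_scale norm_divide)
  then show ?thesis by blast
qed

text \<open>Let \<open>a\<close> be the mean and \<open>y = A x - a x\<close>. The variance is \<open>h y y / p0\<close>, and the third cumulant is
  \<open>h y (A y) / p0\<close> minus \<open>a\<close> times the variance; both terms are at most \<open>M\<close> times the variance.\<close>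

lemma third_cumulant_bound:
  assumes A: "self_adjoint A" and M: "\<And>x. hnorm h (A *v x) \<le> M * hnorm h x" and x: "x \<noteq> 0"
  defines "p0 \<equiv> Re (h x x)" and "p1 \<equiv> Re (h x (A *v x))" and "p2 \<equiv> Re (h (A *v x) (A *v x))"
    and "p3 \<equiv> Re (h (A *v x) (A *v (A *v x)))"
  shows "p2 / p0 - p1 * p1 / p0\<^sup>2 \<ge> 0"
    and "\<bar>p3 / p0 - 3 * (p1 / p0) * (p2 / p0) + 2 * (p1 / p0) ^ 3\<bar> \<le> 2 * M * (p2 / p0 - p1 * p1 / p0\<^sup>2)"
proof -
  have p0: "p0 > 0" unfolding p0_def by (rule pos[OF x])
  have hx: "(hnorm h x)\<^sup>2 = p0" "hnorm h x > 0" using p0 by (auto simp: hnorm_sq p0_def hnorm_def)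
  have M0: "M \<ge> 0"
  proof -
    have "0 \<le> M * hnorm h x" using M[of x] hnorm_nonneg order_trans by blast
    then show ?thesis using hx(2) by (simp add: zero_le_mult_iff)
  qed
  define a where "a = p1 / p0"
  define y where "y = A *v x - a *\<^sub>R x"
  have Ax: "Re (h (A *v x) x) = p1" unfolding p1_def by (rule Re_sym)
  have AAx: "Re (h x (A *v (A *v x))) = p2" "Re (h (A *v (A *v x)) x) = p2"
    using self_adjointD[OF A, of x "A *v x"] Re_sym[of x "A *v (A *v x)"] by (auto simp: p2_def)
  have yy: "Re (h y y) = p0 * (p2 / p0 - p1 * p1 / p0\<^sup>2)"
  proof -
    have "Re (h y y) = p2 - 2 * a * p1 + a\<^sup>2 * p0"
      by (simp add: y_def diff_left diff_right scaleR_left scaleR_right Ax power2_eq_square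
          flip: p0_def p1_def p2_def) (simp add: algebra_simps)
    also have "\<dots> = p0 * (p2 / p0 - p1 * p1 / p0\<^sup>2)"
      using p0 by (simp add: a_def field_simps power2_eq_square)
    finally show ?thesis .
  qed
  have yAy: "Re (h y (A *v y)) = p3 - 2 * a * p2 + a\<^sup>2 * p1"
    by (simp add: y_def diff_left diff_right scaleR_left scaleR_right matrix_vector_mult_diff_distrib matrix_vector_scaleR AAx power2_eq_square
          flip: p0_def p1_def p2_def p3_def) (simp add: algebra_simps)
  show V: "p2 / p0 - p1 * p1 / p0\<^sup>2 \<ge> 0"
    using nonneg[of y] p0 unfolding yy by (simp add: zero_le_mult_iff)
  have 1: "\<bar>Re (h y (A *v y))\<bar> \<le> M * Re (h y y)"
  proof -
    have "\<bar>Re (h y (A *v y))\<bar> \<le> hnorm h y * hnorm h (A *v y)" by (rule Cauchy_Schwarz)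
    also have "\<dots> \<le> hnorm h y * (M * hnorm h y)" by (intro mult_left_mono M) simp
    also have "\<dots> = M * Re (h y y)" by (simp add: hnorm_sq[symmetric] power2_eq_square)
    finally show ?thesis .
  qed
  have 2: "\<bar>a\<bar> \<le> M"
  proof -
    have "\<bar>p1\<bar> \<le> hnorm h x * hnorm h (A *v x)" unfolding p1_def by (rule Cauchy_Schwarz)
    also have "\<dots> \<le> hnorm h x * (M * hnorm h x)" by (intro mult_left_mono M) simp
    also have "\<dots> = M * p0" by (simp add: hx(1)[symmetric] power2_eq_square)
    finally show ?thesis using p0 by (simp add: a_def abs_divide divide_le_eq)
  qed
  let ?V = "p2 / p0 - p1 * p1 / p0\<^sup>2"
  have "p3 / p0 - 3 * (p1 / p0) * (p2 / p0) + 2 * (p1 / p0) ^ 3 = Re (h y (A *v y)) / p0 - a * ?V"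
    unfolding yAy using p0 by (simp add: a_def field_simps power2_eq_square power3_eq_cube)
  also have "\<bar>\<dots>\<bar> \<le> \<bar>Re (h y (A *v y)) / p0\<bar> + \<bar>a * ?V\<bar>" by (rule abs_triangle_ineq4)
  also have "\<dots> \<le> M * ?V + M * ?V"
  proof (intro add_mono)
    have "\<bar>Re (h y (A *v y)) / p0\<bar> = \<bar>Re (h y (A *v y))\<bar> / p0" using p0 by (simp add: abs_divide)
    also have "\<dots> \<le> M * Re (h y y) / p0" using 1 p0 by (intro divide_right_mono) auto
    also have "\<dots> = M * ?V" unfolding yy using p0 by simp
    finally show "\<bar>Re (h y (A *v y)) / p0\<bar> \<le> M * ?V" .
    have "\<bar>a * ?V\<bar> = \<bar>a\<bar> * ?V" using V by (simp add: abs_mult)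
    also have "\<dots> \<le> M * ?V" using 2 V by (rule mult_right_mono)
    finally show "\<bar>a * ?V\<bar> \<le> M * ?V" .
  qed
  finally show "\<bar>p3 / p0 - 3 * (p1 / p0) * (p2 / p0) + 2 * (p1 / p0) ^ 3\<bar> \<le> 2 * M * ?V" by simp
qed

end

lemma matrix_third_moment_bound: "\<bar>(H ** Y) \<bullet> (H ** (H ** Y))\<bar> \<le> norm H * ((H ** Y) \<bullet> (H ** (Y :: complex^'n^'n)))"
proof -
  have "\<bar>(H ** Y) \<bullet> (H ** (H ** Y))\<bar> \<le> norm (H ** Y) * norm (H ** (H ** Y))" by (rule Cauchy_Schwarz_ineq2)
  also have "\<dots> \<le> norm (H ** Y) * (norm H * norm (H ** Y))" by (intro mult_left_mono norm_matrix_mult) simp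
  also have "\<dots> = norm H * ((H ** Y) \<bullet> (H ** Y))" by (simp add: dot_square_norm power2_eq_square)
  finally show ?thesis .
qed

lemma hermitian_mult_adjoint: "dagger H = H \<Longrightarrow> (H ** X) \<bullet> Y = X \<bullet> (H ** (Y :: complex^'k^'n))"
  by (simp add: inner_matrix_trace dagger_mult matrix_mul_assoc)

text \<open>By the hypothesis on \<open>f3\<close> the functions \<open>f2 t * exp (- t)\<close> and \<open>f2 t * exp t\<close> are monotone, so \<open>f2\<close> changes by at most the
  factor \<open>e\<close> on the unit interval; insert this into the Lagrange remainder.\<close>

lemma robust_quadratic_bounds:
  fixes f f1 f2 f3 :: "real \<Rightarrow> real"
  assumes d: "\<And>t. (f has_real_derivative f1 t) (at t)" "\<And>t. (f1 has_real_derivative f2 t) (at t)"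
    "\<And>t. (f2 has_real_derivative f3 t) (at t)"
    and rob: "\<And>t. \<bar>f3 t\<bar> \<le> \<rho> * f2 t" and \<rho>: "\<rho> \<le> 1" and f2: "\<And>t. f2 t \<ge> 0" and s: "0 \<le> s" "s \<le> 1"
  shows "f s \<le> f 0 + s * f1 0 + exp 1 / 2 * s\<^sup>2 * f2 0"
    and "f s \<ge> f 0 + s * f1 0 + 1 / (2 * exp 1) * s\<^sup>2 * f2 0"
proof -
  have rob1: "\<bar>f3 t\<bar> \<le> f2 t" for t
    using rob[of t] mult_right_mono[OF \<rho> f2[of t]] by simp
  have up: "f2 t \<le> exp 1 * f2 0" and lo: "f2 t \<ge> f2 0 / exp 1" if t: "0 \<le> t" "t \<le> 1" for t
  proof -
    have "(\<lambda>u. f2 u * exp (- u)) t \<le> (\<lambda>u. f2 u * exp (- u)) 0"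
    proof (rule DERIV_nonpos_imp_nonincreasing[OF t(1)])
      fix u
      have "((\<lambda>u. f2 u * exp (- u)) has_real_derivative (f3 u - f2 u) * exp (- u)) (at u)"
        by (auto intro!: derivative_eq_intros d simp: algebra_simps)
      moreover have "(f3 u - f2 u) * exp (- u) \<le> 0"
        using rob1[of u] by (intro mult_nonpos_nonneg) auto
      ultimately show "\<exists>y. ((\<lambda>u. f2 u * exp (- u)) has_real_derivative y) (at u) \<and> y \<le> 0" by blast
    qed
    then have "f2 t * exp (- t) * exp t \<le> f2 0 * exp t" by (intro mult_right_mono) auto
    then have "f2 t \<le> f2 0 * exp t" by (simp add: mult.assoc exp_minus)
    also have "\<dots> \<le> f2 0 * exp 1" using t f2 by (intro mult_left_mono) auto
    finally show "f2 t \<le> exp 1 * f2 0" by (simp add: mult.commute)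
    have "(\<lambda>u. f2 u * exp u) 0 \<le> (\<lambda>u. f2 u * exp u) t"
    proof (rule DERIV_nonneg_imp_nondecreasing[OF t(1)])
      fix u
      have "((\<lambda>u. f2 u * exp u) has_real_derivative (f3 u + f2 u) * exp u) (at u)"
        by (auto intro!: derivative_eq_intros d simp: algebra_simps)
      moreover have "(f3 u + f2 u) * exp u \<ge> 0"
        using rob1[of u] by (intro mult_nonneg_nonneg) auto
      ultimately show "\<exists>y. ((\<lambda>u. f2 u * exp u) has_real_derivative y) (at u) \<and> y \<ge> 0" by blast
    qed
    then have "f2 0 \<le> f2 t * exp t" by simp
    also have "\<dots> \<le> f2 t * exp 1" using t f2 by (intro mult_left_mono) auto
    finally show "f2 t \<ge> f2 0 / exp 1" by (simp add: divide_le_eq)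
  qed
  have "f s \<le> f 0 + s * f1 0 + exp 1 / 2 * s\<^sup>2 * f2 0 \<and> f s \<ge> f 0 + s * f1 0 + 1 / (2 * exp 1) * s\<^sup>2 * f2 0"
  proof (cases "s = 0")
    case False
    then have s0: "s > 0" using s by simp
    define D where "D m = (if m = 0 then f else if m = 1 then f1 else f2)" for m :: nat
    have "\<exists>t>0. t < s \<and> f s = (\<Sum>m<2. D m 0 / fact m * s ^ m) + D 2 t / fact 2 * s ^ 2"
    proof (rule Maclaurin[OF s0])
      show "\<forall>m t. m < 2 \<and> 0 \<le> t \<and> t \<le> s \<longrightarrow> DERIV (D m) t :> D (Suc m) t"
      proof (intro allI impI)
        fix m t assume "m < (2::nat) \<and> 0 \<le> t \<and> t \<le> s"
        then have "m = 0 \<or> m = 1" by auto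
        then show "DERIV (D m) t :> D (Suc m) t" using d by (auto simp: D_def)
      qed
    qed (auto simp: D_def)
    then obtain t where t: "0 < t" "t < s" and fs: "f s = f 0 + s * f1 0 + f2 t / 2 * s\<^sup>2"
      by (auto simp: D_def numeral_2_eq_2 mult.commute)
    have "f2 t / 2 * s\<^sup>2 \<le> exp 1 * f2 0 / 2 * s\<^sup>2"
      using up[of t] t s by (intro mult_right_mono divide_right_mono) auto
    moreover have "f2 0 / exp 1 / 2 * s\<^sup>2 \<le> f2 t / 2 * s\<^sup>2"
      using lo[of t] t s by (intro mult_right_mono divide_right_mono) auto
    ultimately show ?thesis unfolding fs by (simp add: field_simps)
  qed simp
  then show "f s \<le> f 0 + s * f1 0 + exp 1 / 2 * s\<^sup>2 * f2 0"
    "f s \<ge> f 0 + s * f1 0 + 1 / (2 * exp 1) * s\<^sup>2 * f2 0" by auto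
qed

lemma second_derivative_nonneg_chord:
  fixes f f1 f2 :: "real \<Rightarrow> real"
  assumes d: "\<And>t. (f has_real_derivative f1 t) (at t)" "\<And>t. (f1 has_real_derivative f2 t) (at t)"
    and f2: "\<And>t. f2 t \<ge> 0" and s: "0 \<le> s" "s \<le> 1"
  shows "f s - f 0 \<le> s * (f 1 - f 0)"
proof -
  have "convex_on UNIV f" by (rule f''_ge0_imp_convex[OF _ d f2]) auto
  from convex_onD[OF this s, of 0 1] show ?thesis by (simp add: algebra_simps)
qed

section \<open>Gradient and Hessian\<close>

lemma kron_mult: "kron A B ** kron C D = kron (A ** C) (B ** D)"
proof -
  have "(\<Sum>p\<in>UNIV. A $ i $ fst p * B $ j $ snd p * (C $ fst p $ k * D $ snd p $ l))
    = (\<Sum>a\<in>UNIV. A $ i $ a * C $ a $ k) * (\<Sum>b\<in>UNIV. B $ j $ b * D $ b $ l)" for i j k l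
  proof -
    have "(\<Sum>p\<in>UNIV. A $ i $ fst p * B $ j $ snd p * (C $ fst p $ k * D $ snd p $ l))
      = (\<Sum>(a, b)\<in>UNIV \<times> UNIV. (A $ i $ a * C $ a $ k) * (B $ j $ b * D $ b $ l))"
      by (simp add: case_prod_beta mult_ac)
    also have "\<dots> = (\<Sum>a\<in>UNIV. \<Sum>b\<in>UNIV. (A $ i $ a * C $ a $ k) * (B $ j $ b * D $ b $ l))"
      by (rule sum.cartesian_product[symmetric])
    finally show ?thesis by (simp add: sum_product)
  qed
  then show ?thesis by (simp add: vec_eq_iff matrix_matrix_mult_def kron_def)
qed

lemma trace_kron: "trace (kron A B) = trace A * trace B"
proof -
  have "trace (kron A B) = (\<Sum>(a, b)\<in>UNIV \<times> UNIV. A $ a $ a * B $ b $ b)"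
    by (simp add: trace_def kron_def case_prod_beta)
  also have "\<dots> = (\<Sum>a\<in>UNIV. \<Sum>b\<in>UNIV. A $ a $ a * B $ b $ b)"
    by (rule sum.cartesian_product[symmetric])
  finally show ?thesis by (simp add: trace_def sum_product)
qed

lemma dagger_kron: "dagger (kron A B) = kron (dagger A) (dagger B)"
  by (simp add: vec_eq_iff kron_def)

lemma trace_add_mult: "trace ((A + B) ** C) = trace (A ** C) + trace (B ** (C :: complex^'n^'n))"
  by (simp add: trace_def matrix_matrix_mult_def distrib_right sum.distrib)

lemma trace_scaleR_mult: "trace ((r *\<^sub>R A) ** C) = of_real r * trace (A ** (C :: complex^'n^'n))"
  by (simp add: matrix_mult_scaleR_left trace_def scaleR_conv_of_real[where 'a = complex] sum_distrib_left)

lemma trace_sum_mult: "trace (sum f I ** C) = (\<Sum>i\<in>I. trace (f i ** (C :: complex^'n^'n)))"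
proof (induction I rule: infinite_finite_induct)
  case (insert i I)
  then show ?case by (simp add: trace_add_mult)
qed (simp_all add: trace_def matrix_matrix_mult_def)

lemma trace_diff_mult: "trace ((A - B) ** C) = trace (A ** C) - trace (B ** (C :: complex^'n^'n))"
  using trace_add_mult[of A "(-1) *\<^sub>R B" C] by (simp add: trace_scaleR_mult[of "-1", simplified])

text \<open>The Riesz representation of the derivative on the real inner product space \<open>iLie K\<close>, where the trace
  of a product is the inner product.\<close>

lemma geodesic_gradient_eq:
  fixes l :: "complex^'n^'n \<Rightarrow> real"
  assumes S: "subspace (iLie K)" "\<And>H. H \<in> iLie K \<Longrightarrow> dagger H = H" and l: "linear l"
    and d: "\<And>H. H \<in> iLie K \<Longrightarrow> deriv (\<lambda>t::real. F (mexp (t *\<^sub>R H) ** g)) 0 = l H"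
    and H: "H \<in> iLie K"
  shows "Re (trace (geodesic_gradient K F g ** H)) = l H"
proof -
  let ?P = "\<lambda>W. W \<in> iLie K \<and> (\<forall>H\<in>iLie K. trace (W ** H) =
           complex_of_real (deriv (\<lambda>t::real. F (mexp (t *\<^sub>R H) ** g)) 0))"
  obtain w where w: "w \<in> iLie K" "\<And>H. H \<in> iLie K \<Longrightarrow> l H = H \<bullet> w"
    using Riesz_subspace[OF l S(1)] by blast
  have tr: "trace (W ** H) = complex_of_real (W \<bullet> H)" if "W \<in> iLie K" "H \<in> iLie K" for W H
    by (rule trace_hermitian_mult) (use S(2) that in auto)
  have "?P w" using w by (simp add: tr d inner_commute)
  moreover have "W = w" if W: "?P W" for W
  proof -
    have "(W - w) \<bullet> H = 0" if H: "H \<in> iLie K" for H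
    proof -
      have "complex_of_real (W \<bullet> H) = complex_of_real (w \<bullet> H)"
        using W \<open>?P w\<close> H tr by metis
      then show ?thesis by (simp add: inner_diff_left)
    qed
    moreover have "W - w \<in> iLie K" using W w(1) S(1) by (simp add: subspace_diff)
    ultimately have "(W - w) \<bullet> (W - w) = 0" by blast
    then show ?thesis by simp
  qed
  ultimately have "geodesic_gradient K F g = w"
    unfolding geodesic_gradient_def by (rule the_equality)
  then show ?thesis using w H by (simp add: tr inner_commute)
qed

text \<open>On the span of the squares the trace form is an inner product, because these matrices are Hermitian; so the
  values on squares determine the Hessian. For existence, expand the bilinear form in an orthonormal basis
  of \<open>iLie K\<close>.\<close>

lemma geodesic_hessian_eq:
  fixes \<beta> :: "complex^'n^'n \<Rightarrow> complex^'n^'n \<Rightarrow> real"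
  assumes S: "subspace (iLie K)" "\<And>H. H \<in> iLie K \<Longrightarrow> dagger H = H"
    and \<beta>: "\<And>X. linear (\<beta> X)" "\<And>X. linear (\<lambda>Y. \<beta> Y X)"
    and d: "\<And>H. H \<in> iLie K \<Longrightarrow> (deriv ^^ 2) (\<lambda>t::real. F (mexp (t *\<^sub>R H) ** g)) 0 = \<beta> H H"
    and H: "H \<in> iLie K"
  shows "Re (trace (geodesic_hessian K F g ** kron H H)) = \<beta> H H"
proof -
  let ?T = "span ((\<lambda>X. kron X X) ` iLie K)"
  let ?P = "\<lambda>Q. Q \<in> ?T \<and> (\<forall>H\<in>iLie K. trace (Q ** kron H H) =
           complex_of_real ((deriv ^^ 2) (\<lambda>t::real. F (mexp (t *\<^sub>R H) ** g)) 0))"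
  obtain B where B: "B \<subseteq> iLie K" "pairwise orthogonal B" "\<And>x. x \<in> B \<Longrightarrow> norm x = 1"
    "independent B" "span B = iLie K"
    using orthonormal_basis_subspace[OF S(1)] by metis
  have finB: "finite B" using B(4) by (rule independent_imp_finite)
  have tr: "trace (kron X X ** kron H H) = complex_of_real ((X \<bullet> H)\<^sup>2)" if "X \<in> iLie K" "H \<in> iLie K" for X H
    using trace_hermitian_mult[of X H] S(2) that by (simp add: kron_mult trace_kron power2_eq_square)
  \<comment> \<open>polarization turns the coefficient matrix of the form into a combination of squares\<close>
  define Q where "Q = (\<Sum>b\<in>B. \<Sum>c\<in>B. (\<beta> b c / 2) *\<^sub>R (kron (b + c) (b + c) - kron b b - kron c c))"
  have "Q \<in> ?T"
    unfolding Q_def using B(1) S(1)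
    by (intro span_sum span_scale span_diff) (auto intro!: span_base subspace_add)
  moreover have "trace (Q ** kron H H) = complex_of_real (\<beta> H H)" if H: "H \<in> iLie K" for H
  proof -
    have summand: "trace (((\<beta> b c / 2) *\<^sub>R (kron (b + c) (b + c) - kron b b - kron c c)) ** kron H H)
        = complex_of_real ((H \<bullet> b) * ((H \<bullet> c) * \<beta> b c))" if "b \<in> B" "c \<in> B" for b c
    proof -
      have bc: "b \<in> iLie K" "c \<in> iLie K" "b + c \<in> iLie K" using that B(1) S(1) by (auto intro: subspace_add)
      show ?thesis
        by (simp only: trace_scaleR_mult trace_diff_mult tr[OF bc(1) H] tr[OF bc(2) H] tr[OF bc(3) H] of_real_mult[symmetric] of_real_diff[symmetric])
          (simp add: inner_add_left inner_commute[of H] power2_eq_square algebra_simps)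
    qed
    have exp: "(\<Sum>b\<in>B. (H \<bullet> b) *\<^sub>R b) = H"
      by (rule orthonormal_basis_expand[OF B(2,3) _ finB]) (use H B(5) in auto)
    have "\<beta> H H = \<beta> (\<Sum>b\<in>B. (H \<bullet> b) *\<^sub>R b) (\<Sum>c\<in>B. (H \<bullet> c) *\<^sub>R c)"
      by (simp only: exp)
    also have "\<dots> = (\<Sum>b\<in>B. (H \<bullet> b) * \<beta> b (\<Sum>c\<in>B. (H \<bullet> c) *\<^sub>R c))"
      by (simp add: linear_sum[OF \<beta>(2)] linear_scale[OF \<beta>(2)])
    also have "\<dots> = (\<Sum>b\<in>B. \<Sum>c\<in>B. (H \<bullet> b) * ((H \<bullet> c) * \<beta> b c))"
      by (simp add: linear_sum[OF \<beta>(1)] linear_scale[OF \<beta>(1)] sum_distrib_left)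
    finally have \<beta>H: "\<beta> H H = (\<Sum>b\<in>B. \<Sum>c\<in>B. (H \<bullet> b) * ((H \<bullet> c) * \<beta> b c))" .
    have "trace (Q ** kron H H) = (\<Sum>b\<in>B. \<Sum>c\<in>B. complex_of_real ((H \<bullet> b) * ((H \<bullet> c) * \<beta> b c)))"
      unfolding Q_def trace_sum_mult by (intro sum.cong refl summand)
    then show ?thesis by (simp add: \<beta>H)
  qed
  ultimately have PQ: "?P Q" by (simp add: d)
  have herm: "dagger R = R" if "R \<in> ?T" for R
  proof -
    have "subspace {R :: complex^('n\<times>'n)^('n\<times>'n). dagger R = R}"
      by (auto simp: subspace_def dagger_add dagger_scaleR vec_eq_iff)
    moreover have "(\<lambda>X. kron X X) ` iLie K \<subseteq> {R. dagger R = R}" using S(2) by (auto simp: dagger_kron)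
    ultimately have "?T \<subseteq> {R. dagger R = R}" by (intro span_minimal)
    then show ?thesis using that by blast
  qed
  have "Q' = Q" if Q': "?P Q'" for Q'
  proof -
    define R where "R = Q' - Q"
    have R: "R \<in> ?T" unfolding R_def using Q' PQ by (auto intro: span_diff)
    have "orthogonal R (kron H H)" if H: "H \<in> iLie K" for H
    proof -
      have "trace (R ** kron H H) = 0" using Q' PQ H by (simp add: R_def trace_diff_mult)
      then show ?thesis by (simp add: orthogonal_def inner_matrix_trace herm[OF R])
    qed
    then have "orthogonal R R" using R by (intro orthogonal_to_span[of R]) auto
    then show ?thesis by (simp add: orthogonal_def R_def)
  qed
  then have "geodesic_hessian K F g = Q"
    unfolding geodesic_hessian_def using PQ by (intro the_equality) blast+
  then show ?thesis using PQ H d by simp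
qed

context symmetric_representation
begin

lemma dpi_weight_norm:
  assumes H: "H \<in> iLie K"
  shows "hnorm h (dpi H *v x) \<le> weight_norm K \<pi> h * norm H * hnorm h x"
proof (cases "H = 0")
  case True
  then show ?thesis using linear_0[OF dpi_linear] by simp
next
  case False
  obtain M where M: "M \<ge> 0" "\<And>A x. hnorm h (A *v x) \<le> M * norm A * hnorm h x" using hopnorm_bound by blast
  obtain L where L: "\<And>H. norm (dpi H) \<le> norm H * L" using bounded_linear.bounded[OF dpi_bounded_linear] by blast
  have le: "hopnorm h A \<le> M * norm A" for A
    unfolding hopnorm_def using unit_vector_exists
  proof (intro cSUP_least)
    show "hnorm h (A *v x) \<le> M * norm A" if "x \<in> {x. hnorm h x = 1}" for x
      using M(2)[of A x] that by simp
  qed auto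
  have "bdd_above (insert 0 {hopnorm h (Lie_rep \<pi> H) | H. H \<in> iLie K \<and> norm H = 1})"
  proof (rule bdd_aboveI[of _ "max 0 (M * L)"])
    fix y assume "y \<in> insert 0 {hopnorm h (Lie_rep \<pi> H) | H. H \<in> iLie K \<and> norm H = 1}"
    then consider "y = 0" | H where "H \<in> iLie K" "norm H = 1" "y = hopnorm h (dpi H)"
      using Lie_rep_eq by auto
    then show "y \<le> max 0 (M * L)"
    proof cases
      case (2 H)
      have "y \<le> M * norm (dpi H)" using 2 le by simp
      also have "\<dots> \<le> M * L" using L[of H] 2 M(1) by (intro mult_left_mono) auto
      finally show ?thesis by simp
    qed simp
  qed
  moreover define H' where "H' = (1 / norm H) *\<^sub>R H"
  have H': "H' \<in> iLie K" "norm H' = 1" using H False by (auto simp: H'_def iLie_scaleR)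
  ultimately have "hopnorm h (dpi H') \<le> weight_norm K \<pi> h"
    unfolding weight_norm_def using Lie_rep_eq by (intro cSup_upper) auto
  then have "hopnorm h (dpi H') * hnorm h x \<le> weight_norm K \<pi> h * hnorm h x" by (rule mult_right_mono) simp
  then have "hnorm h (dpi H' *v x) \<le> weight_norm K \<pi> h * hnorm h x" using hnorm_le_hopnorm[of "dpi H'" x] by linarith
  then have "norm H * hnorm h (dpi H' *v x) \<le> norm H * (weight_norm K \<pi> h * hnorm h x)" by (rule mult_left_mono) simp
  moreover have "hnorm h (dpi H *v x) = norm H * hnorm h (dpi H' *v x)"
  proof -
    have "dpi H *v x = complex_of_real (norm H) *s (dpi H' *v x)"
    proof -
      have "H = cscale (of_real (norm H)) H'" using False by (simp add: H'_def cscale_of_real)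
      then have "dpi H = cscale (of_real (norm H)) (dpi H')" by (metis dpi_cscale)
      then show ?thesis by (simp add: cscale_mult_vec)
    qed
    then show ?thesis by (simp add: hnorm_scale)
  qed
  ultimately show ?thesis by (simp add: mult_ac)
qed

end

locale second_order_setting = symmetric_representation h G K \<pi>
  for h :: "complex^'m \<Rightarrow> complex^'m \<Rightarrow> complex" and G K :: "(complex^'n^'n) set"
    and \<pi> :: "complex^'n^'n \<Rightarrow> complex^'m^'m" +
  fixes v :: "complex^'m" and \<kappa> \<epsilon> N :: real
  assumes cap_pos: "capacity G \<pi> h v > 0" and \<kappa>: "\<kappa> > 0" and \<epsilon>: "\<epsilon> > 0"
    and N_weight: "N \<ge> weight_norm K \<pi> h" and N_half: "N \<ge> 1 / 2"
begin

abbreviation F where "F \<equiv> objective \<pi> h v \<kappa> \<epsilon>"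

text \<open>The first derivative of \<open>F\<close> at \<open>g\<close> in the direction \<open>H\<close>. The regularizer contributes through \<open>g\<close> and
  through \<open>g' = dagger (matrix_inv g)\<close>, which moves along the flow of \<open>- H\<close> when \<open>g\<close> moves along that of \<open>H\<close>.\<close>

definition gradient_form :: "complex^'n^'n \<Rightarrow> complex^'n^'n \<Rightarrow> real" where
  "gradient_form g H = (let w = \<pi> g *v v; g' = dagger (matrix_inv g) in
     Re (h w (dpi H *v w)) / Re (h w w) + \<epsilon> / \<kappa> * (2 * (g \<bullet> (H ** g)) - 2 * (g' \<bullet> (H ** g'))))"

text \<open>The second derivative of \<open>F\<close>, polarized so that it is bilinear in the directions \<open>X\<close> and \<open>Y\<close>.\<close>

definition hessian_form :: "complex^'n^'n \<Rightarrow> complex^'n^'n \<Rightarrow> complex^'n^'n \<Rightarrow> real" where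
  "hessian_form g X Y = (let w = \<pi> g *v v; g' = dagger (matrix_inv g) in
     2 * (Re (h (dpi X *v w) (dpi Y *v w)) / Re (h w w)
        - Re (h w (dpi X *v w)) * Re (h w (dpi Y *v w)) / (Re (h w w))\<^sup>2)
     + \<epsilon> / \<kappa> * (4 * ((X ** g) \<bullet> (Y ** g)) + 4 * ((X ** g') \<bullet> (Y ** g'))))"

text \<open>Three self-adjoint flows enter: \<open>dpi H\<close> on vectors, and multiplication by \<open>H\<close> and by \<open>- H\<close> on matrices. The
  logarithmic part has third derivative at most \<open>4 N |H|\<close> times the second. The regularizer is a sum of exponentials
  with rates at most \<open>2 |H|\<close>, and \<open>2 \<le> 4 N\<close>.\<close>

lemma F_derivatives:
  assumes g: "g \<in> G" and H: "H \<in> iLie K"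
  shows "((\<lambda>t. F (hexp (of_real t) H ** g)) has_real_derivative gradient_form (hexp (of_real t) H ** g) H) (at t)"
    and "((\<lambda>t. gradient_form (hexp (of_real t) H ** g) H) has_real_derivative
          hessian_form (hexp (of_real t) H ** g) H H) (at t)"
    and "hessian_form g H H \<ge> 0"
    and "\<exists>D. ((\<lambda>t. hessian_form (hexp (of_real t) H ** g) H H) has_real_derivative D) (at t) \<and>
          \<bar>D\<bar> \<le> 4 * N * norm H * hessian_form (hexp (of_real t) H ** g) H H"
proof -
  have Hh: "dagger H = H" by (rule iLie_hermitian[OF H])
  define c where "c = \<epsilon> / \<kappa>"
  have c: "c \<ge> 0" using \<epsilon> \<kappa> by (simp add: c_def)
  define x where "x t = \<pi> (hexp (of_real t) H ** g) *v v" for t :: real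
  define Y where "Y t = hexp (of_real t) H ** g" for t :: real
  define Z where "Z t = hexp (- of_real t) H ** dagger (matrix_inv g)" for t :: real
  have YG: "Y t \<in> G" for t unfolding Y_def by (intro G_mult hexp_in_G H g)
  have Zeq: "dagger (matrix_inv (Y t)) = Z t" for t
  proof -
    have "(matrix_inv g ** hexp (- of_real t) H) ** Y t = matrix_inv g ** (hexp (- of_real t) H ** hexp (of_real t) H) ** g"
      by (simp add: Y_def matrix_mul_assoc)
    also have "\<dots> = mat 1" by (simp add: hexp_minus[OF Hh] matrix_inv_inverse[OF G_invertible[OF g]])
    finally have "matrix_inv (Y t) = matrix_inv g ** hexp (- of_real t) H" by (rule matrix_inv_eqI)
    then show ?thesis by (simp add: dagger_mult dagger_hexp[OF Hh] Z_def)
  qed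
  have x_eq: "x t = \<pi> (hexp (of_real t) H) *v (\<pi> g *v v)" for t
    by (simp add: x_def pi_mult hexp_in_G H g matrix_vector_mul_assoc)
  have x': "(x has_vector_derivative dpi H *v x t) (at t)" for t
  proof -
    have "((\<lambda>t. \<pi> (hexp (of_real t) H) *v (\<pi> g *v v)) has_vector_derivative (dpi H ** \<pi> (hexp (of_real t) H)) *v (\<pi> g *v v)) (at t)"
      using bounded_linear.has_vector_derivative[OF bounded_linear_vector_left pi_hexp_derivative(1)[OF H, of 1]]
      by simp
    then show ?thesis by (simp add: x_eq[abs_def] matrix_vector_mul_assoc matrix_mul_assoc)
  qed
  have Y': "(Y has_vector_derivative H ** Y t) (at t)" for t
    using bounded_linear.has_vector_derivative[OF bounded_linear_mult_left hexp_has_vector_derivative[OF Hh, of 1], of g]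
    by (simp add: Y_def[abs_def] matrix_mul_assoc)
  have Z': "(Z has_vector_derivative cscale (- 1) H ** Z t) (at t)" for t
    using bounded_linear.has_vector_derivative[OF bounded_linear_mult_left hexp_has_vector_derivative[OF Hh, of "- 1"], of "dagger (matrix_inv g)"]
    by (simp add: Z_def[abs_def] matrix_mul_assoc)
  have mH: "dagger (cscale (- 1) H) = cscale (- 1) H" by (simp add: dagger_cscale Hh)
  have neg: "cscale (- 1) H ** X = - (H ** X)" for X :: "complex^'n^'n"
    unfolding cscale_mult_left by (simp add: vec_eq_iff)
  define p0 where "p0 t = Re (h (x t) (x t))" for t
  define p1 where "p1 t = Re (h (x t) (dpi H *v x t))" for t
  define p2 where "p2 t = Re (h (dpi H *v x t) (dpi H *v x t))" for t
  define p3 where "p3 t = Re (h (dpi H *v x t) (dpi H *v (dpi H *v x t)))" for t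
  have bl: "bounded_bilinear (\<lambda>x y. Re (h x y))"
  proof -
    obtain M where M: "\<And>x y. norm (h x y) \<le> norm x * norm y * M"
      using bounded_bilinear.bounded[OF bounded_bilinear] by blast
    have "\<exists>M. \<forall>x y. norm (Re (h x y)) \<le> norm x * norm y * M"
      using M abs_Re_le_cmod order_trans unfolding real_norm_def by blast
    then show ?thesis by unfold_locales (auto simp: add_left add_right scaleR_left scaleR_right)
  qed
  note px = self_adjoint_flow_derivatives[OF bl Re_sym bounded_linear_vector_right
      arg_cong[OF self_adjointD[OF dpi_self_adjoint[OF H]], of Re] x', folded p0_def p1_def p2_def p3_def]
  note yd = self_adjoint_flow_derivatives[OF bounded_bilinear_inner inner_commute
      bounded_linear_mult_right hermitian_mult_adjoint[OF Hh] Y']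
  note zd = self_adjoint_flow_derivatives[OF bounded_bilinear_inner inner_commute
      bounded_linear_mult_right hermitian_mult_adjoint[OF mH] Z']
  have xne: "x t \<noteq> 0" for t
    using hnorm_pi_pos(2)[OF cap_pos YG[of t]] by (auto simp: x_def Y_def)
  have p0: "p0 t > 0" for t unfolding p0_def by (rule pos[OF xne])
  note ld = half_ln_derivatives[OF p0 px]
  have F_eq: "F (Y t) = ln (p0 t) / 2 + c * (Y t \<bullet> Y t + Z t \<bullet> Z t)" for t
  proof -
    have "ln (hnorm h (\<pi> (Y t) *v v)) = ln (p0 t) / 2"
      using p0[of t] by (simp add: hnorm_def p0_def x_def Y_def ln_sqrt)
    moreover have "reg (Y t) = Y t \<bullet> Y t + Z t \<bullet> Z t"
      by (simp add: reg_def power2_norm_eq_inner[symmetric] flip: Zeq)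
    ultimately show ?thesis by (simp add: objective_def c_def)
  qed
  have L_eq: "gradient_form (Y t) H = p1 t / p0 t + c * (2 * (Y t \<bullet> (H ** Y t)) + 2 * (Z t \<bullet> (cscale (- 1) H ** Z t)))" for t
    by (simp add: gradient_form_def Let_def Zeq neg c_def p0_def p1_def x_def flip: Y_def)
  have Q_eq: "hessian_form (Y t) H H = 2 * (p2 t / p0 t - p1 t * p1 t / (p0 t)\<^sup>2)
      + c * (4 * ((H ** Y t) \<bullet> (H ** Y t)) + 4 * ((cscale (- 1) H ** Z t) \<bullet> (cscale (- 1) H ** Z t)))" for t
    by (simp add: hessian_form_def Let_def Zeq neg c_def p0_def p1_def p2_def x_def flip: Y_def)
  show "((\<lambda>t. F (hexp (of_real t) H ** g)) has_real_derivative gradient_form (hexp (of_real t) H ** g) H) (at t)"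
    unfolding Y_def[symmetric] F_eq L_eq by (intro DERIV_add DERIV_cmult ld yd zd)
  show "((\<lambda>t. gradient_form (hexp (of_real t) H ** g) H) has_real_derivative
          hessian_form (hexp (of_real t) H ** g) H H) (at t)"
  proof -
    have "((\<lambda>t. p1 t / p0 t + c * (2 * (Y t \<bullet> (H ** Y t)) + 2 * (Z t \<bullet> (cscale (- 1) H ** Z t)))) has_real_derivative
      2 * (p2 t / p0 t - p1 t * p1 t / (p0 t)\<^sup>2)
      + c * (2 * (2 * ((H ** Y t) \<bullet> (H ** Y t))) + 2 * (2 * ((cscale (- 1) H ** Z t) \<bullet> (cscale (- 1) H ** Z t))))) (at t)"
      by (intro DERIV_add DERIV_cmult ld yd zd)
    then show ?thesis unfolding Y_def[symmetric] L_eq Q_eq by simp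
  qed
  have M: "hnorm h (dpi H *v z) \<le> (N * norm H) * hnorm h z" for z
  proof -
    have "weight_norm K \<pi> h * norm H * hnorm h z \<le> N * norm H * hnorm h z"
      using N_weight by (intro mult_right_mono) auto
    then show ?thesis using dpi_weight_norm[OF H, of z] by linarith
  qed
  note tc = third_cumulant_bound[OF dpi_self_adjoint[OF H] M xne, folded p0_def p1_def p2_def p3_def]
  have Q_nonneg: "hessian_form (Y t) H H \<ge> 0" for t
    unfolding Q_eq using tc(1)[of t] c by (intro add_nonneg_nonneg mult_nonneg_nonneg) auto
  show "hessian_form g H H \<ge> 0" using Q_nonneg[of 0] by (simp add: Y_def)
  let ?q = "\<lambda>t. p2 t / p0 t - p1 t * p1 t / (p0 t)\<^sup>2"
  let ?k = "\<lambda>t. p3 t / p0 t - 3 * (p1 t / p0 t) * (p2 t / p0 t) + 2 * (p1 t / p0 t) ^ 3"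
  let ?y = "\<lambda>t. (H ** Y t) \<bullet> (H ** (H ** Y t))"
  let ?z = "\<lambda>t. (cscale (- 1) H ** Z t) \<bullet> (cscale (- 1) H ** (cscale (- 1) H ** Z t))"
  let ?y2 = "\<lambda>t. (H ** Y t) \<bullet> (H ** Y t)"
  let ?z2 = "\<lambda>t. (cscale (- 1) H ** Z t) \<bullet> (cscale (- 1) H ** Z t)"
  have "((\<lambda>t. 2 * ?q t + c * (4 * ?y2 t + 4 * ?z2 t)) has_real_derivative
      4 * ?k t + c * (4 * (2 * ?y t) + 4 * (2 * ?z t))) (at t)" for t
    by (intro DERIV_add DERIV_cmult[of _ _ _ _ c] DERIV_cmult[of _ _ _ _ 4] ld yd zd)
  moreover have "\<bar>4 * ?k t + c * (4 * (2 * ?y t) + 4 * (2 * ?z t))\<bar> \<le> 4 * N * norm H * hessian_form (Y t) H H" for t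
  proof -
    have nH: "norm (cscale (- 1) H) = norm H"
      using norm_scaleR[of "- 1" H] by (simp flip: cscale_of_real)
    have ky: "\<bar>?y t\<bar> \<le> norm H * ?y2 t" by (rule matrix_third_moment_bound)
    have kz: "\<bar>?z t\<bar> \<le> norm H * ?z2 t"
      using matrix_third_moment_bound[of "cscale (- 1) H" "Z t"] unfolding nH .
    have "\<bar>4 * ?k t + c * (4 * (2 * ?y t) + 4 * (2 * ?z t))\<bar> \<le> 4 * \<bar>?k t\<bar> + c * (8 * \<bar>?y t\<bar> + 8 * \<bar>?z t\<bar>)"
    proof -
      have "\<bar>c * (4 * (2 * ?y t) + 4 * (2 * ?z t))\<bar> \<le> c * (8 * \<bar>?y t\<bar> + 8 * \<bar>?z t\<bar>)"
        unfolding abs_mult using c by (intro mult_mono) auto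
      moreover have "\<bar>4 * a + b\<bar> \<le> 4 * \<bar>a\<bar> + b'" if "\<bar>b\<bar> \<le> b'" for a b b' :: real using that by linarith
      ultimately show ?thesis by blast
    qed
    also have "\<dots> \<le> 4 * (2 * (N * norm H) * ?q t) + c * (8 * (norm H * ?y2 t) + 8 * (norm H * ?z2 t))"
      using tc(2)[of t] ky kz c by (intro add_mono mult_left_mono) auto
    also have "\<dots> \<le> 4 * (2 * (N * norm H) * ?q t) + c * (2 * N * (8 * (norm H * ?y2 t) + 8 * (norm H * ?z2 t)))"
    proof -
      have "1 * (8 * (norm H * ?y2 t) + 8 * (norm H * ?z2 t)) \<le> (2 * N) * (8 * (norm H * ?y2 t) + 8 * (norm H * ?z2 t))"
        using N_half by (intro mult_right_mono) auto
      from mult_left_mono[OF this c] show ?thesis by simp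
    qed
    also have "\<dots> = 4 * N * norm H * hessian_form (Y t) H H" unfolding Q_eq by (simp add: algebra_simps)
    finally show ?thesis .
  qed
  ultimately show "\<exists>D. ((\<lambda>t. hessian_form (hexp (of_real t) H ** g) H H) has_real_derivative D) (at t) \<and>
          \<bar>D\<bar> \<le> 4 * N * norm H * hessian_form (hexp (of_real t) H ** g) H H"
    unfolding Y_def[symmetric] Q_eq[abs_def] by (intro exI conjI) (auto simp: Q_eq)
qed

lemma linear_forms:
  "linear (gradient_form g)" "linear (hessian_form g X)" "linear (\<lambda>Y. hessian_form g Y X)"
  unfolding linear_iff
  by (auto simp: gradient_form_def hessian_form_def Let_def linear_add[OF dpi_linear] linear_scale[OF dpi_linear]
      matrix_vector_mult_add_rdistrib add_right add_left scaleR_right scaleR_left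
      bounded_bilinear.scaleR_left[OF bounded_bilinear_matrix_vector]
      bounded_bilinear.add_left[OF bounded_bilinear_matrix_mult] matrix_mult_scaleR_left
      inner_add_right inner_add_left add_divide_distrib algebra_simps)

lemma quadratic_model_eq:
  assumes g: "g \<in> G" and H: "H \<in> iLie K"
  shows "quadratic_model (geodesic_gradient K F g) (geodesic_hessian K F g) H
    = gradient_form g H + 1 / (2 * exp 1) * hessian_form g H H"
proof -
  have d1: "deriv (\<lambda>t::real. F (mexp (t *\<^sub>R H) ** g)) = (\<lambda>t. gradient_form (hexp (of_real t) H ** g) H)"
    if "H \<in> iLie K" for H
    unfolding mexp_scaleR_hexp by (rule ext) (rule DERIV_imp_deriv[OF F_derivatives(1)[OF g that]])
  have d2: "(deriv ^^ 2) (\<lambda>t::real. F (mexp (t *\<^sub>R H) ** g)) 0 = hessian_form g H H" if "H \<in> iLie K" for H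
    using DERIV_imp_deriv[OF F_derivatives(2)[OF g that, of 0]]
    by (simp add: numeral_2_eq_2 d1[OF that])
  have "Re (trace (geodesic_gradient K F g ** H)) = gradient_form g H"
    by (rule geodesic_gradient_eq[OF subspace_iLie iLie_hermitian linear_forms(1) _ H]) (simp_all add: d1)
  moreover have "Re (trace (geodesic_hessian K F g ** kron H H)) = hessian_form g H H"
    by (rule geodesic_hessian_eq[OF subspace_iLie iLie_hermitian linear_forms(2,3) d2 H])
  ultimately show ?thesis by (simp add: quadratic_model_def)
qed

end

section \<open>The second order algorithm\<close>

text \<open>Since \<open>2 n \<le> \<kappa>\<close>, the argument of the logarithm is at most
  \<open>\<kappa>\<^sup>2 (C + \<epsilon>) / \<epsilon>\<close>; the rest is \<open>ln y \<le> y - 1\<close> and \<open>\<gamma> \<le> 1\<close>.\<close>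

lemma log_condition_bound:
  fixes n \<epsilon> C \<gamma> :: real
  defines "\<kappa> \<equiv> 2 * n * (exp (2 * C) / (2 * \<epsilon>)) powr (1 / \<gamma>)"
  assumes n: "n \<ge> 1" and \<epsilon>: "0 < \<epsilon>" "\<epsilon> < 1 / 2" and C: "C \<ge> 0" and \<gamma>: "0 < \<gamma>" "\<gamma> \<le> 1"
  shows "2 * n \<le> \<kappa>"
    and "ln (\<kappa> * (\<kappa> * C / \<epsilon> + 2 * n)) \<le> 12 / \<gamma> * (ln (n / \<epsilon>) + C)"
proof -
  define a where "a = exp (2 * C) / (2 * \<epsilon>)"
  have ln_a: "ln a = 2 * C - ln (2 * \<epsilon>)" using \<epsilon> by (simp add: a_def ln_div)
  have ln2e: "ln (2 * \<epsilon>) = ln 2 + ln \<epsilon>" using \<epsilon> by (simp add: ln_mult)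
  have le0: "ln (2 * \<epsilon>) \<le> 0" using \<epsilon> by simp
  have lna: "ln a \<ge> 0" using C le0 by (simp add: ln_a)
  have apos: "a > 0" using \<epsilon> by (simp add: a_def)
  have a1: "a powr (1 / \<gamma>) \<ge> 1" using lna \<gamma> apos by (simp add: powr_def)
  show \<kappa>n: "2 * n \<le> \<kappa>"
    using mult_left_mono[OF a1, of "2 * n"] n by (simp add: \<kappa>_def a_def)
  have \<kappa>0: "\<kappa> > 0" using \<kappa>n n by linarith
  have ln\<kappa>: "ln \<kappa> = ln 2 + ln n + ln a / \<gamma>"
    using n apos by (simp add: \<kappa>_def ln_mult ln_powr flip: a_def)
  have "\<kappa> * (\<kappa> * C / \<epsilon> + 2 * n) \<le> \<kappa> * (\<kappa> * C / \<epsilon> + \<kappa>)"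
    using \<kappa>n \<kappa>0 by (intro mult_left_mono add_mono) auto
  also have "\<dots> = \<kappa> * \<kappa> * ((C + \<epsilon>) / \<epsilon>)" using \<epsilon> by (simp add: field_simps)
  finally have le: "\<kappa> * (\<kappa> * C / \<epsilon> + 2 * n) \<le> \<kappa> * \<kappa> * ((C + \<epsilon>) / \<epsilon>)" .
  have pos: "\<kappa> * (\<kappa> * C / \<epsilon> + 2 * n) > 0"
    using \<kappa>0 C \<epsilon> n by (intro mult_pos_pos add_nonneg_pos) auto
  have "ln (\<kappa> * (\<kappa> * C / \<epsilon> + 2 * n)) \<le> ln (\<kappa> * \<kappa> * ((C + \<epsilon>) / \<epsilon>))"
    using le pos by (subst ln_le_cancel_iff) auto
  also have "\<dots> = 2 * ln \<kappa> + ln (C + \<epsilon>) - ln \<epsilon>"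
  proof -
    have "ln (\<kappa> * \<kappa> * ((C + \<epsilon>) / \<epsilon>)) = ln (\<kappa> * \<kappa>) + ln ((C + \<epsilon>) / \<epsilon>)"
      using \<kappa>0 C \<epsilon> by (intro ln_mult_pos) (auto intro: add_nonneg_pos)
    moreover have "ln (\<kappa> * \<kappa>) = ln \<kappa> + ln \<kappa>" using \<kappa>0 by (intro ln_mult_pos)
    moreover have "ln ((C + \<epsilon>) / \<epsilon>) = ln (C + \<epsilon>) - ln \<epsilon>" using C \<epsilon> by (intro ln_divide_pos) auto
    ultimately show ?thesis by simp
  qed
  also have "\<dots> \<le> 2 * ln \<kappa> + C - ln \<epsilon>"
    using ln_le_minus_one[of "C + \<epsilon>"] C \<epsilon> by linarith
  finally have 1: "ln (\<kappa> * (\<kappa> * C / \<epsilon> + 2 * n)) \<le> 2 * ln 2 + 2 * ln n + 2 * (ln a / \<gamma>) + C - ln \<epsilon>"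
    by (simp add: ln\<kappa>)
  have ln\<epsilon>: "ln \<epsilon> \<le> 0" using \<epsilon> by simp
  have lnn: "ln n \<ge> 0" using n by simp
  have ln2: "ln 2 \<ge> (0::real)" by simp
  have "2 * ln 2 + 2 * ln n + C - ln \<epsilon> \<ge> 0" using ln\<epsilon> lnn ln2 C by linarith
  from mult_left_le[OF \<gamma>(2) this]
  have "2 * ln 2 + 2 * ln n + C - ln \<epsilon> \<le> (2 * ln 2 + 2 * ln n + C - ln \<epsilon>) / \<gamma>"
    using \<gamma>(1) by (simp add: pos_le_divide_eq)
  with 1 have "ln (\<kappa> * (\<kappa> * C / \<epsilon> + 2 * n)) \<le> (2 * ln 2 + 2 * ln n + C - ln \<epsilon> + 2 * ln a) / \<gamma>"
    by (simp add: add_divide_distrib diff_divide_distrib)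
  also have "\<dots> \<le> (12 * (ln (n / \<epsilon>) + C)) / \<gamma>"
  proof (rule divide_right_mono)
    have "ln (n / \<epsilon>) = ln n - ln \<epsilon>" using n \<epsilon> by (intro ln_divide_pos) auto
    moreover have "2 * x + 2 * y + C - z + 2 * (2 * C - (x + z)) \<le> 12 * ((y - z) + C)"
      if "0 \<le> y" "z \<le> 0" for x y z :: real
    proof -
      have "0 \<le> 10 * y + 9 * (- z) + 7 * C"
        using that C by (intro add_nonneg_nonneg mult_nonneg_nonneg) auto
      then show ?thesis by (simp add: algebra_simps)
    qed
    ultimately show "2 * ln 2 + 2 * ln n + C - ln \<epsilon> + 2 * ln a \<le> 12 * (ln (n / \<epsilon>) + C)"
      unfolding ln_a ln2e using ln\<epsilon> lnn by simp
  qed (use \<gamma> in simp)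
  finally show "ln (\<kappa> * (\<kappa> * C / \<epsilon> + 2 * n)) \<le> 12 / \<gamma> * (ln (n / \<epsilon>) + C)" by simp
qed

lemma norm_le_sqrt_dim:
  fixes d :: "real^'n"
  assumes "\<And>i. \<bar>d $ i\<bar> \<le> m"
  shows "norm d \<le> sqrt (real CARD('n)) * m"
proof -
  have m: "m \<ge> 0" using assms abs_ge_zero order_trans by blast
  have "(norm d)\<^sup>2 = (\<Sum>i\<in>UNIV. \<bar>d $ i\<bar>\<^sup>2)" by (simp add: norm_vec_def L2_set_def sum_nonneg)
  also have "\<dots> \<le> (\<Sum>i\<in>(UNIV :: 'n set). m\<^sup>2)" by (intro sum_mono power_mono assms) simp
  also have "\<dots> = (sqrt (real CARD('n)) * m)\<^sup>2" by (simp add: power_mult_distrib)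
  finally show ?thesis by (rule power2_le_imp_le) (simp add: m)
qed

context second_order_setting
begin

lemma F_K_invariant:
  assumes "k \<in> K" "g \<in> G"
  shows "F (k ** g) = F g"
proof -
  have "\<pi> (k ** g) *v v = \<pi> k *v (\<pi> g *v v)"
    by (simp add: pi_mult K_in_G assms matrix_vector_mul_assoc)
  moreover have "reg (k ** g) = reg g"
    using assms unitary G_invertible by (intro reg_unitary_left) auto
  ultimately show ?thesis by (simp add: objective_def hnorm_K assms(1))
qed

text \<open>Let \<open>g' g\<^sup>-\<^sup>1 = k exp(X)\<close>. The eigenvalues of \<open>exp(2 X)\<close> and \<open>exp(- 2 X)\<close> are bounded by the squared Frobenius norms
  of \<open>g' g\<^sup>-\<^sup>1\<close> and of its inverse, hence by \<open>reg g' * reg g\<close>.\<close>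

lemma geodesic_between:
  assumes g: "g \<in> G" and g': "g' \<in> G"
  shows "\<exists>X\<in>iLie K. F (hexp 1 X ** g) = F g' \<and> norm X \<le> sqrt (real CARD('n)) * (ln (reg g' * reg g) / 2)"
proof -
  note gi = matrix_inv_inverse[OF G_invertible[OF g]] and g'i = matrix_inv_inverse[OF G_invertible[OF g']]
  define p where "p = g' ** matrix_inv g"
  have p: "p \<in> G" unfolding p_def by (intro G_mult g' subgroup_GL_matrix_inv[OF G_subgroup g])
  obtain k X where k: "k \<in> K" and X: "X \<in> iLie K" and pk: "p = k ** hexp 1 X"
    by (rule polar_decomposition[OF symmetric p]) (auto simp: K_eq)
  have Xh: "dagger X = X" by (rule iLie_hermitian[OF X])
  note ku = unitary_groupD[OF subsetD[OF unitary k]]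
  have "g' = p ** g" unfolding p_def by (simp add: matrix_mul_assoc[symmetric] gi)
  also have "\<dots> = k ** (hexp 1 X ** g)" by (simp add: pk matrix_mul_assoc)
  finally have Fg': "F (hexp 1 X ** g) = F g'" using F_K_invariant[OF k G_mult[OF hexp_in_G[OF X] g]] by simp
  define R where "R = reg g' * reg g"
  have reg_bounds: "(norm g)\<^sup>2 \<le> reg g" "(norm (matrix_inv g))\<^sup>2 \<le> reg g" for g :: "complex^'n^'n"
    by (auto simp: reg_def)
  have n1: "(norm (hexp 1 X))\<^sup>2 \<le> R"
  proof -
    have "norm (hexp 1 X) = norm p" unfolding pk by (rule norm_unitary_mult_left[symmetric]) (rule ku)
    also have "\<dots> \<le> norm g' * norm (matrix_inv g)" unfolding p_def by (rule norm_matrix_mult)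
    finally have "(norm (hexp 1 X))\<^sup>2 \<le> (norm g' * norm (matrix_inv g))\<^sup>2" by (intro power_mono) auto
    also have "\<dots> \<le> R" unfolding R_def power_mult_distrib
      using reg_bounds(1)[of g'] reg_bounds(2)[of g] by (intro mult_mono) (auto intro: order_trans[OF zero_le_power2])
    finally show ?thesis .
  qed
  have n2: "(norm (hexp (- 1) X))\<^sup>2 \<le> R"
  proof -
    have "(hexp (- 1) X ** dagger k) ** p = hexp (- 1) X ** (dagger k ** k) ** hexp 1 X"
      by (simp add: pk matrix_mul_assoc)
    also have "\<dots> = mat 1" using hexp_minus(1)[OF Xh, of 1] by (simp add: ku)
    finally have 1: "matrix_inv p = hexp (- 1) X ** dagger k" by (rule matrix_inv_eqI)
    have "(g ** matrix_inv g') ** p = g ** (matrix_inv g' ** g') ** matrix_inv g"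
      by (simp add: p_def matrix_mul_assoc)
    also have "\<dots> = mat 1" by (simp add: gi g'i)
    finally have 2: "matrix_inv p = g ** matrix_inv g'" by (rule matrix_inv_eqI)
    have "norm (hexp (- 1) X) = norm (matrix_inv p)"
      unfolding 1 by (rule norm_unitary_mult_right[symmetric]) (simp add: ku)
    also have "\<dots> \<le> norm g * norm (matrix_inv g')" unfolding 2 by (rule norm_matrix_mult)
    finally have "(norm (hexp (- 1) X))\<^sup>2 \<le> (norm g * norm (matrix_inv g'))\<^sup>2" by (intro power_mono) auto
    also have "\<dots> \<le> R" unfolding R_def power_mult_distrib mult.commute[of "reg g'"]
      using reg_bounds(1)[of g] reg_bounds(2)[of g'] by (intro mult_mono) (auto intro: order_trans[OF zero_le_power2])
    finally show ?thesis .
  qed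
  obtain U and d' :: "'n \<Rightarrow> real" where U: "dagger U ** U = mat 1" "U ** dagger U = mat 1"
    and d': "X = U ** diagm (\<lambda>i. of_real (d' i)) ** dagger U"
    by (rule hermitian_diagonalization[OF Xh])
  define d :: "real^'n" where "d = (\<chi> i. d' i)"
  have Xd: "X = U ** rdiag d ** dagger U" using d' by (simp add: rdiag_def d_def)
  have nU: "norm (U ** A ** dagger U) = norm A" for A :: "complex^'n^'n"
    using norm_unitary_mult_right[of "dagger U" "U ** A"] norm_unitary_mult_left[OF U(1), of A] U by simp
  have exps: "exp (2 * s * d $ i) \<le> (norm (hexp (of_real s) X))\<^sup>2" for s i
    unfolding Xd hexp_unitary_conj[OF U(1)] nU norm_hexp_rdiag
    by (rule member_le_sum) auto
  have "\<bar>d $ i\<bar> \<le> ln R / 2" for i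
  proof -
    have "exp (2 * d $ i) \<le> R" "exp (- 2 * d $ i) \<le> R"
      using exps[of 1 i] exps[of "- 1" i] n1 n2 by auto
    moreover from this have "R > 0" using exp_gt_zero less_le_trans by blast
    ultimately have "2 * d $ i \<le> ln R" "- 2 * d $ i \<le> ln R" by (simp_all only: ln_ge_iff)
    then show ?thesis by linarith
  qed
  then have "norm d \<le> sqrt (real CARD('n)) * (ln R / 2)" by (rule norm_le_sqrt_dim)
  moreover have "norm X = norm d" unfolding Xd nU by (rule norm_rdiag)
  ultimately show ?thesis using X Fg' unfolding R_def by (intro bexI[of _ X]) auto
qed

lemma iLie_zero: "0 \<in> iLie K"
  by (rule subspace_0[OF subspace_iLie])

lemma robust_bounds:
  assumes g: "g \<in> G" and H: "H \<in> iLie K" and nH: "norm H \<le> 1 / (4 * N)" and s: "0 \<le> s" "s \<le> 1"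
  shows "F (hexp (of_real s) H ** g) \<le> F g + s * gradient_form g H + exp 1 / 2 * s\<^sup>2 * hessian_form g H H"
    and "F (hexp (of_real s) H ** g) \<ge> F g + s * gradient_form g H + 1 / (2 * exp 1) * s\<^sup>2 * hessian_form g H H"
proof -
  have gt: "hexp (of_real t) H ** g \<in> G" for t :: real by (intro G_mult hexp_in_G H g)
  have "\<forall>t. \<exists>D. ((\<lambda>t. hessian_form (hexp (of_real t) H ** g) H H) has_real_derivative D) (at t) \<and>
          \<bar>D\<bar> \<le> (4 * N * norm H) * hessian_form (hexp (of_real t) H ** g) H H"
    using F_derivatives(4)[OF g H] by blast
  then obtain D where D: "\<And>t. ((\<lambda>t. hessian_form (hexp (of_real t) H ** g) H H) has_real_derivative D t) (at t)"
    "\<And>t. \<bar>D t\<bar> \<le> (4 * N * norm H) * hessian_form (hexp (of_real t) H ** g) H H" by metis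
  have \<rho>: "4 * N * norm H \<le> 1" using nH N_half by (simp add: field_simps)
  note b = robust_quadratic_bounds[OF F_derivatives(1)[OF g H] F_derivatives(2)[OF g H] D \<rho> F_derivatives(3)[OF gt H] s]
  show "F (hexp (of_real s) H ** g) \<le> F g + s * gradient_form g H + exp 1 / 2 * s\<^sup>2 * hessian_form g H H"
    using b(1) by simp
  show "F (hexp (of_real s) H ** g) \<ge> F g + s * gradient_form g H + 1 / (2 * exp 1) * s\<^sup>2 * hessian_form g H H"
    using b(2) by simp
qed

lemma second_order_step_exists:
  assumes g: "g \<in> G"
  shows "\<exists>g'. second_order_step K F (4 * N) g g'"
proof -
  let ?q = "quadratic_model (geodesic_gradient K F g) (geodesic_hessian K F g)"
  have "compact (iLie K \<inter> cball 0 (1 / (4 * N)))"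
    by (intro closed_Int_compact closed_subspace subspace_iLie) auto
  moreover have "0 \<in> iLie K \<inter> cball 0 (1 / (4 * N))" using iLie_zero N_half by simp
  moreover have "continuous_on S ?q" for S
  proof -
    have "continuous_on S (\<lambda>H. kron H H)"
      unfolding kron_def by (intro continuous_on_vec_lambda continuous_intros)
    then show ?thesis
      unfolding quadratic_model_def trace_def by (intro continuous_intros)
  qed
  ultimately have "\<exists>H\<in>iLie K \<inter> cball 0 (1 / (4 * N)). \<forall>X\<in>iLie K \<inter> cball 0 (1 / (4 * N)). ?q H \<le> ?q X"
    by (intro continuous_attains_inf) auto
  then obtain H where "H \<in> iLie K \<inter> cball 0 (1 / (4 * N))"
    "\<And>X. X \<in> iLie K \<inter> cball 0 (1 / (4 * N)) \<Longrightarrow> ?q H \<le> ?q X" by blast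
  then have "is_arg_min ?q (\<lambda>H. H \<in> iLie K \<and> norm H \<le> 1 / (4 * N)) H"
    by (auto simp: is_arg_min_def not_less)
  then show ?thesis unfolding second_order_step_def by blast
qed

text \<open>The comparison direction is \<open>s X\<close> with \<open>s = 1 / (4 N D)\<close>, the largest multiple that is certain to lie in the ball
  of radius \<open>1 / (4 N)\<close>. Scaling the minimizer by \<open>1 / e\<^sup>2\<close> balances the factors \<open>e\<close> of the upper and the lower
  quadratic bound: the upper bound at \<open>H / e\<^sup>2\<close> is \<open>F g\<close> plus \<open>1 / e\<^sup>2\<close> times the model value of \<open>H\<close>.\<close>

lemma second_order_step_progress:
  assumes g: "g \<in> G" and step: "second_order_step K F (4 * N) g g'"
    and X: "X \<in> iLie K" and D: "norm X \<le> D" "1 / (4 * N) \<le> D"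
  shows "g' \<in> G" "F g' \<le> F g - 1 / ((exp 1)\<^sup>2 * (4 * N * D)) * (F g - F (hexp 1 X ** g))"
proof -
  let ?q = "quadratic_model (geodesic_gradient K F g) (geodesic_hessian K F g)"
  obtain H where "is_arg_min ?q (\<lambda>H. H \<in> iLie K \<and> norm H \<le> 1 / (4 * N)) H"
    and g'_eq: "g' = mexp ((1 / (exp 1)\<^sup>2) *\<^sub>R H) ** g"
    using step unfolding second_order_step_def by blast
  then have H: "H \<in> iLie K" "norm H \<le> 1 / (4 * N)"
    and min: "\<And>Y. Y \<in> iLie K \<Longrightarrow> norm Y \<le> 1 / (4 * N) \<Longrightarrow> ?q H \<le> ?q Y"
    by (auto simp: is_arg_min_def not_less)
  have g': "g' = hexp (of_real (1 / (exp 1)\<^sup>2)) H ** g" unfolding g'_eq mexp_scaleR_hexp ..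
  then show "g' \<in> G" by (simp add: G_mult hexp_in_G H(1) g)
  have N0: "N > 0" using N_half by simp
  have D0: "D > 0" using D(2) N0 by (smt (verit) divide_pos_pos)
  define s where "s = 1 / (4 * N * D)"
  have s: "0 \<le> s" "s \<le> 1" using D(2) N0 D0 by (auto simp: s_def field_simps)
  have sX: "s *\<^sub>R X \<in> iLie K" by (rule iLie_scaleR[OF X])
  have nsX: "norm (s *\<^sub>R X) \<le> 1 / (4 * N)"
  proof -
    have "norm (s *\<^sub>R X) \<le> s * D" using s(1) D(1) by (simp add: mult_left_mono)
    also have "\<dots> = 1 / (4 * N)" using D0 by (simp add: s_def)
    finally show ?thesis .
  qed
  \<comment> \<open>the minimizer does at least as well as a short piece of the geodesic towards the comparison point\<close>
  have "?q H \<le> ?q (s *\<^sub>R X)" by (rule min[OF sX nsX])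
  also have "\<dots> \<le> F (hexp 1 (s *\<^sub>R X) ** g) - F g"
    using robust_bounds(2)[OF g sX nsX, of 1] by (simp add: quadratic_model_eq[OF g sX])
  also have "\<dots> = F (hexp (of_real s) X ** g) - F (hexp (of_real 0) X ** g)"
    by (simp add: hexp_scaleR)
  also have "\<dots> \<le> s * (F (hexp (of_real 1) X ** g) - F (hexp (of_real 0) X ** g))"
    by (rule second_derivative_nonneg_chord[OF F_derivatives(1)[OF g X] F_derivatives(2)[OF g X] F_derivatives(3) s])
      (intro G_mult hexp_in_G X g, rule X)
  finally have q: "?q H \<le> s * (F (hexp 1 X ** g) - F g)" by simp
  have e: "exp 1 > (0::real)" by simp
  have e1: "1 / (exp 1)\<^sup>2 \<le> (1::real)" by (simp add: power2_eq_square exp_add[symmetric])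
  have "F g' \<le> F g + 1 / (exp 1)\<^sup>2 * gradient_form g H + exp 1 / 2 * (1 / (exp 1)\<^sup>2)\<^sup>2 * hessian_form g H H"
    unfolding g' by (rule robust_bounds(1)[OF g H]) (use e1 in auto)
  also have "\<dots> = F g + 1 / (exp 1)\<^sup>2 * ?q H"
    unfolding quadratic_model_eq[OF g H(1)] by (simp add: field_simps power2_eq_square)
  also have "\<dots> \<le> F g + 1 / (exp 1)\<^sup>2 * (s * (F (hexp 1 X ** g) - F g))"
    using q by (intro add_left_mono mult_left_mono) auto
  also have "\<dots> = F g - 1 / ((exp 1)\<^sup>2 * (4 * N * D)) * (F g - F (hexp 1 X ** g))"
    by (simp add: s_def algebra_simps diff_divide_distrib)
  finally show "F g' \<le> F g - 1 / ((exp 1)\<^sup>2 * (4 * N * D)) * (F g - F (hexp 1 X ** g))" .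
qed

lemma second_order_step_decrease:
  assumes "g \<in> G" "second_order_step K F (4 * N) g g'"
  shows "F g' \<le> F g"
  using second_order_step_progress(2)[OF assms iLie_zero, of "1 / (4 * N)"] N_half
  by (simp add: hexp_zero)

lemma second_order_iterates:
  assumes "gs 0 = mat 1" "\<And>t. t < T \<Longrightarrow> second_order_step K F (4 * N) (gs t) (gs (Suc t))" "t \<le> T"
  shows "gs t \<in> G \<and> F (gs t) \<le> F (mat 1)"
  using assms(3)
proof (induction t)
  case 0
  then show ?case using G_one by (simp add: assms(1))
next
  case (Suc t)
  then have g: "gs t \<in> G" "F (gs t) \<le> F (mat 1)" and step: "second_order_step K F (4 * N) (gs t) (gs (Suc t))"
    using assms(2) by auto
  have "gs (Suc t) \<in> G"
    using second_order_step_progress(1)[OF g(1) step iLie_zero, of "1 / (4 * N)"] N_half by simp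
  then show ?case using second_order_step_decrease[OF g(1) step] g(2) by simp
qed

lemma second_order_results_nonempty: "second_order_results K \<pi> h v (4 * N) \<kappa> \<epsilon> T \<noteq> {}"
proof -
  define gs where "gs = rec_nat (mat 1) (\<lambda>_ g. SOME g'. second_order_step K F (4 * N) g g')"
  have gs0: "gs 0 = mat 1" and gsS: "\<And>t. gs (Suc t) = (SOME g'. second_order_step K F (4 * N) (gs t) g')"
    by (simp_all add: gs_def)
  have step: "second_order_step K F (4 * N) (gs t) (gs (Suc t))" if "gs t \<in> G" for t
    unfolding gsS by (rule someI_ex) (rule second_order_step_exists[OF that])
  have "gs t \<in> G" for t
  proof (induction t)
    case 0
    then show ?case by (simp add: gs0 G_one)
  next
    case (Suc t)
    then show ?case
      using second_order_step_progress(1)[OF Suc step[OF Suc] iLie_zero, of "1 / (4 * N)"] N_half by simp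
  qed
  then show ?thesis using gs0 step unfolding second_order_results_def by blast
qed

text \<open>The logarithmic part of \<open>F\<close> is bounded below by the logarithm of the capacity, which leaves at most
  \<open>C + (\<epsilon> / \<kappa>) reg 1\<close> for the regularizer.\<close>

lemma reg_bound_of_decrease:
  assumes g: "g \<in> G" "F g \<le> F (mat 1)" and C: "C \<ge> ln (hnorm h v / capacity G \<pi> h v)"
  shows "reg g \<le> \<kappa> * C / \<epsilon> + 2 * real CARD('n)"
proof -
  let ?cap = "capacity G \<pi> h v"
  have hv: "hnorm h v > 0" using hnorm_pi_pos(2)[OF cap_pos G_one] by (simp add: pi_one)
  have "ln ?cap \<le> ln (hnorm h (\<pi> g *v v))"
    using hnorm_pi_pos[OF cap_pos g(1)] cap_pos by simp
  moreover have "ln (hnorm h v) - ln ?cap \<le> C" using C hv cap_pos by (simp add: ln_div)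
  ultimately have "\<epsilon> / \<kappa> * reg g \<le> C + \<epsilon> / \<kappa> * (2 * real CARD('n))"
    using g(2) by (simp add: objective_def pi_one reg_one)
  then have "\<kappa> / \<epsilon> * (\<epsilon> / \<kappa> * reg g) \<le> \<kappa> / \<epsilon> * (C + \<epsilon> / \<kappa> * (2 * real CARD('n)))"
    using \<kappa> \<epsilon> by (intro mult_left_mono) auto
  then show ?thesis using \<kappa> \<epsilon> by (simp add: distrib_left)
qed

end

theorem theorem5p7:
  fixes G K TK :: "(complex^'n^'n) set"
    and \<pi> :: "complex^'n^'n \<Rightarrow> complex^'m^'m"
    and h :: "complex^'m \<Rightarrow> complex^'m \<Rightarrow> complex"
    and v :: "complex^'m"
    and n \<epsilon> C \<gamma> N \<kappa> :: real
    and T :: nat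
  assumes "symmetric_subgroup G"
    and "K = G \<inter> unitary_group"
    and "maximal_torus K TK"
    and "TK \<subseteq> diagonal_matrices"
    and "rational_representation G \<pi>"
    and "hermitian_inner_product h"
    and "invariant_inner_product K \<pi> h"
    and "capacity G \<pi> h v > 0"
    and "0 < \<epsilon>" and "\<epsilon> < 1 / 2"
    and "C \<ge> ln (hnorm h v / capacity G \<pi> h v)"
    and "n = real CARD('n)"
    and "\<gamma> = real_of_ereal (min (weight_margin TK \<pi>) 1)"
    and "N = max (weight_norm K \<pi> h) (1 / 2)"
    and "\<kappa> = 2 * n * (exp (2 * C) / (2 * \<epsilon>)) powr (1 / \<gamma>)"
    and "real T \<ge> 24 * (exp 1)\<^sup>2 * (N * sqrt n / \<gamma>) * (ln (n / \<epsilon>) + C) * ln (C / \<epsilon>)"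
  shows "second_order_results K \<pi> h v (4 * N) \<kappa> \<epsilon> T \<noteq> {} \<and>
         (\<forall>g\<in>second_order_results K \<pi> h v (4 * N) \<kappa> \<epsilon> T.
            g \<in> G \<and> ln (hnorm h (\<pi> g *v v)) \<le> ln (capacity G \<pi> h v) + 3 * \<epsilon>)"
proof -
  note G = assms(1) and K = assms(2) and cap = assms(8) and \<epsilon> = assms(9,10) and C = assms(11) and T = assms(16)
  interpret hermitian_form h by (rule hermitian_form.intro[OF assms(6)])
  interpret symmetric_representation h G K \<pi>
    by (intro symmetric_representation.intro symmetric_representation_axioms.intro hermitian_form_axioms assms)
  interpret torus_representation h G K TK \<pi>
    by (intro torus_representation.intro maximal_diagonal_torus.intro maximal_diagonal_torus_axioms.intro
        symmetric_representation_axioms compact_matrix_group_axioms assms)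
  obtain B \<omega> where basis: "orthonormal B" "\<And>x. x = (\<Sum>b\<in>B. h b x *s b)" "\<And>b. b \<in> B \<Longrightarrow> \<omega> b \<in> E"
    "\<And>b x. b \<in> B \<Longrightarrow> x \<in> E \<Longrightarrow> dpi (rdiag x) *v b = of_real (x \<bullet> \<omega> b) *s b"
    by (rule weight_basis) blast
  note \<gamma> = weight_margin_properties(1,2)[OF basis assms(13)]
  let ?cap = "capacity G \<pi> h v"
  have n: "n \<ge> 1" using assms(12) by (simp add: Suc_le_eq)
  have hv: "?cap \<le> hnorm h v" using hnorm_pi_pos(1)[OF cap G_one] by (simp add: pi_one)
  then have "ln (hnorm h v / ?cap) \<ge> 0" using cap by simp
  then have C0: "C \<ge> 0" using C by linarith
  have lnv: "ln (hnorm h v) \<le> ln ?cap + C" using C hv cap by (simp add: ln_div)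
  note cond = log_condition_bound[OF n \<epsilon> C0 \<gamma>, folded assms(15)]
  have \<kappa>0: "\<kappa> > 0" using cond(1) n by linarith
  interpret second_order_setting h G K \<pi> v \<kappa> \<epsilon> N
    by (intro second_order_setting.intro second_order_setting_axioms.intro symmetric_representation_axioms)
      (use cap \<kappa>0 \<epsilon> assms(14) in auto)
  note \<epsilon> = assms(9,10)
  have N0: "N > 0" using N_half by simp
  have F1: "F (mat 1) \<le> ln ?cap + C + \<epsilon>"
  proof -
    have r1: "reg (mat 1 :: complex^'n^'n) = 2 * n" by (simp add: reg_one assms(12))
    have "\<epsilon> / \<kappa> * (2 * n) \<le> \<epsilon> / \<kappa> * \<kappa>" using cond(1) \<epsilon> \<kappa>0 by (intro mult_left_mono) auto
    then have "\<epsilon> / \<kappa> * (2 * n) \<le> \<epsilon>" using \<kappa>0 by simp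
    then show ?thesis using lnv by (simp add: objective_def pi_one r1)
  qed
  have ln_le_F: "ln (hnorm h (\<pi> g *v v)) \<le> F g" for g
    using \<epsilon> \<kappa>0 by (simp add: objective_def reg_def)
  have "g \<in> G \<and> ln (hnorm h (\<pi> g *v v)) \<le> ln ?cap + 3 * \<epsilon>"
    if res: "g \<in> second_order_results K \<pi> h v (4 * N) \<kappa> \<epsilon> T" for g
  proof -
    obtain gs where gT: "g = gs T" and gs0: "gs 0 = mat 1"
      and step: "\<And>t. t < T \<Longrightarrow> second_order_step K F (4 * N) (gs t) (gs (Suc t))"
      using res unfolding second_order_results_def by blast
    note it = second_order_iterates[OF gs0 step]
    have gG: "gs t \<in> G" "F (gs t) \<le> F (mat 1)" if "t \<le> T" for t using it[OF _ that] by auto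
    \<comment> \<open>if \<open>C \<le> \<epsilon>\<close>, already the starting point is good enough, and \<open>F\<close> never increases\<close>
    have "F (gs T) \<le> ln ?cap + 3 * \<epsilon>"
    proof (cases "C \<le> \<epsilon>")
      case True
      then show ?thesis using gG(2)[OF order_refl] F1 \<epsilon>(1) by linarith
    next
      case False
      then have C\<epsilon>: "C > \<epsilon>" by simp
      have Cpos: "C > 0" using C\<epsilon> \<epsilon> by linarith
      \<comment> \<open>the decay factor \<open>\<epsilon> / C\<close> turns the initial gap \<open>C - \<epsilon>\<close> into \<open>\<epsilon> - \<epsilon>\<^sup>2 / C\<close>, which leaves this slack\<close>
      define \<delta> where "\<delta> = \<epsilon>\<^sup>2 / C"
      have \<delta>: "\<delta> > 0" using Cpos \<epsilon> by (simp add: \<delta>_def)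
      obtain g' where g': "g' \<in> G" "reg g' \<le> \<kappa>" "ln (hnorm h (\<pi> g' *v v)) \<le> ln ?cap + \<epsilon> + \<delta>"
        using near_optimal_element[OF cap \<epsilon> C assms(13) \<delta>] assms(12,15) by auto
      have Fg': "F g' \<le> ln ?cap + 2 * \<epsilon> + \<delta>"
      proof -
        have "\<epsilon> / \<kappa> * reg g' \<le> \<epsilon> / \<kappa> * \<kappa>" using g'(2) \<epsilon> \<kappa>0 by (intro mult_left_mono) auto
        then have "\<epsilon> / \<kappa> * reg g' \<le> \<epsilon>" using \<kappa>0 by simp
        then show ?thesis using g'(3) by (simp add: objective_def)
      qed
      define L where "L = \<kappa> * (\<kappa> * C / \<epsilon> + 2 * n)"
      \<comment> \<open>a bound for the distance from every iterate to the comparison point\<close>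
      define D where "D = max (sqrt n * (ln L / 2)) (1 / (4 * N))"
      have D0: "D > 0" "1 / (4 * N) \<le> D" using N0 by (auto simp: D_def less_max_iff_disj)
      define a where "a = 1 / ((exp 1)\<^sup>2 * (4 * N * D))"
      have a0: "a \<ge> 0" using N0 D0 by (simp add: a_def)
      have a1: "a \<le> 1"
      proof -
        have "1 \<le> 4 * N * D" using D0 N0 by (simp add: field_simps)
        moreover have "1 \<le> (exp (1::real))\<^sup>2" by (simp add: power2_eq_square exp_add[symmetric])
        ultimately have "1 * 1 \<le> (exp 1)\<^sup>2 * (4 * N * D)" by (intro mult_mono) auto
        moreover have "1 / x \<le> 1" if "1 * 1 \<le> x" for x :: real using that by simp
        ultimately show ?thesis unfolding a_def by blast
      qed
      define \<Phi> where "\<Phi> t = F (gs t) - (ln ?cap + 2 * \<epsilon> + \<delta>)" for t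
      have contract: "\<Phi> (Suc t) \<le> (1 - a) * \<Phi> t" if t: "t < T" for t
      proof -
        have gt: "gs t \<in> G" "F (gs t) \<le> F (mat 1)" using gG[of t] t by auto
        obtain X where X: "X \<in> iLie K" "F (hexp 1 X ** gs t) = F g'"
          "norm X \<le> sqrt (real CARD('n)) * (ln (reg g' * reg (gs t)) / 2)"
          using geodesic_between[OF gt(1) g'(1)] by blast
        have "norm X \<le> D"
        proof (cases "reg g' * reg (gs t) > 0")
          case True
          have "reg g' * reg (gs t) \<le> L"
            unfolding L_def using g'(2) reg_bound_of_decrease[OF gt C] assms(12) \<kappa>0
            by (intro mult_mono) (auto simp: reg_def)
          then have "ln (reg g' * reg (gs t)) \<le> ln L" using True by (subst ln_le_cancel_iff) auto
          then have "sqrt n * (ln (reg g' * reg (gs t)) / 2) \<le> sqrt n * (ln L / 2)"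
            using n by (intro mult_left_mono) auto
          then have "norm X \<le> sqrt n * (ln L / 2)" using X(3) unfolding assms(12) by (rule order_trans[rotated])
          then show ?thesis unfolding D_def by (rule order_trans) (rule max.cobounded1)
        next
          case False
          moreover have "reg g' * reg (gs t) \<ge> 0" by (simp add: reg_def)
          ultimately have "reg g' * reg (gs t) = 0" by linarith
          then have "norm X \<le> 0" using X(3) by (simp only: ln_0 div_0 mult_zero_right)
          then show ?thesis using D0(1) by linarith
        qed
        from second_order_step_progress(2)[OF gt(1) step[OF t] X(1) this D0(2)]
        have "F (gs (Suc t)) \<le> F (gs t) - a * (F (gs t) - F g')" by (simp add: X(2) a_def)
        also have "\<dots> \<le> F (gs t) - a * (F (gs t) - (ln ?cap + 2 * \<epsilon> + \<delta>))"
          using Fg' a0 by (intro diff_left_mono mult_left_mono) auto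
        finally show ?thesis by (simp add: \<Phi>_def algebra_simps)
      qed
      have pow: "\<Phi> t \<le> (1 - a) ^ t * \<Phi> 0" if "t \<le> T" for t
        using that
      proof (induction t)
        case (Suc t)
        have "\<Phi> (Suc t) \<le> (1 - a) * \<Phi> t" using contract Suc.prems by simp
        also have "\<dots> \<le> (1 - a) * ((1 - a) ^ t * \<Phi> 0)"
          using Suc a1 by (intro mult_left_mono) auto
        finally show ?case by simp
      qed simp
      have rate: "ln (C / \<epsilon>) \<le> a * real T"
      proof -
        have lnC: "ln (C / \<epsilon>) > 0" using C\<epsilon> \<epsilon> by simp
        have "4 * N * D \<le> 24 * (N * sqrt n / \<gamma>) * (ln (n / \<epsilon>) + C)"
        proof -
          have base: "1 / 2 \<le> ln (n / \<epsilon>)"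
          proof -
            have "ln 2 \<le> ln (n / \<epsilon>)" using n \<epsilon> by (subst ln_le_cancel_iff) (auto simp: le_divide_eq)
            then show ?thesis using ln2_ge_two_thirds by linarith
          qed
          have s1: "N * sqrt n / \<gamma> \<ge> 1 / 2"
          proof -
            have "1 / 2 * 1 \<le> N * sqrt n" using N_half n by (intro mult_mono) auto
            moreover have "N * sqrt n \<le> N * sqrt n / \<gamma>"
              using mult_left_le[OF \<gamma>(2), of "N * sqrt n"] \<gamma>(1) N0 n by (simp add: pos_le_divide_eq)
            ultimately show ?thesis by linarith
          qed
          have "4 * N * (1 / (4 * N)) \<le> 24 * (N * sqrt n / \<gamma>) * (ln (n / \<epsilon>) + C)"
          proof -
            have "24 * (1 / 2) * (1 / 2) \<le> 24 * (N * sqrt n / \<gamma>) * (ln (n / \<epsilon>) + C)"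
              using s1 base C0 by (intro mult_mono) auto
            then show ?thesis using N0 by simp
          qed
          moreover have "4 * N * (sqrt n * (ln L / 2)) \<le> 24 * (N * sqrt n / \<gamma>) * (ln (n / \<epsilon>) + C)"
          proof -
            have "(2 * N * sqrt n) * ln L \<le> (2 * N * sqrt n) * (12 / \<gamma> * (ln (n / \<epsilon>) + C))"
              unfolding L_def using cond(2) N0 n by (intro mult_left_mono) auto
            then show ?thesis by (simp add: algebra_simps)
          qed
          ultimately show ?thesis unfolding D_def by (simp add: max_def)
        qed
        then have "(exp 1)\<^sup>2 * (4 * N * D) * ln (C / \<epsilon>)
            \<le> (exp 1)\<^sup>2 * (24 * (N * sqrt n / \<gamma>) * (ln (n / \<epsilon>) + C)) * ln (C / \<epsilon>)"
          using lnC by (intro mult_right_mono mult_left_mono) auto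
        also have "\<dots> = 24 * (exp 1)\<^sup>2 * (N * sqrt n / \<gamma>) * (ln (n / \<epsilon>) + C) * ln (C / \<epsilon>)"
          by (simp only: mult_ac)
        also have "\<dots> \<le> real T" by (rule T)
        finally show ?thesis using N0 D0 by (simp add: a_def field_simps)
      qed
      have "(1 - a) ^ T \<le> \<epsilon> / C"
      proof -
        have "(1 - a) ^ T \<le> exp (- a) ^ T"
          using exp_ge_add_one_self[of "- a"] a1 by (intro power_mono) auto
        also have "\<dots> = exp (- (a * real T))" by (simp add: exp_of_nat_mult[symmetric] mult.commute)
        also have "\<dots> \<le> exp (- ln (C / \<epsilon>))" using rate by simp
        also have "\<dots> = \<epsilon> / C" using Cpos \<epsilon> by (simp add: exp_minus)
        finally show ?thesis .
      qed
      moreover have "\<Phi> 0 \<le> C - \<epsilon>" using F1 \<delta> by (simp add: \<Phi>_def gs0)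
      ultimately have "(1 - a) ^ T * \<Phi> 0 \<le> \<epsilon> / C * (C - \<epsilon>)"
      proof -
        have "(1 - a) ^ T * \<Phi> 0 \<le> (1 - a) ^ T * (C - \<epsilon>)"
          using \<open>\<Phi> 0 \<le> C - \<epsilon>\<close> a1 by (intro mult_left_mono) auto
        also have "\<dots> \<le> \<epsilon> / C * (C - \<epsilon>)"
          using \<open>(1 - a) ^ T \<le> \<epsilon> / C\<close> C\<epsilon> by (intro mult_right_mono) auto
        finally show ?thesis .
      qed
      also have "\<epsilon> / C * (C - \<epsilon>) = \<epsilon> - \<delta>" using Cpos by (simp add: \<delta>_def field_simps power2_eq_square)
      finally have "\<Phi> T \<le> \<epsilon> - \<delta>" using pow[of T] by simp
      then show ?thesis by (simp add: \<Phi>_def)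
    qed
    then show ?thesis using gG(1)[OF order_refl] ln_le_F[of "gs T"] by (simp add: gT)
  qed
  then show ?thesis using second_order_results_nonempty by blast
qed

end
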